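(* Let $\tilde p:[0,c]\to\tilde A$ be a piecewise-linear path, parametrized with unit speed, in an apartment $\tilde A\subset X$, such that $\tilde p'_-(t)\sim_{W_{sph}}\tilde p'_+(t)$ for each $t$ (for instance, $\tilde p$ a geodesic path). Let $g=\mathrm{Fold}_{z,h,\Delta}:X\to\Delta$ be a folding of $X$ into the Weyl chamber $\Delta$. Then the folded path $p=g(\tilde p)$ satisfies the chain condition.
   Context: $R$ is a root system on a Euclidean vector space $V$ (roots are linear functionals), $W_{sph}$ its finite Weyl group, $\Delta\subset V$ the positive Weyl chamber, $R^+$ the positive roots, $\tau_\beta(v)=v-\beta(v)\beta^\vee$. $A$ is the affine space of $V$, with origin $o$, and $W=W_{aff}$ is the group generated by the reflections in the walls $\{\alpha=t\}$, $\alpha\in R$, $t\in\mathbb{Z}$. $X$ is a Euclidean building modeled on $(A,W_{aff})$, with the model apartment $A$ identified with an apartment of $X$, so $\Delta\subset A\subset X$ has its tip at the special vertex $o$. Foldings: for an alcove $a\subset A$, the retraction $\mathrm{Fold}_{a,A}:X\to A$ sends $x$ to $\phi(x)$, where $A_x$ is any apartment containing $x$ and $a$, and $\phi:A_x\to A$ is the unique isomorphism fixing $A\cap A_x$ pointwise. A dilation $h\in\mathrm{Dil}(A,W_{aff})$ is a composition of a translation and a similarity $v\mapsto\lambda v$ ($\lambda>0$) with $hW_{aff}h^{-1}\subset W_{aff}$. $\mathbb{P}:A\to\Delta$ sends $x$ to the unique point of $W_{sph}\cdot x\cap\Delta$. For a vertex $z\in A$ (not necessarily special), a dilation $h\in\mathrm{Dil}(A,W_{aff})$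 with $h(z)=o$, and any alcove $a\subset A$ containing $z$, $\mathrm{Fold}_{z,h,\Delta}:=\mathbb{P}\circ h\circ\mathrm{Fold}_{a,A}$ (independent of the choice of $a$). Relations: $\mu\sim_{W_{sph}}\nu$ for nonzero vectors means that they lie in a common closed Weyl chamber of $W_{sph}$ (in $\tilde A$ this is understood via a chart identifying $\tilde A$ with $A$). For $x\in A$ and nonzero $\nu,\mu\in V$, $\nu\geq_{W_x}\mu$ means there are vectors $\nu=\eta_0,\dots,\eta_m=\mu$ ($m\geq0$) and roots $\beta_i\in R^+$ with $\beta_i(x)\in\mathbb{Z}$, $\beta_i(\eta_{i-1})<0$, $\eta_i=\tau_{\beta_i}(\eta_{i-1})$. A piecewise-linear path $p$ in $A$ satisfies the chain condition if at each interior parameter $t$, with one-sided unit tangent directions $\nu=p'_-(t)/|p'_-(t)|$, $\eta=p'_+(t)/|p'_+(t)|$, there is a unit vector $\mu$ with $\nu\geq_{W_{p(t)}}\mu$ and $\mu\sim_{W_{sph}}\eta$. *)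

theory Defs
  imports "HOL-Analysis.Analysis"
begin

text \<open>
  The dual space \<open>V\<^sup>*\<close> is the type \<open>'v \<Rightarrow>\<^sub>L real\<close>, whose elements are applied to vectors through the
  library coercion \<open>blinfun_apply\<close>.  The affine space \<open>A\<close> is identified with \<open>V\<close>, its origin \<open>o\<close>
  being \<open>0\<close>.
\<close>

section \<open>Root systems\<close>

text \<open>\<open>adjoint \<alpha> 1\<close> is the vector representing \<open>\<alpha>\<close> with respect to the inner product.\<close>

definition coroot :: "('v::euclidean_space \<Rightarrow>\<^sub>L real) \<Rightarrow> 'v" where
  "coroot \<alpha> = (let g = adjoint (blinfun_apply \<alpha>) 1 in (2 / (g \<bullet> g)) *\<^sub>R g)"

definition root_system :: "('v::euclidean_space \<Rightarrow>\<^sub>L real) set \<Rightarrow> bool" where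
  "root_system R \<longleftrightarrow>
     finite R \<and> span R = UNIV \<and> 0 \<notin> R \<and>
     (\<forall>\<alpha>\<in>R. \<forall>\<beta>\<in>R. \<beta> - blinfun_apply \<beta> (coroot \<alpha>) *\<^sub>R \<alpha> \<in> R) \<and>
     (\<forall>\<alpha>\<in>R. \<forall>\<beta>\<in>R. \<beta> (coroot \<alpha>) \<in> \<int>)"

definition \<tau> :: "('v::euclidean_space \<Rightarrow>\<^sub>L real) \<Rightarrow> 'v \<Rightarrow> 'v" where
  "\<tau> \<beta> v = v - \<beta> v *\<^sub>R coroot \<beta>"

definition wall :: "('v::euclidean_space \<Rightarrow>\<^sub>L real) \<Rightarrow> int \<Rightarrow> 'v set" where
  "wall \<alpha> k = {x. \<alpha> x = of_int k}"

definition wall_reflection :: "('v::euclidean_space \<Rightarrow>\<^sub>L real) \<Rightarrow> int \<Rightarrow> 'v \<Rightarrow> 'v" where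
  "wall_reflection \<alpha> k x = x - (\<alpha> x - of_int k) *\<^sub>R coroot \<alpha>"

definition walls :: "('v::euclidean_space \<Rightarrow>\<^sub>L real) set \<Rightarrow> 'v set set" where
  "walls R = {wall \<alpha> k |\<alpha> k. \<alpha> \<in> R}"

text \<open>Closure under inverses is omitted: the generators used below are involutions.\<close>

inductive_set group_generated_by :: "('v \<Rightarrow> 'v) set \<Rightarrow> ('v \<Rightarrow> 'v) set" for S where
  one: "id \<in> group_generated_by S"
| step: "s \<in> S \<Longrightarrow> w \<in> group_generated_by S \<Longrightarrow> s \<circ> w \<in> group_generated_by S"

definition W_sph :: "('v::euclidean_space \<Rightarrow>\<^sub>L real) set \<Rightarrow> ('v \<Rightarrow> 'v) set" where
  "W_sph R = group_generated_by (\<tau> ` R)"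

definition W_aff :: "('v::euclidean_space \<Rightarrow>\<^sub>L real) set \<Rightarrow> ('v \<Rightarrow> 'v) set" where
  "W_aff R = group_generated_by {wall_reflection \<alpha> k |\<alpha> k. \<alpha> \<in> R}"

text \<open>Weyl chambers and alcoves are closed.\<close>

definition weyl_chambers :: "('v::euclidean_space \<Rightarrow>\<^sub>L real) set \<Rightarrow> 'v set set" where
  "weyl_chambers R = closure ` components (- (\<Union>\<alpha>\<in>R. wall \<alpha> 0))"

definition alcoves :: "('v::euclidean_space \<Rightarrow>\<^sub>L real) set \<Rightarrow> 'v set set" where
  "alcoves R = closure ` components (- \<Union>(walls R))"

definition positive_roots ::
    "('v::euclidean_space \<Rightarrow>\<^sub>L real) set \<Rightarrow> 'v set \<Rightarrow> ('v \<Rightarrow>\<^sub>L real) set" where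
  "positive_roots R \<Delta> = {\<alpha> \<in> R. \<forall>v\<in>\<Delta>. 0 \<le> \<alpha> v}"

definition is_vertex :: "('v::euclidean_space \<Rightarrow>\<^sub>L real) set \<Rightarrow> 'v \<Rightarrow> bool" where
  "is_vertex R z \<longleftrightarrow> \<Inter>{H \<in> walls R. z \<in> H} = {z}"

definition Dil :: "('v::euclidean_space \<Rightarrow>\<^sub>L real) set \<Rightarrow> ('v \<Rightarrow> 'v) set" where
  "Dil R = {h. (\<exists>l>0. \<exists>b. h = (\<lambda>x. l *\<^sub>R x + b)) \<and> (\<forall>w\<in>W_aff R. h \<circ> w \<circ> inv h \<in> W_aff R)}"

definition proj_chamber :: "('v::euclidean_space \<Rightarrow>\<^sub>L real) set \<Rightarrow> 'v set \<Rightarrow> 'v \<Rightarrow> 'v" where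
  "proj_chamber R \<Delta> x = (THE y. y \<in> (\<lambda>w. w x) ` W_sph R \<inter> \<Delta>)"

section \<open>Euclidean buildings and foldings\<close>

text \<open>
  A building is given by its atlas of charts \<open>A \<rightarrow> X\<close>, where \<open>X\<close> is the whole type \<open>'x\<close>.
  The last two conditions imply that any two points, and more generally any two closed faces, lie
  in a common apartment.  Thickness is not required.
\<close>

definition euclidean_building ::
    "('v::euclidean_space \<Rightarrow>\<^sub>L real) set \<Rightarrow> ('v \<Rightarrow> 'x::metric_space) set \<Rightarrow> bool" where
  "euclidean_building R charts \<longleftrightarrow>
     (\<forall>f\<in>charts. \<forall>u v. dist (f u) (f v) = dist u v) \<and>
     (\<forall>f\<in>charts. \<forall>w\<in>W_aff R. f \<circ> w \<in> charts) \<and>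
     (\<forall>f\<in>charts. \<forall>f'\<in>charts. \<exists>w\<in>W_aff R. \<forall>u v. f u = f' v \<longrightarrow> v = w u) \<and>
     (\<Union>f\<in>charts. range f) = UNIV \<and>
     (\<forall>f\<in>charts. \<forall>f'\<in>charts. \<forall>a\<in>alcoves R. \<forall>a'\<in>alcoves R.
        \<exists>k\<in>charts. f ` a \<union> f' ` a' \<subseteq> range k)"

definition apartments :: "('v \<Rightarrow> 'x) set \<Rightarrow> 'x set set" where
  "apartments charts = range ` charts"

text \<open>Only the values of \<open>\<phi>\<close> on \<open>B\<close> matter.\<close>

definition apartment_iso :: "('v \<Rightarrow> 'x) set \<Rightarrow> 'x set \<Rightarrow> 'x set \<Rightarrow> ('x \<Rightarrow> 'x) \<Rightarrow> bool" where
  "apartment_iso charts B C \<phi> \<longleftrightarrow>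
     (\<exists>f\<in>charts. range f = B \<and> \<phi> \<circ> f \<in> charts \<and> range (\<phi> \<circ> f) = C)"

text \<open>
  \<open>\<iota>\<close> is the chart identifying the model apartment \<open>A\<close> with an apartment of \<open>X\<close>; the value of
  the folding is the point of \<open>A\<close> that \<open>\<iota>\<close> identifies with \<open>\<phi> x\<close>.
\<close>

definition Fold_alcove :: "('v \<Rightarrow> 'x) set \<Rightarrow> ('v \<Rightarrow> 'x) \<Rightarrow> 'v set \<Rightarrow> 'x \<Rightarrow> 'v" where
  "Fold_alcove charts \<iota> a x =
     (THE y. \<exists>B\<in>apartments charts. \<exists>\<phi>.
        x \<in> B \<and> \<iota> ` a \<subseteq> B \<and> apartment_iso charts B (range \<iota>) \<phi> \<and>
        (\<forall>b \<in> range \<iota> \<inter> B. \<phi> b = b) \<and> \<iota> y = \<phi> x)"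

text \<open>The map \<open>Fold\<^bsub>z,h,\<Delta>\<^esub>\<close>, computed from an alcove \<open>a\<close> containing \<open>z\<close>.\<close>

definition Fold_chamber ::
    "('v::euclidean_space \<Rightarrow>\<^sub>L real) set \<Rightarrow> 'v set \<Rightarrow> ('v \<Rightarrow> 'x) set \<Rightarrow> ('v \<Rightarrow> 'x) \<Rightarrow>
     ('v \<Rightarrow> 'v) \<Rightarrow> 'v set \<Rightarrow> 'x \<Rightarrow> 'v" where
  "Fold_chamber R \<Delta> charts \<iota> h a = proj_chamber R \<Delta> \<circ> h \<circ> Fold_alcove charts \<iota> a"

section \<open>Paths and the chain condition\<close>

text \<open>
  A path on \<open>[0,c]\<close> is a total function of which only the values on \<open>{0..c}\<close> matter.  The set \<open>S\<close>
  contains the break points; as the intervals \<open>{a..b}\<close> are closed, the path is continuous.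
\<close>

definition piecewise_linear :: "real \<Rightarrow> (real \<Rightarrow> 'v::real_normed_vector) \<Rightarrow> bool" where
  "piecewise_linear c p \<longleftrightarrow>
     (\<exists>S. finite S \<and>
        (\<forall>a b. 0 \<le> a \<and> a \<le> b \<and> b \<le> c \<and> {a<..<b} \<inter> S = {} \<longrightarrow>
           (\<exists>u v. \<forall>t\<in>{a..b}. p t = u + t *\<^sub>R v)))"

text \<open>Both one-sided derivatives point forward: they coincide where the path is differentiable.\<close>

definition deriv_left :: "(real \<Rightarrow> 'v::real_normed_vector) \<Rightarrow> real \<Rightarrow> 'v" where
  "deriv_left p t = vector_derivative p (at_left t)"

definition deriv_right :: "(real \<Rightarrow> 'v::real_normed_vector) \<Rightarrow> real \<Rightarrow> 'v" where
  "deriv_right p t = vector_derivative p (at_right t)"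

definition unit_speed :: "real \<Rightarrow> (real \<Rightarrow> 'v::real_normed_vector) \<Rightarrow> bool" where
  "unit_speed c p \<longleftrightarrow>
     (\<forall>t\<in>{0<..c}. norm (deriv_left p t) = 1) \<and> (\<forall>t\<in>{0..<c}. norm (deriv_right p t) = 1)"

definition same_chamber :: "('v::euclidean_space \<Rightarrow>\<^sub>L real) set \<Rightarrow> 'v \<Rightarrow> 'v \<Rightarrow> bool" where
  "same_chamber R \<mu> \<nu> \<longleftrightarrow> \<mu> \<noteq> 0 \<and> \<nu> \<noteq> 0 \<and> (\<exists>C\<in>weyl_chambers R. \<mu> \<in> C \<and> \<nu> \<in> C)"

definition chain_step ::
    "('v::euclidean_space \<Rightarrow>\<^sub>L real) set \<Rightarrow> 'v set \<Rightarrow> 'v \<Rightarrow> 'v \<Rightarrow> 'v \<Rightarrow> bool" where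
  "chain_step R \<Delta> x \<eta> \<eta>' \<longleftrightarrow>
     (\<exists>\<beta>\<in>positive_roots R \<Delta>. blinfun_apply \<beta> x \<in> \<int> \<and> blinfun_apply \<beta> \<eta> < 0 \<and> \<eta>' = \<tau> \<beta> \<eta>)"

definition chain_ge ::
    "('v::euclidean_space \<Rightarrow>\<^sub>L real) set \<Rightarrow> 'v set \<Rightarrow> 'v \<Rightarrow> 'v \<Rightarrow> 'v \<Rightarrow> bool" where
  "chain_ge R \<Delta> x \<nu> \<mu> \<longleftrightarrow> \<nu> \<noteq> 0 \<and> \<mu> \<noteq> 0 \<and> (chain_step R \<Delta> x)\<^sup>*\<^sup>* \<nu> \<mu>"

text \<open>\<open>sgn v\<close> is the unit vector \<open>v / norm v\<close>.\<close>

definition chain_condition ::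
    "('v::euclidean_space \<Rightarrow>\<^sub>L real) set \<Rightarrow> 'v set \<Rightarrow> real \<Rightarrow> (real \<Rightarrow> 'v) \<Rightarrow> bool" where
  "chain_condition R \<Delta> c p \<longleftrightarrow>
     piecewise_linear c p \<and>
     (\<forall>t\<in>{0<..<c}. \<exists>\<mu>. norm \<mu> = 1 \<and>
        chain_ge R \<Delta> (p t) (sgn (deriv_left p t)) \<mu> \<and>
        same_chamber R \<mu> (sgn (deriv_right p t)))"

end

theory Submission
  imports Defs
begin

text \<open>
  Let \<open>x\<close> be a point of the apartment that carries the path, identified with \<open>V\<close> by the chart \<open>f\<close>,
  and let \<open>G\<close> be the folding in these coordinates: the retraction to the model apartment, followed
  by the dilation \<open>h\<close> with ratio \<open>l\<close> and by the projection to the chamber \<open>\<Delta>\<close>.  Near \<open>x\<close>, the map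
  \<open>G\<close> is affine on every Weyl chamber \<open>C\<close> with tip \<open>x\<close>, with linear part \<open>l u\<^sub>C\<close> for some \<open>u\<^sub>C\<close> in
  the finite Weyl group: the retraction is given by one element of the affine Weyl group there
  (\<open>Fold_germ\<close>), and the projection by one element of the finite one (\<open>proj_chamber_germ\<close>).  In
  particular the folded path is piecewise linear.  If the path has the one-sided directions \<open>v\<close> and
  \<open>v'\<close> at \<open>x\<close>, both in a chamber \<open>C\<close>, then the folded path has the directions \<open>u v\<close> and
  \<open>u\<^sub>C v'\<close>, where \<open>l u\<close> is the linear part of \<open>G\<close> on \<open>- C\<close>.  The vector \<open>u\<^sub>C v\<close> lies in a common chamber with
  the latter, so that everything reduces to a chain from \<open>u v\<close> to \<open>u\<^sub>C v\<close>.

  The chain is obtained from a gallery of Weyl chambers at \<open>x\<close> that leads from \<open>- C\<close> to \<open>C\<close> and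
  crosses no wall twice (\<open>gallery_chain\<close>).  Whenever it crosses a panel, the linear part either stays
  the same or is multiplied by a reflection, because the linear parts on the two sides agree on the
  panel.  If it is reflected, then the common image of the two chambers lies in \<open>\<Delta>\<close>, on the positive
  side of the root \<open>\<beta>\<close> of the reflection, so that \<open>\<beta>\<close> is a positive root; and since \<open>v\<close> does not point
  to the side of the wall on which the first of the two chambers lies, \<open>\<beta>\<close> is not positive at the current
  direction.  So the reflection is a step of a chain, or does not change the direction
  (\<open>panel_crossing\<close>).  Two points remain.

  The wall of \<open>\<beta>\<close> passes through the folded point.  If the projection causes the fold, then \<open>\<beta>\<close>
  vanishes there.  If the retraction causes it, then the reflection is conjugate to an element of the
  affine Weyl group, and all reflections of that group are reflections in walls
  (\<open>W_aff_reflection_is_wall_reflection\<close>).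

  The common image lies on the positive side of \<open>\<beta>\<close>.  This is clear for the projection.  For the
  retraction it says that the fold opens away from \<open>z\<close>, the point that \<open>h\<close> takes to the tip of \<open>\<Delta>\<close>
  (\<open>fold_away_from_centre\<close>).  It follows from the uniqueness of geodesics
  (\<open>charts_agree_on_segment\<close>), which holds because the retraction does not increase distances.

  That \<open>\<Delta>\<close> meets every orbit of the finite Weyl group exactly once, so that the projection exists,
  is proved by the deletion property of words in the simple reflections.
\<close>

section \<open>Reflections\<close>

lemma group_generated_by_comp:
  assumes "g \<in> group_generated_by S" "g' \<in> group_generated_by S"
  shows "g \<circ> g' \<in> group_generated_by S"
  using assms(1)
proof induction
  case one
  then show ?case using assms(2) by simp
next
  case (step s w)
  then show ?case by (metis comp_assoc group_generated_by.step)
qed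

lemma group_generated_by_generator: "s \<in> S \<Longrightarrow> s \<in> group_generated_by S"
  using group_generated_by.step[OF _ group_generated_by.one] by simp

lemma group_generated_by_mono:
  assumes "S \<subseteq> group_generated_by T" "g \<in> group_generated_by S"
  shows "g \<in> group_generated_by T"
  using assms(2)
proof induction
  case one
  show ?case by (rule group_generated_by.one)
next
  case (step s w)
  then show ?case using assms(1) group_generated_by_comp by blast
qed

lemma group_generated_by_inverse:
  assumes invol: "\<And>s. s \<in> S \<Longrightarrow> s \<circ> s = id" and "g \<in> group_generated_by S"
  shows "bij g \<and> inv g \<in> group_generated_by S"
  using assms(2)
proof induction
  case one
  show ?case using group_generated_by.one[of S] by (simp only: bij_id inv_id simp_thms)
next
  case (step s w)
  have s: "bij s" "inv s = s"
    using invol[OF step(1)] o_bij inv_unique_comp by blast+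
  have "inv (s \<circ> w) = inv w \<circ> s"
    using s step.IH by (simp add: o_inv_distrib)
  then show ?case
    using s step by (metis bij_comp group_generated_by_comp group_generated_by_generator)
qed

text \<open>
  The level \<open>c\<close> is real: dilations carry walls to hyperplanes that are not known to be walls at the
  outset.
\<close>

definition reflection :: "('v::euclidean_space \<Rightarrow>\<^sub>L real) \<Rightarrow> real \<Rightarrow> 'v \<Rightarrow> 'v" where
  "reflection \<alpha> c x = x - (\<alpha> x - c) *\<^sub>R coroot \<alpha>"

lemma wall_reflection_eq: "wall_reflection \<alpha> k = reflection \<alpha> (of_int k)"
  by (simp add: fun_eq_iff wall_reflection_def reflection_def)

lemma \<tau>_eq: "\<tau> \<alpha> = reflection \<alpha> 0"
  by (simp add: fun_eq_iff \<tau>_def reflection_def)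

text \<open>
  The coroot represents a positive multiple of \<open>\<alpha>\<close>, so that \<open>\<tau> \<alpha>\<close> is an orthogonal reflection.
\<close>

lemma coroot_inner:
  fixes \<alpha> :: "'v::euclidean_space \<Rightarrow>\<^sub>L real"
  assumes "\<alpha> \<noteq> 0"
  obtains k where "k > 0" "\<And>v. coroot \<alpha> \<bullet> v = k * \<alpha> v" "coroot \<alpha> \<bullet> coroot \<alpha> = 2 * k"
    "\<alpha> (coroot \<alpha>) = 2"
proof -
  define g where "g = adjoint (blinfun_apply \<alpha>) 1"
  have g: "\<alpha> v = g \<bullet> v" for v
    using adjoint_works[OF blinfun.bounded_linear_right[THEN bounded_linear.linear], of v \<alpha> 1]
    by (simp add: g_def inner_commute)
  have "g \<noteq> 0"
    using assms g by (metis blinfun_eqI inner_zero_left zero_blinfun.rep_eq)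
  then have gg: "g \<bullet> g > 0" by simp
  have c: "coroot \<alpha> = (2 / (g \<bullet> g)) *\<^sub>R g"
    by (simp add: coroot_def g_def Let_def)
  show ?thesis
  proof (rule that)
    show "2 / (g \<bullet> g) > 0" using gg by simp
  qed (use gg in \<open>auto simp: c g inner_commute\<close>)
qed

lemma root_coroot: "\<alpha> \<noteq> 0 \<Longrightarrow> \<alpha> (coroot \<alpha>) = 2"
  by (erule coroot_inner)

lemma reflection_reflection [simp]:
  "\<alpha> \<noteq> 0 \<Longrightarrow> reflection \<alpha> c (reflection \<alpha> c x) = x"
  by (simp add: reflection_def root_coroot blinfun.diff_right blinfun.add_right blinfun.scaleR_right algebra_simps)

lemma root_reflection: "\<alpha> \<noteq> 0 \<Longrightarrow> \<alpha> (reflection \<alpha> c x) = 2 * c - \<alpha> x"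
  by (simp add: reflection_def root_coroot blinfun.diff_right blinfun.add_right blinfun.scaleR_right algebra_simps)

lemma reflection_fixes_iff: "\<alpha> \<noteq> 0 \<Longrightarrow> reflection \<alpha> c x = x \<longleftrightarrow> \<alpha> x = c"
  using root_coroot[of \<alpha>] by (auto simp: reflection_def)

lemma linear_\<tau>: "linear (\<tau> \<alpha>)"
  by (auto intro!: linearI simp: \<tau>_def blinfun.add_right blinfun.scaleR_right algebra_simps)

lemma \<tau>_\<tau> [simp]: "\<alpha> \<noteq> 0 \<Longrightarrow> \<tau> \<alpha> (\<tau> \<alpha> v) = v"
  by (simp add: \<tau>_eq)

lemma norm_\<tau> [simp]: "\<alpha> \<noteq> 0 \<Longrightarrow> norm (\<tau> \<alpha> v) = norm v"
proof (erule coroot_inner)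
  fix k assume k: "\<And>v. coroot \<alpha> \<bullet> v = k * \<alpha> v" "\<alpha> (coroot \<alpha>) = 2" "coroot \<alpha> \<bullet> coroot \<alpha> = 2 * k"
  have "\<tau> \<alpha> v \<bullet> \<tau> \<alpha> v = v \<bullet> v"
    by (simp add: \<tau>_def inner_diff_left inner_diff_right k inner_commute[of v "coroot \<alpha>"] algebra_simps)
  then show ?thesis by (simp add: norm_eq_sqrt_inner)
qed

text \<open>
  The root system contains \<open>- \<alpha>\<close> together with \<open>\<alpha>\<close>, and may contain \<open>2\<alpha>\<close>; for a step of a chain one has
  to pass to the multiple that is positive and for which the wall has an integral level.
\<close>

lemma \<tau>_proportional:
  fixes \<alpha> \<beta> :: "'v::euclidean_space \<Rightarrow>\<^sub>L real"
  assumes "\<alpha> \<noteq> 0" "\<beta> \<noteq> 0" "\<And>v. \<beta> v = c * \<alpha> v"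
  shows "\<tau> \<beta> = \<tau> \<alpha>"
proof -
  obtain k where k: "\<And>v. coroot \<alpha> \<bullet> v = k * \<alpha> v" "k > 0" using assms(1) coroot_inner by metis
  obtain l where l: "\<And>v. coroot \<beta> \<bullet> v = l * \<beta> v" "l > 0" using assms(2) coroot_inner by metis
  have "coroot \<beta> = (l * c / k) *\<^sub>R coroot \<alpha>"
  proof (rule vector_eq_rdot[THEN iffD1, rule_format])
    fix v show "coroot \<beta> \<bullet> v = (l * c / k) *\<^sub>R coroot \<alpha> \<bullet> v"
      using k l assms(3) by (simp add: inner_commute)
  qed
  then obtain d where d: "coroot \<beta> = d *\<^sub>R coroot \<alpha>" by blast
  have "\<beta> (coroot \<beta>) = 2" using root_coroot[OF assms(2)] .
  then have "c * d = 1"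
    using root_coroot[OF assms(1)] by (simp add: assms(3) d blinfun.scaleR_right mult.commute)
  then show ?thesis by (auto simp: fun_eq_iff \<tau>_def assms(3) d)
qed

text \<open>
  An isometry \<open>w\<close> that carries \<open>\<alpha>\<close> to \<open>\<beta>\<close> carries the coroot to the coroot: both are orthogonal to the
  kernel of \<open>\<beta>\<close>, and \<open>\<beta>\<close> has the value \<open>2\<close> at them.
\<close>

lemma \<tau>_conjugate:
  fixes \<alpha> \<beta> :: "'v::euclidean_space \<Rightarrow>\<^sub>L real"
  assumes "\<alpha> \<noteq> 0" "\<beta> \<noteq> 0" "linear w" "\<And>v. norm (w v) = norm v" "\<And>v. \<beta> (w v) = \<alpha> v"
  shows "w (coroot \<alpha>) = coroot \<beta>" "\<tau> \<beta> (w v) = w (\<tau> \<alpha> v)"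
proof -
  have orth: "w x \<bullet> w y = x \<bullet> y" for x y
    using assms(3,4) orthogonal_transformation orthogonal_transformation_def by blast
  have "inj w" using assms(3,4) by (metis linear_injective_0 norm_eq_zero)
  then have "surj w" using assms(3) linear_injective_imp_surjective by blast
  obtain k where k: "\<And>v. coroot \<alpha> \<bullet> v = k * \<alpha> v" "k > 0" "coroot \<alpha> \<bullet> coroot \<alpha> = 2 * k"
    using assms(1) coroot_inner by metis
  obtain l where l: "\<And>v. coroot \<beta> \<bullet> v = l * \<beta> v" "l > 0" "coroot \<beta> \<bullet> coroot \<beta> = 2 * l"
    using assms(2) coroot_inner by metis
  have 1: "w (coroot \<alpha>) \<bullet> v = (k / l) * (coroot \<beta> \<bullet> v)" for v
  proof -
    obtain u where "v = w u" using \<open>surj w\<close> by (metis surjD)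
    then show ?thesis using l(2) by (simp add: orth k(1) l(1) assms(5))
  qed
  define c where "c = k / l"
  have 2: "w (coroot \<alpha>) = c *\<^sub>R coroot \<beta>"
    by (rule vector_eq_rdot[THEN iffD1, rule_format]) (simp add: 1 c_def)
  have "\<beta> (w (coroot \<alpha>)) = 2" by (simp add: assms(5) root_coroot[OF assms(1)])
  then have "c = 1"
    unfolding 2 blinfun.scaleR_right root_coroot[OF assms(2)] real_scaleR_def by linarith
  with 2 show w: "w (coroot \<alpha>) = coroot \<beta>" by simp
  show "\<tau> \<beta> (w v) = w (\<tau> \<alpha> v)"
    by (simp add: \<tau>_def linear_diff[OF assms(3)] linear_cmul[OF assms(3)] w assms(5))
qed

section \<open>Weyl chambers and alcoves\<close>

text \<open>
  A Weyl chamber is described by the signs of the roots at one of its interior points \<open>\<rho>\<close>.  Inequalities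
  are easier to handle than connected components, which enter only through \<open>weyl_chamber_iff\<close> and the
  lemmas on alcoves.
\<close>

definition regular_vector :: "('v::euclidean_space \<Rightarrow>\<^sub>L real) set \<Rightarrow> 'v \<Rightarrow> bool" where
  "regular_vector R \<rho> \<longleftrightarrow> (\<forall>\<alpha>\<in>R. \<alpha> \<rho> \<noteq> 0)"

definition chamber_of :: "('v::euclidean_space \<Rightarrow>\<^sub>L real) set \<Rightarrow> 'v \<Rightarrow> 'v set" where
  "chamber_of R \<rho> = {v. \<forall>\<alpha>\<in>R. 0 < \<alpha> \<rho> \<longrightarrow> 0 \<le> \<alpha> v}"

definition open_chamber_of :: "('v::euclidean_space \<Rightarrow>\<^sub>L real) set \<Rightarrow> 'v \<Rightarrow> 'v set" where
  "open_chamber_of R \<rho> = {v. \<forall>\<alpha>\<in>R. 0 < \<alpha> \<rho> \<longrightarrow> 0 < \<alpha> v}"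

lemma open_chamber_of_subset: "open_chamber_of R \<rho> \<subseteq> chamber_of R \<rho>"
  by (force simp: open_chamber_of_def chamber_of_def)

lemma self_in_open_chamber_of: "\<rho> \<in> open_chamber_of R \<rho>"
  by (auto simp: open_chamber_of_def)

lemma self_in_chamber_of: "\<rho> \<in> chamber_of R \<rho>"
  using open_chamber_of_subset self_in_open_chamber_of by blast

lemma chamber_of_scaleR: "v \<in> chamber_of R \<rho> \<Longrightarrow> 0 \<le> s \<Longrightarrow> s *\<^sub>R v \<in> chamber_of R \<rho>"
  by (auto simp: chamber_of_def blinfun.scaleR_right)

lemma chamber_of_add_open:
  "v \<in> chamber_of R \<rho> \<Longrightarrow> w \<in> open_chamber_of R \<rho> \<Longrightarrow> 0 < s \<Longrightarrow>
    v + s *\<^sub>R w \<in> open_chamber_of R \<rho>"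
  by (auto simp: chamber_of_def open_chamber_of_def blinfun.scaleR_right blinfun.add_right add_nonneg_pos)

lemma closed_chamber_of: "closed (chamber_of R \<rho>)"
proof -
  have "chamber_of R \<rho> = (\<Inter>\<alpha>\<in>{\<alpha>\<in>R. 0 < blinfun_apply \<alpha> \<rho>}. {v. 0 \<le> blinfun_apply \<alpha> v})"
    by (auto simp: chamber_of_def)
  then show ?thesis by (auto intro!: closed_Collect_le continuous_intros)
qed

lemma convex_open_chamber_of: "convex (open_chamber_of R \<rho>)"
proof (rule convexI)
  fix x y and u v :: real
  assume *: "x \<in> open_chamber_of R \<rho>" "y \<in> open_chamber_of R \<rho>" "0 \<le> u" "0 \<le> v" "u + v = 1"
  show "u *\<^sub>R x + v *\<^sub>R y \<in> open_chamber_of R \<rho>"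
    unfolding open_chamber_of_def
  proof (intro CollectI ballI impI)
    fix \<alpha> assume "\<alpha> \<in> R" "0 < \<alpha> \<rho>"
    then have "0 < \<alpha> x" "0 < \<alpha> y" using * by (auto simp: open_chamber_of_def)
    then have "0 < u * \<alpha> x + v * \<alpha> y"
      using *(3-5) by (cases "u = 0") (auto intro: add_pos_nonneg)
    then show "0 < \<alpha> (u *\<^sub>R x + v *\<^sub>R y)"
      by (simp add: blinfun.scaleR_right blinfun.add_right)
  qed
qed

lemma connected_avoids_level:
  fixes \<alpha> :: "'v::euclidean_space \<Rightarrow>\<^sub>L real"
  assumes "connected T" "\<And>v. v \<in> T \<Longrightarrow> \<alpha> v \<noteq> c" "x \<in> T" "y \<in> T" "c < \<alpha> x"
  shows "c < \<alpha> y"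
proof (rule ccontr)
  assume "\<not> c < \<alpha> y"
  moreover have "connected (blinfun_apply \<alpha> ` T)"
    using assms(1) by (auto intro!: connected_continuous_image continuous_intros)
  ultimately have "c \<in> blinfun_apply \<alpha> ` T"
    using connectedD_interval[of "blinfun_apply \<alpha> ` T" "\<alpha> y" "\<alpha> x" c] assms by auto
  then show False using assms(2) by auto
qed

text \<open>
  Germs are expressed through the filter \<open>nhds 0\<close>: a property that holds for all small vectors
  holds for all small multiples of a fixed one.
\<close>

lemma eventually_small_multiple:
  fixes v :: "'v::real_normed_vector"
  assumes "eventually P (nhds 0)"
  shows "eventually (\<lambda>s. P (s *\<^sub>R v)) (at_right 0)"
proof -
  have "((\<lambda>s. s *\<^sub>R v) \<longlongrightarrow> 0 *\<^sub>R v) (at_right 0)"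
    by (intro tendsto_intros)
  then show ?thesis using assms by (auto dest: filterlim_iff[THEN iffD1, rule_format])
qed

lemma small_multiple:
  fixes v :: "'v::real_normed_vector"
  assumes "eventually P (nhds 0)"
  obtains s where "0 < s" "s < 1" "P (s *\<^sub>R v)"
proof -
  have "eventually (\<lambda>s. P (s *\<^sub>R v) \<and> s \<in> {0<..<1}) (at_right 0)"
    using eventually_small_multiple[OF assms] eventually_at_right_real[of 0 1]
    by (simp add: eventually_conj)
  then show ?thesis using that by (auto dest!: eventually_happens)
qed

locale roots =
  fixes R :: "('v::euclidean_space \<Rightarrow>\<^sub>L real) set"
  assumes root_system: "root_system R"
begin

lemma finite_roots: "finite R"
  using root_system by (simp add: root_system_def)

lemma root_nonzero: "\<alpha> \<in> R \<Longrightarrow> \<alpha> \<noteq> 0"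
  using root_system by (auto simp: root_system_def)

lemma root_\<tau>:
  assumes "\<alpha> \<in> R" "\<beta> \<in> R"
  obtains \<delta> where "\<delta> \<in> R" "\<And>v. \<delta> v = \<beta> (\<tau> \<alpha> v)"
proof
  show "\<beta> - blinfun_apply \<beta> (coroot \<alpha>) *\<^sub>R \<alpha> \<in> R"
    using root_system assms by (auto simp: root_system_def)
qed (simp add: \<tau>_def blinfun.diff_left blinfun.diff_right blinfun.scaleR_left blinfun.scaleR_right)

lemma root_coroot_Ints: "\<alpha> \<in> R \<Longrightarrow> \<beta> \<in> R \<Longrightarrow> \<beta> (coroot \<alpha>) \<in> \<int>"
  using root_system by (auto simp: root_system_def)

lemma root_uminus: "\<alpha> \<in> R \<Longrightarrow> - \<alpha> \<in> R"
proof -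
  assume a: "\<alpha> \<in> R"
  then obtain \<delta> where d: "\<delta> \<in> R" "\<And>v. \<delta> v = \<alpha> (\<tau> \<alpha> v)" using root_\<tau> by metis
  have "\<delta> = - \<alpha>"
    by (rule blinfun_eqI)
      (simp add: d \<tau>_def root_coroot[OF root_nonzero[OF a]] blinfun.diff_right blinfun.scaleR_right blinfun.minus_left)
  with d show ?thesis by simp
qed

lemma roots_separate:
  assumes "\<And>\<alpha>. \<alpha> \<in> R \<Longrightarrow> \<alpha> v = 0"
  shows "v = 0"
proof -
  have "subspace {\<alpha>. blinfun_apply \<alpha> v = 0}"
    by (auto simp: subspace_def blinfun.add_left blinfun.scaleR_left)
  then have "span R \<subseteq> {\<alpha>. blinfun_apply \<alpha> v = 0}"
    using assms by (intro span_minimal) auto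
  then have "blinfun_inner_right v \<in> {\<alpha>. blinfun_apply \<alpha> v = 0}"
    using root_system unfolding root_system_def by blast
  then show ?thesis by (simp add: blinfun_inner_right.rep_eq)
qed

lemma regular_cases:
  assumes "regular_vector R \<rho>" "\<alpha> \<in> R"
  shows "\<alpha> \<rho> > 0 \<or> \<alpha> \<rho> < 0"
  using assms by (auto simp: regular_vector_def)

text \<open>Since \<open>R = - R\<close>, a chamber also determines the signs of the roots that are negative on it.\<close>

lemma chamber_of_neg: "v \<in> chamber_of R \<rho> \<Longrightarrow> \<alpha> \<in> R \<Longrightarrow> \<alpha> \<rho> < 0 \<Longrightarrow> \<alpha> v \<le> 0"
  using root_uminus[of \<alpha>] by (force simp: chamber_of_def blinfun.minus_left)

lemma open_chamber_of_neg: "v \<in> open_chamber_of R \<rho> \<Longrightarrow> \<alpha> \<in> R \<Longrightarrow> \<alpha> \<rho> < 0 \<Longrightarrow> \<alpha> v < 0"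
  using root_uminus[of \<alpha>] by (force simp: open_chamber_of_def blinfun.minus_left)

lemma regular_in_chamber_of:
  assumes "regular_vector R \<sigma>" "\<sigma> \<in> chamber_of R \<rho>"
  shows "\<sigma> \<in> open_chamber_of R \<rho>"
  using assms by (force simp: open_chamber_of_def chamber_of_def regular_vector_def)

lemma open_chamber_of_regular:
  assumes "regular_vector R \<rho>" "\<sigma> \<in> open_chamber_of R \<rho>"
  shows "regular_vector R \<sigma>" "chamber_of R \<sigma> = chamber_of R \<rho>"
proof -
  have *: "0 < \<alpha> \<sigma> \<longleftrightarrow> 0 < \<alpha> \<rho>" "\<alpha> \<sigma> \<noteq> 0" if "\<alpha> \<in> R" for \<alpha>
  proof -
    have "0 < \<alpha> \<sigma> \<and> 0 < \<alpha> \<rho> \<or> \<alpha> \<sigma> < 0 \<and> \<alpha> \<rho> < 0"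
      using regular_cases[OF assms(1) that] open_chamber_of_neg[OF assms(2) that] assms(2) that
      by (auto simp: open_chamber_of_def)
    then show "0 < \<alpha> \<sigma> \<longleftrightarrow> 0 < \<alpha> \<rho>" "\<alpha> \<sigma> \<noteq> 0" by auto
  qed
  show "regular_vector R \<sigma>" "chamber_of R \<sigma> = chamber_of R \<rho>"
    using * by (auto simp: regular_vector_def chamber_of_def)
qed

lemma closure_open_chamber_of:
  "closure (open_chamber_of R \<rho>) = chamber_of R \<rho>"
proof
  show "closure (open_chamber_of R \<rho>) \<subseteq> chamber_of R \<rho>"
    by (intro closure_minimal open_chamber_of_subset closed_chamber_of)
next
  show "chamber_of R \<rho> \<subseteq> closure (open_chamber_of R \<rho>)"
  proof
    fix v assume v: "v \<in> chamber_of R \<rho>"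
    show "v \<in> closure (open_chamber_of R \<rho>)"
    proof (rule Lim_in_closed_set)
      have "((\<lambda>s. v + s *\<^sub>R \<rho>) \<longlongrightarrow> v + 0 *\<^sub>R \<rho>) (at_right 0)"
        by (intro tendsto_intros)
      then show "((\<lambda>s. v + s *\<^sub>R \<rho>) \<longlongrightarrow> v) (at_right 0)" by simp
      show "\<forall>\<^sub>F s in at_right 0. v + s *\<^sub>R \<rho> \<in> closure (open_chamber_of R \<rho>)"
        using eventually_at_right_less[of "0::real"]
        by eventually_elim
          (meson closure_subset subsetD chamber_of_add_open[OF v self_in_open_chamber_of])
    qed auto
  qed
qed

lemma weyl_chamber_iff:
  "C \<in> weyl_chambers R \<longleftrightarrow> (\<exists>\<rho>. regular_vector R \<rho> \<and> C = chamber_of R \<rho>)"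
proof -
  let ?U = "- (\<Union>\<alpha>\<in>R. wall \<alpha> 0)"
  have U: "v \<in> ?U \<longleftrightarrow> regular_vector R v" for v
    by (auto simp: wall_def regular_vector_def)
  have Q: "connected_component_set ?U \<rho> = open_chamber_of R \<rho>" if r: "regular_vector R \<rho>" for \<rho>
  proof
    show "open_chamber_of R \<rho> \<subseteq> connected_component_set ?U \<rho>"
      using open_chamber_of_regular(1)[OF r] U
      by (intro connected_component_maximal convex_connected convex_open_chamber_of
          self_in_open_chamber_of) blast
    show "connected_component_set ?U \<rho> \<subseteq> open_chamber_of R \<rho>"
    proof
      fix v assume v: "v \<in> connected_component_set ?U \<rho>"
      show "v \<in> open_chamber_of R \<rho>"
        unfolding open_chamber_of_def
      proof (intro CollectI ballI impI)
        fix \<alpha> assume a: "\<alpha> \<in> R" "0 < \<alpha> \<rho>"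
        show "0 < \<alpha> v"
        proof (rule connected_avoids_level[OF connected_connected_component])
          fix u assume "u \<in> connected_component_set ?U \<rho>"
          then have "u \<in> ?U" using connected_component_subset by blast
          then show "\<alpha> u \<noteq> 0" using U a by (auto simp: regular_vector_def)
        next
          show "\<rho> \<in> connected_component_set ?U \<rho>" using r U by (simp add: connected_component_refl)
        qed (use v a in auto)
      qed
    qed
  qed
  have "C \<in> weyl_chambers R \<longleftrightarrow> (\<exists>\<rho>\<in>?U. C = closure (connected_component_set ?U \<rho>))"
    unfolding weyl_chambers_def components_def by auto
  also have "\<dots> \<longleftrightarrow> (\<exists>\<rho>. regular_vector R \<rho> \<and> C = chamber_of R \<rho>)"
    using Q U by (metis closure_open_chamber_of)
  finally show ?thesis .
qed

lemma avoids_walls_iff: "v \<in> - \<Union>(walls R) \<longleftrightarrow> (\<forall>\<alpha>\<in>R. \<alpha> v \<notin> \<int>)"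
proof -
  have "v \<in> - \<Union>(walls R) \<longleftrightarrow> (\<forall>\<alpha>\<in>R. \<forall>k. \<alpha> v \<noteq> of_int k)"
    by (auto simp: walls_def wall_def)
  then show ?thesis by (simp only: Ints_def) blast
qed

text \<open>
  The walls are locally finite, since \<open>R\<close> is finite and \<open>\<int>\<close> is discrete.
\<close>

lemma walls_nearby:
  "\<forall>\<^sub>F e in nhds 0. \<forall>\<alpha>\<in>R. (\<alpha> x \<in> \<int> \<longrightarrow> \<bar>\<alpha> e\<bar> < 1) \<and> (\<alpha> x \<notin> \<int> \<longrightarrow> \<alpha> (x + e) \<notin> \<int>)"
proof (rule eventually_ball_finite[OF finite_roots], rule ballI)
  fix \<alpha> assume "\<alpha> \<in> R"
  have "(blinfun_apply \<alpha> \<longlongrightarrow> \<alpha> 0) (nhds 0)"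
    using linear_continuous_at[OF blinfun.bounded_linear_right, of 0 \<alpha>]
    unfolding isCont_def tendsto_at_iff_tendsto_nhds .
  then have t: "(blinfun_apply \<alpha> \<longlongrightarrow> 0) (nhds 0)" by (simp only: blinfun.zero_right)
  then have "\<forall>\<^sub>F e in nhds 0. dist (\<alpha> e) 0 < 1" by (rule tendstoD) simp
  moreover have "\<forall>\<^sub>F e in nhds 0. \<alpha> (x + e) \<notin> \<int>" if "\<alpha> x \<notin> \<int>"
  proof -
    have "((\<lambda>e. \<alpha> x + \<alpha> e) \<longlongrightarrow> \<alpha> x + 0) (nhds 0)" by (intro tendsto_intros t)
    then have "\<forall>\<^sub>F e in nhds 0. \<alpha> x + \<alpha> e \<in> - \<int>"
      using that by (intro topological_tendstoD) auto
    then show ?thesis by (simp add: blinfun.add_right)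
  qed
  ultimately show "\<forall>\<^sub>F e in nhds 0. (\<alpha> x \<in> \<int> \<longrightarrow> \<bar>\<alpha> e\<bar> < 1) \<and> (\<alpha> x \<notin> \<int> \<longrightarrow> \<alpha> (x + e) \<notin> \<int>)"
    by (cases "\<alpha> x \<in> \<int>") auto
qed

text \<open>
  The small vectors in the interior of the chamber lead from \<open>x\<close> into a convex set that no wall meets: a
  wall through \<open>x\<close> is avoided because of the chamber, another one because of the distance.
\<close>

lemma alcove_at:
  assumes r: "regular_vector R \<rho>"
  obtains b where "b \<in> alcoves R" "\<forall>\<^sub>F e in nhds 0. e \<in> chamber_of R \<rho> \<longrightarrow> x + e \<in> b"
proof -
  let ?U = "- \<Union>(walls R)"
  obtain d where d: "d > 0" "\<And>e. norm e < d \<Longrightarrow>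
      \<forall>\<alpha>\<in>R. (\<alpha> x \<in> \<int> \<longrightarrow> \<bar>\<alpha> e\<bar> < 1) \<and> (\<alpha> x \<notin> \<int> \<longrightarrow> \<alpha> (x + e) \<notin> \<int>)"
    using walls_nearby[of x] unfolding eventually_nhds_metric by (auto simp: dist_norm)
  define T where "T = (+) x ` (open_chamber_of R \<rho> \<inter> ball 0 d)"
  have TU: "T \<subseteq> ?U"
  proof
    fix v assume "v \<in> T"
    then obtain e where e: "v = x + e" "e \<in> open_chamber_of R \<rho>" "norm e < d"
      by (auto simp: T_def)
    have "\<alpha> v \<notin> \<int>" if a: "\<alpha> \<in> R" for \<alpha>
    proof (cases "\<alpha> x \<in> \<int>")
      case True
      have "\<alpha> e \<noteq> 0" using open_chamber_of_regular(1)[OF r e(2)] a by (auto simp: regular_vector_def)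
      moreover have "\<bar>\<alpha> e\<bar> < 1" using d e(3) a True by blast
      ultimately have "\<alpha> e \<notin> \<int>" by (auto elim!: Ints_cases)
      then show ?thesis
        using True by (metis Ints_diff add_diff_cancel_left' blinfun.add_right e(1))
    next
      case False
      then show ?thesis using d e(1,3) a by blast
    qed
    then show "v \<in> ?U" using avoids_walls_iff by blast
  qed
  have "connected T"
    unfolding T_def by (intro convex_connected convex_translation convex_Int convex_open_chamber_of convex_ball)
  obtain s where s: "0 < s" "norm (s *\<^sub>R \<rho>) < d"
  proof -
    have "\<forall>\<^sub>F e in nhds (0::'v). norm e < d"
      using d(1) unfolding eventually_nhds_metric by (auto simp: dist_norm)
    then show ?thesis using that small_multiple by metis
  qed
  then have t: "x + s *\<^sub>R \<rho> \<in> T"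
    by (auto simp: T_def open_chamber_of_def blinfun.scaleR_right)
  define Q where "Q = connected_component_set ?U (x + s *\<^sub>R \<rho>)"
  have "T \<subseteq> Q"
    unfolding Q_def by (intro connected_component_maximal t TU \<open>connected T\<close>)
  show ?thesis
  proof
    show "closure Q \<in> alcoves R"
      using t TU by (auto simp: alcoves_def Q_def components_def)
    have "x + e \<in> closure Q" if e: "norm e < d" "e \<in> chamber_of R \<rho>" for e
    proof (rule Lim_in_closed_set)
      have "((\<lambda>s. x + (e + s *\<^sub>R \<rho>)) \<longlongrightarrow> x + (e + 0 *\<^sub>R \<rho>)) (at_right 0)"
        by (intro tendsto_intros)
      then show "((\<lambda>s. x + (e + s *\<^sub>R \<rho>)) \<longlongrightarrow> x + e) (at_right 0)" by simp
      have "((\<lambda>s. norm (e + s *\<^sub>R \<rho>)) \<longlongrightarrow> norm (e + 0 *\<^sub>R \<rho>)) (at_right 0)"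
        by (intro tendsto_intros)
      then have "\<forall>\<^sub>F s in at_right 0. norm (e + s *\<^sub>R \<rho>) < d"
        using e(1) by (intro order_tendstoD) auto
      then show "\<forall>\<^sub>F s in at_right 0. x + (e + s *\<^sub>R \<rho>) \<in> closure Q"
        using eventually_at_right_less[of "0::real"]
      proof eventually_elim
        case (elim s)
        then have "x + (e + s *\<^sub>R \<rho>) \<in> T"
          using chamber_of_add_open[OF e(2) self_in_open_chamber_of] by (simp add: T_def)
        then show ?case using \<open>T \<subseteq> Q\<close> closure_subset by blast
      qed
    qed auto
    then show "\<forall>\<^sub>F e in nhds 0. e \<in> chamber_of R \<rho> \<longrightarrow> x + e \<in> closure Q"
      using d(1) unfolding eventually_nhds_metric by (auto simp: dist_norm)
  qed
qed

lemma alcove_interior: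
  assumes "b \<in> alcoves R"
  obtains q d where "0 < d" "ball q d \<subseteq> b"
proof -
  let ?U = "- \<Union>(walls R)"
  note U = avoids_walls_iff
  obtain q where q: "q \<in> ?U" "b = closure (connected_component_set ?U q)"
    using assms by (auto simp: alcoves_def components_def)
  obtain d where d: "d > 0" "\<And>e. norm e < d \<Longrightarrow>
      \<forall>\<alpha>\<in>R. (\<alpha> q \<in> \<int> \<longrightarrow> \<bar>\<alpha> e\<bar> < 1) \<and> (\<alpha> q \<notin> \<int> \<longrightarrow> \<alpha> (q + e) \<notin> \<int>)"
    using walls_nearby[of q] unfolding eventually_nhds_metric by (auto simp: dist_norm)
  have "ball q d \<subseteq> ?U"
  proof
    fix v assume "v \<in> ball q d"
    then have "norm (v - q) < d" by (simp add: dist_norm norm_minus_commute)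
    then show "v \<in> ?U" using d(2)[of "v - q"] q(1) U by auto
  qed
  then have "ball q d \<subseteq> connected_component_set ?U q"
    using d(1) by (intro connected_component_maximal) auto
  then show ?thesis using that d(1) q(2) closure_subset by blast
qed

end

section \<open>The finite Weyl group and simple roots\<close>

lemmas root_linear = blinfun.add_right blinfun.diff_right blinfun.minus_right
  blinfun.scaleR_right blinfun.zero_right

context roots
begin

lemma involution_\<tau>: "s \<in> \<tau> ` R \<Longrightarrow> s \<circ> s = id"
  by (auto simp: fun_eq_iff root_nonzero)

lemma W_sph_comp: "g \<in> W_sph R \<Longrightarrow> g' \<in> W_sph R \<Longrightarrow> g \<circ> g' \<in> W_sph R"
  unfolding W_sph_def by (rule group_generated_by_comp)

lemma W_sph_id: "id \<in> W_sph R"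
  unfolding W_sph_def by (rule group_generated_by.one)

lemma W_sph_\<tau>: "\<alpha> \<in> R \<Longrightarrow> \<tau> \<alpha> \<in> W_sph R"
  unfolding W_sph_def by (intro group_generated_by_generator imageI)

lemma W_sph_bij: "g \<in> W_sph R \<Longrightarrow> bij g"
  and W_sph_inv: "g \<in> W_sph R \<Longrightarrow> inv g \<in> W_sph R"
  unfolding W_sph_def using group_generated_by_inverse[OF involution_\<tau>] by blast+

lemma W_sph_inv_apply [simp]:
  assumes "g \<in> W_sph R"
  shows "inv g (g v) = v" "g (inv g v) = v"
  using W_sph_bij[OF assms] by (simp_all add: bij_is_inj bij_is_surj surj_f_inv_f)

lemma W_sph_linear_norm:
  assumes "g \<in> W_sph R"
  shows "linear g \<and> (\<forall>v. norm (g v) = norm v)"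
  using assms unfolding W_sph_def
proof induction
  case one
  show ?case using linear_id by (simp add: id_def)
next
  case (step s w)
  then obtain \<alpha> where "\<alpha> \<in> R" "s = \<tau> \<alpha>" by auto
  moreover from this have "linear (\<tau> \<alpha> \<circ> w)"
    using step.IH by (intro linear_compose linear_\<tau>) auto
  ultimately show ?case using step.IH by (simp add: root_nonzero comp_def)
qed

lemma W_sph_linear: "g \<in> W_sph R \<Longrightarrow> linear g"
  and W_sph_norm: "g \<in> W_sph R \<Longrightarrow> norm (g v) = norm v"
  using W_sph_linear_norm by blast+

lemma W_sph_root:
  assumes "g \<in> W_sph R" "\<beta> \<in> R"
  obtains \<delta> where "\<delta> \<in> R" "\<And>v. \<delta> v = \<beta> (g v)"
proof -
  have "\<forall>\<beta>\<in>R. \<exists>\<delta>\<in>R. \<forall>v. \<delta> v = \<beta> (g v)"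
    using assms(1) unfolding W_sph_def
  proof induction
    case one
    then show ?case by auto
  next
    case (step s w)
    then obtain \<alpha> where a: "\<alpha> \<in> R" "s = \<tau> \<alpha>" by auto
    show ?case
    proof
      fix \<beta> assume "\<beta> \<in> R"
      then obtain \<delta> where "\<delta> \<in> R" "\<And>v. \<delta> v = \<beta> (\<tau> \<alpha> v)" using root_\<tau> a by metis
      then show "\<exists>\<delta>\<in>R. \<forall>v. \<delta> v = \<beta> ((s \<circ> w) v)" using step.IH a by (metis comp_apply)
    qed
  qed
  with assms(2) that show ?thesis by blast
qed

lemma W_sph_root_inv:
  assumes "g \<in> W_sph R" "\<beta> \<in> R"
  obtains \<delta> where "\<delta> \<in> R" "\<And>v. \<delta> (g v) = \<beta> v"
proof -
  obtain \<delta> where "\<delta> \<in> R" "\<And>v. \<delta> v = \<beta> (inv g v)"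
    using W_sph_root[OF W_sph_inv[OF assms(1)] assms(2)] by blast
  then show ?thesis using that assms(1) by simp
qed

lemma W_sph_regular: "g \<in> W_sph R \<Longrightarrow> regular_vector R \<rho> \<Longrightarrow> regular_vector R (g \<rho>)"
  by (metis W_sph_root regular_vector_def)

lemma W_sph_chamber_of_iff:
  assumes "g \<in> W_sph R"
  shows "g v \<in> chamber_of R (g \<rho>) \<longleftrightarrow> v \<in> chamber_of R \<rho>"
proof
  assume l: "g v \<in> chamber_of R (g \<rho>)"
  show "v \<in> chamber_of R \<rho>"
    unfolding chamber_of_def
  proof (intro CollectI ballI impI)
    fix \<alpha> assume a: "\<alpha> \<in> R" "0 < \<alpha> \<rho>"
    obtain \<delta> where "\<delta> \<in> R" "\<And>v. \<delta> (g v) = \<alpha> v" using W_sph_root_inv[OF assms a(1)] by blast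
    then show "0 \<le> \<alpha> v" using l a by (force simp: chamber_of_def)
  qed
next
  assume r: "v \<in> chamber_of R \<rho>"
  show "g v \<in> chamber_of R (g \<rho>)"
    unfolding chamber_of_def
  proof (intro CollectI ballI impI)
    fix \<alpha> assume a: "\<alpha> \<in> R" "0 < \<alpha> (g \<rho>)"
    obtain \<delta> where "\<delta> \<in> R" "\<And>v. \<delta> v = \<alpha> (g v)" using W_sph_root[OF assms a(1)] by blast
    then show "0 \<le> \<alpha> (g v)" using r a by (force simp: chamber_of_def)
  qed
qed

text \<open>
  A vector is determined by the values of the roots, and the group only permutes these values.
\<close>

lemma finite_W_sph_orbit: "finite ((\<lambda>g. g v) ` W_sph R)"
proof (rule inj_on_finite)
  let ?r = "\<lambda>u. restrict (\<lambda>\<alpha>. blinfun_apply \<alpha> u) R"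
  show "inj_on ?r ((\<lambda>g. g v) ` W_sph R)"
  proof (rule inj_onI)
    fix x y assume "?r x = ?r y"
    then have "\<alpha> x = \<alpha> y" if "\<alpha> \<in> R" for \<alpha> using that by (metis restrict_apply')
    then have "x - y = 0" by (intro roots_separate) (simp add: root_linear)
    then show "x = y" by simp
  qed
  show "?r ` (\<lambda>g. g v) ` W_sph R \<subseteq> (\<Pi>\<^sub>E \<alpha>\<in>R. (\<lambda>\<beta>. blinfun_apply \<beta> v) ` R)"
  proof clarify
    fix g assume g: "g \<in> W_sph R"
    show "?r (g v) \<in> (\<Pi>\<^sub>E \<alpha>\<in>R. (\<lambda>\<beta>. blinfun_apply \<beta> v) ` R)"
    proof (rule restrict_PiE_iff[THEN iffD2], rule ballI)
      fix \<alpha> assume "\<alpha> \<in> R"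
      then obtain \<delta> where "\<delta> \<in> R" "\<And>v. \<delta> v = \<alpha> (g v)" using W_sph_root[OF g] by blast
      then show "\<alpha> (g v) \<in> (\<lambda>\<beta>. blinfun_apply \<beta> v) ` R" by (metis imageI)
    qed
  qed
  show "finite (\<Pi>\<^sub>E \<alpha>\<in>R. (\<lambda>\<beta>. blinfun_apply \<beta> v) ` R)"
    by (intro finite_PiE finite_imageI finite_roots)
qed

end

definition proportional :: "('v::euclidean_space \<Rightarrow>\<^sub>L real) \<Rightarrow> ('v \<Rightarrow>\<^sub>L real) \<Rightarrow> bool" where
  "proportional \<alpha> \<beta> \<longleftrightarrow> (\<exists>c. \<forall>v. \<beta> v = c * \<alpha> v)"

lemma proportional_iff_kernel:
  fixes \<alpha> \<beta> :: "'v::euclidean_space \<Rightarrow>\<^sub>L real"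
  assumes "\<alpha> \<noteq> 0"
  shows "proportional \<alpha> \<beta> \<longleftrightarrow> (\<forall>v. \<alpha> v = 0 \<longrightarrow> \<beta> v = 0)"
proof
  assume *: "\<forall>v. \<alpha> v = 0 \<longrightarrow> \<beta> v = 0"
  have "\<beta> v = (\<beta> (coroot \<alpha>) / 2) * \<alpha> v" for v
  proof -
    have "\<alpha> (v - (\<alpha> v / 2) *\<^sub>R coroot \<alpha>) = 0"
      by (simp add: root_linear root_coroot[OF assms])
    then have "\<beta> (v - (\<alpha> v / 2) *\<^sub>R coroot \<alpha>) = 0" using * by blast
    then show ?thesis by (simp add: root_linear)
  qed
  then show "proportional \<alpha> \<beta>" unfolding proportional_def by blast
qed (auto simp: proportional_def)

text \<open>
  A point in the relative interior of a panel with normal \<open>\<alpha>\<close>: the only root hyperplane through it is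
  that of \<open>\<alpha>\<close>.
\<close>

definition panel_point :: "('v::euclidean_space \<Rightarrow>\<^sub>L real) set \<Rightarrow> ('v \<Rightarrow>\<^sub>L real) \<Rightarrow> 'v \<Rightarrow> bool" where
  "panel_point R \<alpha> m \<longleftrightarrow> \<alpha> m = 0 \<and> (\<forall>\<delta>\<in>R. blinfun_apply \<delta> m = 0 \<longrightarrow> proportional \<alpha> \<delta>)"

text \<open>
  The simple roots are taken to be the normals of the walls of the chamber.  The point
  \<open>m\<close> inside the panel replaces their linear independence.
\<close>

definition simple_roots :: "('v::euclidean_space \<Rightarrow>\<^sub>L real) set \<Rightarrow> 'v \<Rightarrow> ('v \<Rightarrow>\<^sub>L real) set \<Rightarrow> bool" where
  "simple_roots R \<rho> S \<longleftrightarrow>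
     S \<subseteq> {\<alpha>\<in>R. 0 < blinfun_apply \<alpha> \<rho>} \<and> chamber_of R \<rho> = {v. \<forall>\<alpha>\<in>S. 0 \<le> blinfun_apply \<alpha> v} \<and>
     (\<forall>\<alpha>\<in>S. \<exists>m\<in>chamber_of R \<rho>. panel_point R \<alpha> m)"

context roots
begin

text \<open>
  An irredundant subsystem of the inequalities that define the chamber is a system of simple roots.
  Dropping the inequality of \<open>\<alpha>\<close> admits a point \<open>v\<close> beyond the wall; the segment from \<open>v\<close> to \<open>\<rho>\<close> crosses
  the wall in a point \<open>m\<close> of the panel.  Near \<open>m\<close> the chamber is the half-space of \<open>\<alpha>\<close>, so that a root
  that vanishes at \<open>m\<close> must vanish on the hyperplane of \<open>\<alpha>\<close>.
\<close>

lemma ex_simple_roots: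
  assumes r: "regular_vector R \<rho>"
  obtains S where "simple_roots R \<rho> S"
proof -
  let ?P = "{\<alpha>\<in>R. 0 < blinfun_apply \<alpha> \<rho>}"
  define cut where
    "cut S \<longleftrightarrow> S \<subseteq> ?P \<and> chamber_of R \<rho> = {v. \<forall>\<alpha>\<in>S. 0 \<le> blinfun_apply \<alpha> v}" for S
  have P: "cut ?P" by (auto simp: cut_def chamber_of_def)
  have "\<exists>S. cut S \<and> (\<forall>T. cut T \<longrightarrow> card S \<le> card T)"
    by (rule ex_has_least_nat[of cut, OF P])
  then obtain S where "cut S" and min: "\<And>T. cut T \<Longrightarrow> card S \<le> card T"
    by auto
  then have S: "S \<subseteq> ?P" "chamber_of R \<rho> = {v. \<forall>\<alpha>\<in>S. 0 \<le> blinfun_apply \<alpha> v}"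
    by (simp_all add: cut_def)
  have fin: "finite S" using finite_subset[OF S(1)] finite_roots by simp
  have "\<exists>m\<in>chamber_of R \<rho>. panel_point R \<alpha> m" if a: "\<alpha> \<in> S" for \<alpha>
  proof -
    have pos: "0 < \<alpha> \<rho>" "\<alpha> \<in> R" using a S by auto
    have "\<not> cut (S - {\<alpha>})"
      using min[of "S - {\<alpha>}"] fin a by (meson card_Diff1_less not_le)
    then have "chamber_of R \<rho> \<noteq> {v. \<forall>\<beta>\<in>S - {\<alpha>}. 0 \<le> blinfun_apply \<beta> v}"
      using S(1) by (auto simp: cut_def)
    moreover have "chamber_of R \<rho> \<subseteq> {v. \<forall>\<beta>\<in>S - {\<alpha>}. 0 \<le> blinfun_apply \<beta> v}"
      using S(2) by auto
    ultimately obtain v where v': "\<forall>\<beta>\<in>S - {\<alpha>}. 0 \<le> \<beta> v" "v \<notin> chamber_of R \<rho>" by blast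
    then obtain \<beta> where b: "\<beta> \<in> S" "\<beta> v < 0" using S(2) by (auto simp: not_le)
    with v'(1) have "\<beta> = \<alpha>" by force
    with b v' have v: "\<forall>\<beta>\<in>S - {\<alpha>}. 0 \<le> \<beta> v" "\<alpha> v < 0" by auto
    define s where "s = - \<alpha> v / \<alpha> \<rho>"
    define m where "m = v + s *\<^sub>R \<rho>"
    have s: "s > 0" using v pos by (simp add: s_def divide_neg_pos)
    have am: "\<alpha> m = 0" using pos by (simp add: m_def s_def root_linear)
    have bm: "0 < \<beta> m" if "\<beta> \<in> S - {\<alpha>}" for \<beta>
    proof -
      have "0 < \<beta> \<rho>" using that S by auto
      then show ?thesis
        using s v that by (simp add: m_def root_linear add_nonneg_pos)
    qed
    have "proportional \<alpha> \<delta>" if d: "\<delta> \<in> R" "\<delta> m = 0" for \<delta>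
    proof -
      have "\<delta> e = 0" if e: "\<alpha> e = 0" for e
      proof -
        have in_chamber: "\<exists>s>0. m + s *\<^sub>R e \<in> chamber_of R \<rho>" if e: "\<alpha> e = 0" for e
        proof -
          have "\<forall>\<^sub>F s in at_right 0. 0 < \<beta> (m + s *\<^sub>R e)" if "\<beta> \<in> S - {\<alpha>}" for \<beta>
          proof (rule order_tendstoD(1))
            show "((\<lambda>s. \<beta> (m + s *\<^sub>R e)) \<longlongrightarrow> \<beta> (m + 0 *\<^sub>R e)) (at_right 0)"
              by (intro tendsto_intros)
          qed (use bm that in auto)
          then have "\<forall>\<^sub>F s in at_right 0. \<forall>\<beta>\<in>S - {\<alpha>}. 0 < \<beta> (m + s *\<^sub>R e)"
            using fin by (intro eventually_ball_finite) auto
          then have "\<forall>\<^sub>F s in at_right 0. 0 < s \<and> m + s *\<^sub>R e \<in> chamber_of R \<rho>"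
            using eventually_at_right_less[of "0::real"]
          proof eventually_elim
            case (elim s)
            have "0 \<le> \<beta> (m + s *\<^sub>R e)" if "\<beta> \<in> S" for \<beta>
              using elim that am e
              by (cases "\<beta> = \<alpha>") (auto simp: root_linear intro: less_imp_le)
            then show ?case using S elim by auto
          qed
          then show ?thesis by (auto dest: eventually_happens)
        qed
        obtain s where s: "s > 0" "m + s *\<^sub>R e \<in> chamber_of R \<rho>" using in_chamber e by blast
        obtain t where t: "t > 0" "m + t *\<^sub>R (- e) \<in> chamber_of R \<rho>"
          using in_chamber[of "- e"] e by (auto simp: root_linear)
        have *: "s * \<delta> e = \<delta> (m + s *\<^sub>R e)" "- (t * \<delta> e) = \<delta> (m + t *\<^sub>R (- e))"
          using d by (simp_all add: root_linear)
        show ?thesis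
        proof (cases "0 < \<delta> \<rho>")
          case True
          then have "0 \<le> s * \<delta> e" "0 \<le> - (t * \<delta> e)"
            unfolding * using s t d by (auto simp: chamber_of_def)
          then show ?thesis using s(1) t(1) by (simp add: zero_le_mult_iff mult_le_0_iff)
        next
          case False
          then have "\<delta> \<rho> < 0" using regular_cases[OF r d(1)] by auto
          then have "s * \<delta> e \<le> 0" "- (t * \<delta> e) \<le> 0"
            unfolding * using s t d by (auto intro: chamber_of_neg)
          then show ?thesis using s(1) t(1) by (simp add: zero_le_mult_iff mult_le_0_iff)
        qed
      qed
      then show ?thesis using proportional_iff_kernel[OF root_nonzero[OF pos(2)]] by blast
    qed
    moreover have "m \<in> chamber_of R \<rho>" using S am bm by (force intro: less_imp_le)
    ultimately show ?thesis using am by (auto simp: panel_point_def)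
  qed
  then have "simple_roots R \<rho> S" using S unfolding simple_roots_def by blast
  then show ?thesis by (rule that)
qed

text \<open>
  The root \<open>\<delta>\<close> does not vanish at the point \<open>m\<close> of the panel, which the reflection fixes; its signs at
  \<open>\<rho>\<close> and at the mirror image of \<open>\<rho>\<close> are both the sign of its value at \<open>m\<close>.
\<close>

lemma panel_sign:
  assumes "m \<in> chamber_of R \<rho>" "panel_point R \<alpha> m" "\<alpha> \<in> R" "\<delta> \<in> R" "\<not> proportional \<alpha> \<delta>" 
    "regular_vector R \<rho>"
  shows "0 < \<delta> (\<tau> \<alpha> \<rho>) \<longleftrightarrow> 0 < \<delta> \<rho>"
proof -
  have sgn: "0 < \<delta> \<rho> \<longleftrightarrow> 0 < \<delta> m" if "\<delta> \<in> R" "\<delta> m \<noteq> 0" for \<delta>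
  proof (cases "0 < \<delta> \<rho>")
    case True
    then have "0 \<le> \<delta> m" using assms(1) that(1) by (simp add: chamber_of_def)
    with True that(2) show ?thesis by simp
  next
    case False
    then have "\<delta> m \<le> 0"
      using chamber_of_neg[OF assms(1) that(1)] regular_cases[OF assms(6) that(1)] by simp
    with False show ?thesis by simp
  qed
  obtain \<beta> where b: "\<beta> \<in> R" "\<And>v. \<beta> v = \<delta> (\<tau> \<alpha> v)" using root_\<tau>[OF assms(3,4)] by blast
  have "\<tau> \<alpha> m = m" using assms(2) by (simp add: \<tau>_def panel_point_def)
  moreover have "\<delta> m \<noteq> 0" using assms by (auto simp: panel_point_def)
  ultimately show ?thesis using sgn[OF b(1)] sgn[OF assms(4)] b(2) by simp
qed

end

section \<open>The Weyl chamber as a fundamental domain\<close>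

definition word :: "('v::euclidean_space \<Rightarrow>\<^sub>L real) list \<Rightarrow> 'v \<Rightarrow> 'v" where
  "word \<alpha>s = foldr (\<lambda>\<alpha> g. \<tau> \<alpha> \<circ> g) \<alpha>s id"

lemma word_simps [simp]: "word [] = id" "word (\<alpha> # \<alpha>s) = \<tau> \<alpha> \<circ> word \<alpha>s"
  by (simp_all add: word_def)

lemma word_append: "word (\<alpha>s @ \<beta>s) = word \<alpha>s \<circ> word \<beta>s"
  by (induction \<alpha>s) (auto simp: comp_assoc)

locale simple_system = roots +
  fixes \<rho> S
  assumes regular: "regular_vector R \<rho>" and simple: "simple_roots R \<rho> S"
begin

lemma simple_root: "\<alpha> \<in> S \<Longrightarrow> \<alpha> \<in> R" "\<alpha> \<in> S \<Longrightarrow> 0 < \<alpha> \<rho>"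
  using simple by (auto simp: simple_roots_def)

lemma chamber_simple: "v \<in> chamber_of R \<rho> \<longleftrightarrow> (\<forall>\<alpha>\<in>S. 0 \<le> \<alpha> v)"
  using simple by (auto simp: simple_roots_def)

lemma word_W_sph: "set \<alpha>s \<subseteq> S \<Longrightarrow> word \<alpha>s \<in> W_sph R"
  by (induction \<alpha>s) (auto simp: W_sph_id intro!: W_sph_comp W_sph_\<tau> simple_root)

lemma word_rev: "set \<alpha>s \<subseteq> S \<Longrightarrow> word (rev \<alpha>s) (word \<alpha>s v) = v"
  by (induction \<alpha>s arbitrary: v) (auto simp: word_append root_nonzero simple_root)

lemma simple_reflection_sign:
  assumes "\<alpha> \<in> S" "\<delta> \<in> R" "0 < \<delta> \<rho>" "\<delta> (\<tau> \<alpha> \<rho>) < 0"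
  shows "proportional \<alpha> \<delta>"
proof (rule ccontr)
  assume "\<not> proportional \<alpha> \<delta>"
  moreover obtain m where "m \<in> chamber_of R \<rho>" "panel_point R \<alpha> m"
    using simple assms(1) by (auto simp: simple_roots_def)
  ultimately show False using panel_sign[of m \<rho> \<alpha> \<delta>] assms simple_root regular by force
qed

text \<open>
  The deletion property.  When the letters of the word are applied one after the other, some letter
  turns the image of \<open>\<alpha>\<close> from positive to negative.  A simple reflection does this only to multiples of its
  own root, so that this letter cancels against \<open>\<tau> \<alpha>\<close>.
\<close>

lemma deletion:
  assumes "set \<alpha>s \<subseteq> S" "\<alpha> \<in> S" "\<alpha> (inv (word \<alpha>s) \<rho>) < 0"
  obtains \<beta>s where "set \<beta>s \<subseteq> S" "length \<beta>s < length \<alpha>s" "word \<beta>s = word \<alpha>s \<circ> \<tau> \<alpha>"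
proof -
  have "\<exists>\<beta>s. set \<beta>s \<subseteq> S \<and> length \<beta>s < length \<alpha>s \<and> word \<beta>s = word \<alpha>s \<circ> \<tau> \<alpha>"
    using assms
  proof (induction \<alpha>s)
    case Nil
    then show ?case using simple_root[of \<alpha>] by (auto simp: inv_id[unfolded id_def] id_def)
  next
    case (Cons \<beta> \<alpha>s)
    let ?u = "word \<alpha>s"
    have u: "?u \<in> W_sph R" and b: "\<beta> \<in> S" using Cons word_W_sph by auto
    have inv_eq: "inv (word (\<beta> # \<alpha>s)) v = inv ?u (\<tau> \<beta> v)" for v
      using W_sph_inv_apply(1)[OF word_W_sph[OF Cons.prems(1)], of "inv ?u (\<tau> \<beta> v)"] u b
      by (simp add: root_nonzero simple_root)
    have neg: "\<alpha> (inv ?u (\<tau> \<beta> \<rho>)) < 0" using Cons.prems(3) by (simp only: inv_eq)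
    obtain \<delta> where d: "\<delta> \<in> R" "\<And>v. \<delta> v = \<alpha> (inv ?u v)"
      using W_sph_root[OF W_sph_inv[OF u] simple_root(1)[OF \<open>\<alpha> \<in> S\<close>]] by blast
    consider "\<delta> \<rho> < 0" | "0 < \<delta> \<rho>" using regular_cases[OF regular d(1)] by blast
    then show ?case
    proof cases
      case 1
      then have "\<alpha> (inv ?u \<rho>) < 0" by (simp only: d(2))
      moreover have "set \<alpha>s \<subseteq> S" using Cons.prems(1) by simp
      ultimately obtain \<beta>s where "set \<beta>s \<subseteq> S" "length \<beta>s < length \<alpha>s" "word \<beta>s = ?u \<circ> \<tau> \<alpha>"
        using Cons.IH Cons.prems(2) by blast
      then show ?thesis using b by (intro exI[of _ "\<beta> # \<beta>s"]) (simp add: comp_assoc)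
    next
      case 2
      then have "proportional \<beta> \<delta>" using simple_reflection_sign[OF b d(1)] neg d by simp
      then have t: "\<tau> \<delta> = \<tau> \<beta>"
        using \<tau>_proportional root_nonzero d(1) simple_root(1)[OF b] unfolding proportional_def by metis
      have "?u (\<tau> \<alpha> v) = \<tau> \<delta> (?u v)" for v
        using \<tau>_conjugate(2)[of \<alpha> \<delta> ?u v] u d W_sph_linear W_sph_norm root_nonzero simple_root \<open>\<alpha> \<in> S\<close>
        by auto
      then have "word (\<beta> # \<alpha>s) \<circ> \<tau> \<alpha> = ?u"
        using b by (auto simp: fun_eq_iff t root_nonzero simple_root)
      moreover have "set \<alpha>s \<subseteq> S" using Cons.prems(1) by simp
      moreover have "length \<alpha>s < length (\<beta> # \<alpha>s)" by simp
      ultimately show ?thesis by metis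
    qed
  qed
  then show ?thesis using that by blast
qed

text \<open>
  Let \<open>\<alpha>\<close> be the last letter of the word, and \<open>u\<close> the rest.  Either the word can be shortened, or
  \<open>u\<close> takes \<open>\<alpha>\<close> to a positive root; then that root is nonnegative at the image of \<open>x\<close> although its
  value is \<open>- \<alpha> x\<close>, whence \<open>\<alpha> x = 0\<close> and the last letter fixes \<open>x\<close>.
\<close>

lemma word_fixes:
  assumes "set \<alpha>s \<subseteq> S" "x \<in> chamber_of R \<rho>" "word \<alpha>s x \<in> chamber_of R \<rho>"
  shows "word \<alpha>s x = x"
  using assms
proof (induction \<alpha>s rule: measure_induct_rule[of length])
  case (less \<alpha>s)
  show ?case
  proof (cases \<alpha>s rule: rev_cases)
    case (snoc us \<alpha>)
    let ?u = "word us"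
    have a: "\<alpha> \<in> S" and us: "set us \<subseteq> S" and u: "?u \<in> W_sph R"
      using less.prems snoc word_W_sph by auto
    have w: "word \<alpha>s = ?u \<circ> \<tau> \<alpha>" by (simp add: snoc word_append)
    obtain \<delta> where d: "\<delta> \<in> R" "\<And>v. \<delta> v = \<alpha> (inv ?u v)"
      using W_sph_root[OF W_sph_inv[OF u] simple_root(1)[OF a]] by blast
    consider "\<delta> \<rho> < 0" | "0 < \<delta> \<rho>" using regular_cases[OF regular d(1)] by blast
    then show ?thesis
    proof cases
      case 1
      then obtain \<beta>s where b: "set \<beta>s \<subseteq> S" "length \<beta>s < length us" "word \<beta>s = ?u \<circ> \<tau> \<alpha>"
        using deletion[OF us a] d by auto
      then show ?thesis using less.IH[of \<beta>s] less.prems w snoc by auto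
    next
      case 2
      have "0 \<le> \<delta> (word \<alpha>s x)" using less.prems 2 d(1) by (auto simp: chamber_of_def)
      also have "\<dots> = - \<alpha> x"
        using root_reflection[OF root_nonzero[OF simple_root(1)[OF a]], of 0 x] u
        by (simp add: w d \<tau>_eq)
      finally have "\<alpha> x = 0" using less.prems(2) a chamber_simple by force
      then have "\<tau> \<alpha> x = x" by (simp add: \<tau>_def)
      then show ?thesis using less.IH[of us] less.prems us w snoc by auto
    qed
  qed auto
qed

text \<open>A point of the orbit that maximizes the inner product with \<open>\<rho>\<close> lies in the chamber.\<close>

lemma ex_word_to_chamber: 
  obtains \<alpha>s where "set \<alpha>s \<subseteq> S" "word \<alpha>s x \<in> chamber_of R \<rho>"
proof -
  define Y where "Y = {word \<alpha>s x |\<alpha>s. set \<alpha>s \<subseteq> S}"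
  have "Y \<subseteq> (\<lambda>g. g x) ` W_sph R" using word_W_sph by (auto simp: Y_def)
  then have fin: "finite Y" using finite_W_sph_orbit finite_subset by blast
  have "word [] x \<in> Y" unfolding Y_def by (intro CollectI exI[of _ "[]"]) simp
  then have ne: "(\<lambda>y. y \<bullet> \<rho>) ` Y \<noteq> {}" by blast
  obtain y where "y \<in> Y" and ymax: "y \<bullet> \<rho> = Max ((\<lambda>y. y \<bullet> \<rho>) ` Y)"
    using Max_in[OF finite_imageI[OF fin] ne] by auto
  then obtain \<alpha>s where as: "set \<alpha>s \<subseteq> S" "y = word \<alpha>s x" by (auto simp: Y_def)
  have "0 \<le> \<alpha> y" if a: "\<alpha> \<in> S" for \<alpha>
  proof (rule ccontr)
    assume n: "\<not> 0 \<le> \<alpha> y"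
    have "\<tau> \<alpha> y = word (\<alpha> # \<alpha>s) x" by (simp add: as)
    then have "\<tau> \<alpha> y \<in> Y" 
      unfolding Y_def using as a by (intro CollectI exI[of _ "\<alpha> # \<alpha>s"]) simp
    then have le: "\<tau> \<alpha> y \<bullet> \<rho> \<le> y \<bullet> \<rho>"
      unfolding ymax by (intro Max_ge finite_imageI fin imageI)
    obtain k where k: "k > 0" "\<And>v. coroot \<alpha> \<bullet> v = k * \<alpha> v"
      using coroot_inner[OF root_nonzero[OF simple_root(1)[OF a]]] by metis
    have "0 < - (\<alpha> y) * (k * \<alpha> \<rho>)" using k n simple_root[OF a] by (intro mult_pos_pos) auto
    then show False using le k by (simp add: \<tau>_def inner_diff_left)
  qed
  then show ?thesis using that as chamber_simple by metis
qed

end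

context roots
begin

text \<open>A hyperplane is not covered by finitely many of its proper subspaces.\<close>

lemma ex_panel_point:
  assumes "\<alpha> \<in> R"
  obtains m where "panel_point R \<alpha> m"
proof -
  have "\<exists>m. \<alpha> m = 0 \<and> (\<forall>\<delta>\<in>D. blinfun_apply \<delta> m = 0 \<longrightarrow> proportional \<alpha> \<delta>)" if "finite D" for D
    using that
  proof induction
    case empty
    show ?case by (intro exI[of _ 0]) (simp add: root_linear)
  next
    case (insert \<delta> D)
    then obtain m where m: "\<alpha> m = 0" "\<forall>\<delta>\<in>D. blinfun_apply \<delta> m = 0 \<longrightarrow> proportional \<alpha> \<delta>" by blast
    show ?case
    proof (cases "proportional \<alpha> \<delta>")
      case False
      then obtain e where e: "\<alpha> e = 0" "\<delta> e \<noteq> 0"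
        using proportional_iff_kernel[OF root_nonzero[OF assms]] by blast
      define B where "B = insert (- \<delta> m / \<delta> e) ((\<lambda>\<gamma>. - blinfun_apply \<gamma> m / blinfun_apply \<gamma> e) ` D) \<union> {0}"
      have "finite B" using insert by (simp add: B_def)
      then obtain s where s: "s \<notin> B" using ex_new_if_finite infinite_UNIV_char_0 by blast
      have "proportional \<alpha> \<gamma>" if g: "\<gamma> \<in> insert \<delta> D" "\<gamma> (m + s *\<^sub>R e) = 0" for \<gamma>
      proof (cases "\<gamma> e = 0")
        case True
        then show ?thesis
          using g m e by (auto simp: root_linear)
      next
        case False
        then have "s = - \<gamma> m / \<gamma> e"
          using g(2) by (simp add: root_linear field_simps)
        then show ?thesis using s g(1) by (auto simp: B_def)
      qed
      moreover have "\<alpha> (m + s *\<^sub>R e) = 0"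
        using m e by (simp add: root_linear)
      ultimately show ?thesis by blast
    qed (use m in blast)
  qed
  from this[OF finite_roots] show ?thesis using that by (auto simp: panel_point_def)
qed

end

context simple_system
begin

text \<open>
  A generic point \<open>m\<close> of the mirror of \<open>\<beta>\<close> can be moved into the chamber by simple reflections, where it
  ends up on a wall; as \<open>m\<close> lies on no other mirror, \<open>\<tau> \<beta>\<close> is conjugate to the reflection in that wall.
\<close>

lemma reflection_word:
  assumes b: "\<beta> \<in> R"
  obtains \<alpha>s where "set \<alpha>s \<subseteq> S" "\<tau> \<beta> = word \<alpha>s"
proof -
  obtain m where m: "panel_point R \<beta> m" using ex_panel_point[OF b] .
  obtain \<alpha>s where as: "set \<alpha>s \<subseteq> S" "word \<alpha>s m \<in> chamber_of R \<rho>" using ex_word_to_chamber .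
  define g where "g = word \<alpha>s"
  have g: "g \<in> W_sph R" using as word_W_sph by (simp add: g_def)
  obtain \<delta> where d: "\<delta> \<in> R" "\<And>v. \<delta> (g v) = \<beta> v" using W_sph_root_inv[OF g b] by blast
  \<comment> \<open>The chamber has no root hyperplane through its interior, so \<open>g m\<close> lies on one of its walls.\<close>
  have "\<exists>\<alpha>\<in>S. \<alpha> (g m) = 0"
  proof (rule ccontr)
    assume n: "\<not> (\<exists>\<alpha>\<in>S. \<alpha> (g m) = 0)"
    have small: "\<exists>s>0. g m + s *\<^sub>R e \<in> chamber_of R \<rho>" for e
    proof -
      have "\<forall>\<^sub>F s in at_right 0. 0 < \<alpha> (g m + s *\<^sub>R e)" if "\<alpha> \<in> S" for \<alpha>
      proof (rule order_tendstoD(1))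
        show "((\<lambda>s. \<alpha> (g m + s *\<^sub>R e)) \<longlongrightarrow> \<alpha> (g m + 0 *\<^sub>R e)) (at_right 0)"
          by (intro tendsto_intros)
        show "0 < \<alpha> (g m + 0 *\<^sub>R e)" using n as that chamber_simple by (force simp: g_def)
      qed
      moreover have "finite S" using simple_root finite_roots finite_subset by (metis subsetI)
      ultimately have "\<forall>\<^sub>F s in at_right 0. \<forall>\<alpha>\<in>S. 0 < \<alpha> (g m + s *\<^sub>R e)"
        by (intro eventually_ball_finite) auto
      then have "\<forall>\<^sub>F s in at_right 0. 0 < s \<and> g m + s *\<^sub>R e \<in> chamber_of R \<rho>"
        using eventually_at_right_less[of "0::real"]
        by eventually_elim (auto simp: chamber_simple intro: less_imp_le)
      then show ?thesis by (auto dest: eventually_happens)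
    qed
    obtain s where s: "s > 0" "g m + s *\<^sub>R coroot \<delta> \<in> chamber_of R \<rho>" using small by blast
    obtain t where t: "t > 0" "g m + t *\<^sub>R (- coroot \<delta>) \<in> chamber_of R \<rho>" using small by blast
    have "\<delta> (g m) = 0" using d m by (simp add: panel_point_def)
    then have "\<delta> (g m + s *\<^sub>R coroot \<delta>) = 2 * s" "\<delta> (g m + t *\<^sub>R (- coroot \<delta>)) = - (2 * t)"
      using root_coroot[OF root_nonzero[OF d(1)]]
      by (simp_all add: root_linear)
    then show False
      using s t regular_cases[OF regular d(1)] chamber_of_neg[OF s(2) d(1)] d(1)
      by (force simp: chamber_of_def)
  qed
  then obtain \<alpha> where a: "\<alpha> \<in> S" "\<alpha> (g m) = 0" by blast
  obtain \<gamma> where c: "\<gamma> \<in> R" "\<And>v. \<gamma> v = \<alpha> (g v)" using W_sph_root[OF g simple_root(1)[OF a(1)]] by blast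
  have "\<gamma> m = 0" using a c(2) by simp
  then have "proportional \<beta> \<gamma>" using m c(1) unfolding panel_point_def by blast
  then obtain k where k: "\<And>v. \<gamma> v = k * \<beta> v" unfolding proportional_def by blast
  have "\<alpha> v = k * \<delta> v" for v using k[of "inv g v"] c d g W_sph_inv_apply by metis
  then have t: "\<tau> \<alpha> = \<tau> \<delta>" using \<tau>_proportional root_nonzero d(1) simple_root(1)[OF a(1)] by metis
  have "\<tau> \<beta> v = word (rev \<alpha>s @ \<alpha> # \<alpha>s) v" for v
  proof -
    have "\<tau> \<delta> (g v) = g (\<tau> \<beta> v)"
      using \<tau>_conjugate(2)[of \<beta> \<delta> g v] g d b W_sph_linear W_sph_norm root_nonzero by auto
    then show ?thesis using word_rev[OF as(1)] t by (simp add: word_append g_def)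
  qed
  then show ?thesis using that[of "rev \<alpha>s @ \<alpha> # \<alpha>s"] as a by auto
qed

lemma W_sph_word:
  assumes "g \<in> W_sph R"
  obtains \<alpha>s where "set \<alpha>s \<subseteq> S" "g = word \<alpha>s"
proof -
  have "\<exists>\<alpha>s. set \<alpha>s \<subseteq> S \<and> g = word \<alpha>s"
    using assms unfolding W_sph_def
  proof induction
    case one
    then show ?case by (intro exI[of _ "[]"]) simp
  next
    case (step s w)
    then obtain \<alpha>s where "set \<alpha>s \<subseteq> S" "w = word \<alpha>s" by blast
    moreover obtain \<beta>s where "set \<beta>s \<subseteq> S" "s = word \<beta>s" using step(1) reflection_word by blast
    ultimately show ?case by (intro exI[of _ "\<beta>s @ \<alpha>s"]) (simp add: word_append)
  qed
  then show ?thesis using that by blast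
qed

end

context roots
begin

lemma ex_W_sph_to_chamber:
  assumes "regular_vector R \<rho>"
  obtains g where "g \<in> W_sph R" "g x \<in> chamber_of R \<rho>"
proof -
  obtain S where "simple_roots R \<rho> S" using ex_simple_roots[OF assms] .
  then interpret simple_system R \<rho> S using assms by unfold_locales
  show ?thesis using that ex_word_to_chamber word_W_sph by metis
qed

lemma W_sph_chamber_unique:
  assumes "regular_vector R \<rho>" "g \<in> W_sph R" "x \<in> chamber_of R \<rho>" "g x \<in> chamber_of R \<rho>"
  shows "g x = x"
proof -
  obtain S where "simple_roots R \<rho> S" using ex_simple_roots[OF assms(1)] .
  then interpret simple_system R \<rho> S using assms by unfold_locales
  obtain \<alpha>s where "set \<alpha>s \<subseteq> S" "g = word \<alpha>s" using W_sph_word[OF assms(2)] .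
  then show ?thesis using word_fixes assms by auto
qed

lemma proj_chamber_eq:
  assumes "regular_vector R \<rho>" "g \<in> W_sph R" "g x \<in> chamber_of R \<rho>"
  shows "proj_chamber R (chamber_of R \<rho>) x = g x"
  unfolding proj_chamber_def
proof (rule the_equality)
  show "g x \<in> (\<lambda>w. w x) ` W_sph R \<inter> chamber_of R \<rho>" using assms by blast
next
  fix y assume "y \<in> (\<lambda>w. w x) ` W_sph R \<inter> chamber_of R \<rho>"
  then obtain w where w: "w \<in> W_sph R" "y = w x" "y \<in> chamber_of R \<rho>" by blast
  have "(w \<circ> inv g) (g x) = g x"
    using assms w by (intro W_sph_chamber_unique[OF assms(1)] W_sph_comp W_sph_inv) auto
  then show "y = g x" using assms w by simp
qed

text \<open>
  For small \<open>s\<close> the vector \<open>y + s \<sigma>\<close> is regular, and its chamber contains \<open>y + e\<close> for all small \<open>e\<close> in the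
  chamber of \<open>\<sigma>\<close>.  The element \<open>g\<close> that takes this chamber to the chamber of \<open>\<rho>\<close> projects all these
  points.
\<close>

lemma proj_chamber_germ:
  assumes "regular_vector R \<rho>" "regular_vector R \<sigma>"
  obtains g where "g \<in> W_sph R"
    "\<forall>\<^sub>F e in nhds 0. e \<in> chamber_of R \<sigma> \<longrightarrow>
       g (y + e) \<in> chamber_of R \<rho> \<and> proj_chamber R (chamber_of R \<rho>) (y + e) = g (y + e)"
proof -
  have near: "\<forall>\<^sub>F e in nhds 0. \<forall>\<alpha>\<in>R. 0 < \<alpha> y \<longrightarrow> 0 < \<alpha> (y + e)"
  proof (rule eventually_ball_finite[OF finite_roots], rule ballI)
    fix \<alpha> assume "\<alpha> \<in> R"
    have "((\<lambda>e. \<alpha> (y + e)) \<longlongrightarrow> \<alpha> (y + 0)) (nhds 0)"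
      by (intro tendsto_intros filterlim_ident)
    then have "\<forall>\<^sub>F e in nhds 0. 0 < \<alpha> (y + e)" if "0 < \<alpha> y"
      using that by (intro order_tendstoD(1)) auto
    then show "\<forall>\<^sub>F e in nhds 0. 0 < \<alpha> y \<longrightarrow> 0 < \<alpha> (y + e)" by (cases "0 < \<alpha> y") auto
  qed
  obtain s where s: "0 < s" "\<forall>\<alpha>\<in>R. 0 < \<alpha> y \<longrightarrow> 0 < \<alpha> (y + s *\<^sub>R \<sigma>)"
    using small_multiple[OF near] by blast
  define y' where "y' = y + s *\<^sub>R \<sigma>"
  have neg: "\<alpha> y' < 0" if "\<alpha> \<in> R" "\<alpha> y < 0" for \<alpha>
    using s(2) root_uminus[OF that(1)] that(2) by (force simp: blinfun.minus_left y'_def)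
  have zero: "\<alpha> y' = s * \<alpha> \<sigma>" if "\<alpha> y = 0" for \<alpha> :: "'v \<Rightarrow>\<^sub>L real"
    by (simp add: y'_def that root_linear)
  have r: "regular_vector R y'"
    unfolding regular_vector_def
  proof
    fix \<alpha> assume a: "\<alpha> \<in> R"
    consider "\<alpha> y < 0" | "\<alpha> y = 0" | "0 < \<alpha> y" by linarith
    then show "\<alpha> y' \<noteq> 0"
    proof cases
      case 2
      then show ?thesis using zero s(1) assms(2) a by (auto simp: regular_vector_def)
    qed (use neg a s in \<open>force simp: y'_def\<close>)+
  qed
  obtain g where g: "g \<in> W_sph R" "g y' \<in> chamber_of R \<rho>"
    using ex_W_sph_to_chamber[OF assms(1)] .
  have "chamber_of R (g y') = chamber_of R \<rho>"
    using regular_in_chamber_of[OF _ g(2)] W_sph_regular[OF g(1) r]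
      open_chamber_of_regular(2)[OF assms(1)] by blast
  then have img: "g v \<in> chamber_of R \<rho>" if "v \<in> chamber_of R y'" for v
    using W_sph_chamber_of_iff[OF g(1)] that by metis
  have "\<forall>\<^sub>F e in nhds 0. e \<in> chamber_of R \<sigma> \<longrightarrow>
       g (y + e) \<in> chamber_of R \<rho> \<and> proj_chamber R (chamber_of R \<rho>) (y + e) = g (y + e)"
    using near
  proof eventually_elim
    case (elim e)
    show ?case
    proof
      assume e: "e \<in> chamber_of R \<sigma>"
      have "y + e \<in> chamber_of R y'"
        unfolding chamber_of_def
      proof (intro CollectI ballI impI)
        fix \<alpha> assume a: "\<alpha> \<in> R" "0 < \<alpha> y'"
        consider "\<alpha> y < 0" | "\<alpha> y = 0" | "0 < \<alpha> y" by linarith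
        then show "0 \<le> \<alpha> (y + e)"
        proof cases
          case 1
          then show ?thesis using neg a by fastforce
        next
          case 2
          then have "0 < \<alpha> \<sigma>" using a(2) s(1) zero by (simp add: zero_less_mult_iff)
          then show ?thesis using 2 e a by (simp add: chamber_of_def root_linear)
        next
          case 3
          then show ?thesis using elim a by (auto intro: less_imp_le)
        qed
      qed
      then show "g (y + e) \<in> chamber_of R \<rho> \<and> proj_chamber R (chamber_of R \<rho>) (y + e) = g (y + e)"
        using img g proj_chamber_eq[OF assms(1)] by blast
    qed
  qed
  then show ?thesis using that g by blast
qed

end

section \<open>Reflections in the affine Weyl group\<close>

lemma even_card_involution:
  assumes "finite A" "\<And>x. x \<in> A \<Longrightarrow> f x \<in> A" "\<And>x. x \<in> A \<Longrightarrow> f (f x) = x" "\<And>x. x \<in> A \<Longrightarrow> f x \<noteq> x"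
  shows "even (card A)"
  using assms
proof (induction A rule: finite_psubset_induct)
  case (psubset A)
  show ?case
  proof (cases "A = {}")
    case False
    then obtain x where x: "x \<in> A" by blast
    let ?B = "A - {x, f x}"
    have "even (card ?B)"
    proof (rule psubset.IH)
      show "?B \<subset> A" using x by blast
      fix y assume y: "y \<in> ?B"
      then have "f y \<noteq> x" "f y \<noteq> f x" using psubset.prems x by (metis DiffD1 DiffD2 insertI1 insertI2)+
      then show "f y \<in> ?B" using y psubset.prems by blast
    qed (use psubset.prems in blast)+
    moreover have "card A = card ?B + card {x, f x}"
      using psubset.hyps x psubset.prems(1)[OF x] by (metis card_Diff_subset card_mono empty_subsetI finite.emptyI finite.insertI insert_subset le_add_diff_inverse2)
    moreover have "card {x, f x} = 2" using psubset.prems(3)[OF x] by (simp add: card_2_iff)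
    ultimately show ?thesis by simp
  qed simp
qed

lemma even_card_symmetric_difference:
  assumes "finite A" "finite B"
  shows "even (card {x. x \<in> A \<longleftrightarrow> x \<notin> B}) \<longleftrightarrow> (even (card A) \<longleftrightarrow> even (card B))"
proof -
  have "{x. x \<in> A \<longleftrightarrow> x \<notin> B} = (A - B) \<union> (B - A)" by blast
  then have "card {x. x \<in> A \<longleftrightarrow> x \<notin> B} = card (A - B) + card (B - A)"
    using assms card_Un_disjoint[of "A - B" "B - A"] by auto
  moreover have "card A = card (A - B) + card (A \<inter> B)"
    using assms(1) by (simp add: card_Diff_subset_Int card_mono)
  moreover have "card B = card (B - A) + card (A \<inter> B)"
    using assms(2) by (simp add: card_Diff_subset_Int card_mono Int_commute)
  ultimately show ?thesis by presburger
qed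

definition hyperplane :: "('v::euclidean_space \<Rightarrow>\<^sub>L real) \<Rightarrow> real \<Rightarrow> 'v set" where
  "hyperplane \<alpha> c = {v. \<alpha> v = c}"

text \<open>
  For points off a hyperplane \<open>K\<close> this says that they lie on different sides; in this form it is visibly
  invariant under affine maps and independent of an equation of \<open>K\<close>.
\<close>

definition separates :: "'v::euclidean_space set \<Rightarrow> 'v \<Rightarrow> 'v \<Rightarrow> bool" where
  "separates K m n \<longleftrightarrow> K \<inter> closed_segment m n \<noteq> {}"

lemma separates_commute: "separates K m n \<longleftrightarrow> separates K n m"
  by (simp add: separates_def closed_segment_commute)

lemma separates_hyperplane:
  fixes \<beta> :: "'v::euclidean_space \<Rightarrow>\<^sub>L real"
  assumes "\<beta> m \<noteq> c" "\<beta> n \<noteq> c"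
  shows "separates (hyperplane \<beta> c) m n \<longleftrightarrow> (\<beta> m < c \<longleftrightarrow> \<not> \<beta> n < c)"
proof
  assume "separates (hyperplane \<beta> c) m n"
  then obtain u where u: "0 \<le> u" "u \<le> 1" "\<beta> ((1 - u) *\<^sub>R m + u *\<^sub>R n) = c"
    by (auto simp: separates_def hyperplane_def closed_segment_def)
  then have e: "(1 - u) * (\<beta> m - c) + u * (\<beta> n - c) = 0"
    by (simp add: root_linear algebra_simps)
  show "\<beta> m < c \<longleftrightarrow> \<not> \<beta> n < c"
  proof (rule ccontr)
    assume "\<not> ?thesis"
    then consider "\<beta> m - c < 0" "\<beta> n - c < 0" | "0 < \<beta> m - c" "0 < \<beta> n - c"
      using assms by linarith
    then show False
    proof cases
      case 1
      then have "(1 - u) * (\<beta> m - c) + u * (\<beta> n - c) < 0"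
        using u by (cases "u = 0") (auto intro!: add_nonpos_neg mult_nonneg_nonpos mult_pos_neg)
      with e show ?thesis by simp
    next
      case 2
      then have "0 < (1 - u) * (\<beta> m - c) + u * (\<beta> n - c)"
        using u by (cases "u = 0") (auto intro!: add_nonneg_pos mult_nonneg_nonneg mult_pos_pos)
      with e show ?thesis by simp
    qed
  qed
next
  assume opp: "\<beta> m < c \<longleftrightarrow> \<not> \<beta> n < c"
  define u where "u = (c - \<beta> m) / (\<beta> n - \<beta> m)"
  have "0 \<le> u \<and> u \<le> 1"
    using opp assms by (auto simp: u_def divide_simps)
  moreover have "\<beta> ((1 - u) *\<^sub>R m + u *\<^sub>R n) = c"
  proof -
    have "\<beta> ((1 - u) *\<^sub>R m + u *\<^sub>R n) = \<beta> m + u * (\<beta> n - \<beta> m)"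
      by (simp add: root_linear algebra_simps)
    moreover have "\<beta> n - \<beta> m \<noteq> 0" using opp assms by auto
    ultimately show ?thesis by (simp add: u_def)
  qed
  ultimately show "separates (hyperplane \<beta> c) m n"
    by (auto simp: separates_def hyperplane_def closed_segment_def)
qed

lemma separates_image:
  assumes "linear w" "\<And>x. s x = s 0 + w x" "inj s"
  shows "separates (s ` K) (s m) (s n) \<longleftrightarrow> separates K m n"
proof -
  have "closed_segment (s m) (s n) = s ` closed_segment m n"
  proof -
    have "closed_segment (s m) (s n) = (+) (s 0) ` w ` closed_segment m n"
      by (metis assms(1,2) closed_segment_linear_image closed_segment_translation)
    also have "\<dots> = s ` closed_segment m n"
      using assms(2) by (metis (no_types, lifting) image_cong image_image)
    finally show ?thesis .
  qed
  then have "s ` K \<inter> closed_segment (s m) (s n) = s ` (K \<inter> closed_segment m n)"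
    using assms(3) by (simp add: image_Int)
  then show ?thesis by (simp add: separates_def)
qed

lemma reflection_affine: "reflection \<alpha> c x = reflection \<alpha> c 0 + \<tau> \<alpha> x"
  by (simp add: reflection_def \<tau>_def root_linear algebra_simps)

lemma inj_reflection: "\<alpha> \<noteq> 0 \<Longrightarrow> inj (reflection \<alpha> c)"
  by (metis injI reflection_reflection)

text \<open>
  Suppose that a set of hyperplanes is stable under the reflection in \<open>H\<close>.  The reflection acts on
  the hyperplanes that separate \<open>m\<close> from its mirror image, and \<open>H\<close> is the only one of them that
  it can fix.
\<close>

lemma reflection_parity:
  fixes \<alpha> :: "'v::euclidean_space \<Rightarrow>\<^sub>L real"
  assumes \<alpha>: "\<alpha> \<noteq> 0"
    and hyp: "\<And>K. K \<in> \<O> \<Longrightarrow> \<exists>\<beta> j. K = hyperplane \<beta> j"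
    and stable: "\<And>K. K \<in> \<O> \<Longrightarrow> reflection \<alpha> c ` K \<in> \<O>"
    and fin: "finite {K\<in>\<O>. separates K m (reflection \<alpha> c m)}"
    and off: "\<And>K. K \<in> \<O> \<Longrightarrow> m \<notin> K"
  shows "even (card {K\<in>\<O>. separates K m (reflection \<alpha> c m)}) \<longleftrightarrow> hyperplane \<alpha> c \<notin> \<O>"
proof -
  let ?r = "reflection \<alpha> c" and ?H = "hyperplane \<alpha> c"
  define A where "A = {K\<in>\<O>. separates K m (?r m)}"
  have rr: "?r ` ?r ` K = K" for K using \<alpha> by (simp add: image_image)
  have inv: "?r ` K \<in> A" if "K \<in> A" for K
  proof -
    have "separates (?r ` K) (?r m) (?r (?r m))"
      using that separates_image[OF linear_\<tau> reflection_affine inj_reflection[OF \<alpha>]] by (auto simp: A_def)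
    then show ?thesis using that stable \<alpha> separates_commute by (auto simp: A_def)
  qed
  have fixed: "K = ?H" if K: "K \<in> A" "?r ` K = K" for K
  proof -
    obtain \<beta> j where b: "K = hyperplane \<beta> j" using hyp K(1) unfolding A_def by blast
    obtain u where u: "(1 - u) *\<^sub>R m + u *\<^sub>R ?r m \<in> K"
      using K(1) by (auto simp: A_def separates_def closed_segment_def)
    have ne: "\<beta> (coroot \<alpha>) \<noteq> 0"
    proof
      assume "\<beta> (coroot \<alpha>) = 0"
      then have "\<beta> m = j" using u by (simp add: b hyperplane_def reflection_def root_linear algebra_simps)
      then show False using off K(1) b by (auto simp: A_def hyperplane_def)
    qed
    have sub: "\<alpha> x = c" if "\<beta> x = j" for x
    proof -
      have "?r x \<in> K" using that K(2) b by (auto simp: hyperplane_def)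
      then show ?thesis using that ne by (simp add: b hyperplane_def reflection_def root_linear)
    qed
    have "\<beta> x = j" if x: "\<alpha> x = c" for x
    proof -
      have "\<beta> (x - ((\<beta> x - j) / \<beta> (coroot \<alpha>)) *\<^sub>R coroot \<alpha>) = j"
        using ne by (simp add: root_linear)
      from sub[OF this] show ?thesis using x ne by (simp add: root_linear root_coroot[OF \<alpha>])
    qed
    with sub show ?thesis by (auto simp: b hyperplane_def)
  qed
  have ev: "even (card (A - {?H}))"
  proof (rule even_card_involution[where f = "image ?r"])
    show "finite (A - {?H})" using fin by (simp add: A_def)
    fix K assume K: "K \<in> A - {?H}"
    have "?r v = v" if "v \<in> ?H" for v
      using that \<alpha> by (simp add: hyperplane_def reflection_fixes_iff)
    then have HH: "?r ` ?H = ?H" by (simp cong: image_cong)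
    show "?r ` K \<in> A - {?H}" using K inv[of K] rr[of K] HH by auto
    show "?r ` ?r ` K = K" by (rule rr)
    show "?r ` K \<noteq> K" using fixed K by blast
  qed
  have mem: "?H \<in> A" if H: "?H \<in> \<O>"
  proof -
    have "\<alpha> m \<noteq> c" using off[OF H] by (auto simp: hyperplane_def)
    then have "separates ?H m (?r m)"
      by (subst separates_hyperplane) (auto simp: root_reflection[OF \<alpha>])
    with H show ?thesis by (simp add: A_def)
  qed
  show ?thesis
  proof (cases "?H \<in> \<O>")
    case True
    have "card A = Suc (card (A - {?H}))"
      using fin mem[OF True] unfolding A_def by (rule card.remove)
    then have "odd (card A)" using ev by simp
    then show ?thesis using True unfolding A_def by blast
  next
    case False
    then have "A - {?H} = A" by (auto simp: A_def)
    then have "even (card A)" using ev by simp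
    then show ?thesis using False unfolding A_def by blast
  qed
qed

lemma negligible_affine_hyperplane:
  assumes "\<alpha> \<noteq> 0"
  shows "negligible (hyperplane \<alpha> c)"
proof -
  obtain k where k: "k > 0" "\<And>v. coroot \<alpha> \<bullet> v = k * \<alpha> v" "coroot \<alpha> \<bullet> coroot \<alpha> = 2 * k"
    using coroot_inner[OF assms] by metis
  have "hyperplane \<alpha> c = {v. coroot \<alpha> \<bullet> v = k * c}"
    using k(1) by (auto simp: hyperplane_def k(2))
  moreover have "coroot \<alpha> \<noteq> 0" using k(1,3) by auto
  ultimately show ?thesis by (simp add: negligible_hyperplane)
qed

context roots
begin

lemma involution_wall_reflection: "s \<in> {wall_reflection \<alpha> k |\<alpha> k. \<alpha> \<in> R} \<Longrightarrow> s \<circ> s = id"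
  by (auto simp: fun_eq_iff root_nonzero wall_reflection_eq)

lemma W_aff_comp: "g \<in> W_aff R \<Longrightarrow> g' \<in> W_aff R \<Longrightarrow> g \<circ> g' \<in> W_aff R"
  unfolding W_aff_def by (rule group_generated_by_comp)

lemma W_aff_id: "id \<in> W_aff R"
  unfolding W_aff_def by (rule group_generated_by.one)

lemma W_aff_bij: "g \<in> W_aff R \<Longrightarrow> bij g"
  and W_aff_inv: "g \<in> W_aff R \<Longrightarrow> inv g \<in> W_aff R"
  unfolding W_aff_def using group_generated_by_inverse[OF involution_wall_reflection] by blast+

lemma W_aff_inv_apply [simp]:
  assumes "g \<in> W_aff R"
  shows "inv g (g v) = v" "g (inv g v) = v"
  using W_aff_bij[OF assms] by (simp_all add: bij_is_inj bij_is_surj surj_f_inv_f)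

lemma W_aff_reflection: "\<alpha> \<in> R \<Longrightarrow> reflection \<alpha> (of_int k) \<in> W_aff R"
  unfolding W_aff_def wall_reflection_eq[symmetric] by (rule group_generated_by_generator) blast

lemma W_sph_subset_W_aff: "g \<in> W_sph R \<Longrightarrow> g \<in> W_aff R"
  unfolding W_sph_def W_aff_def
proof (rule group_generated_by_mono)
  show "\<tau> ` R \<subseteq> group_generated_by {wall_reflection \<alpha> k |\<alpha> k. \<alpha> \<in> R}"
    using W_aff_reflection[of _ 0] by (auto simp: \<tau>_eq W_aff_def)
qed

lemma W_aff_linear_part:
  assumes "g \<in> W_aff R"
  obtains w where "w \<in> W_sph R" "\<And>x e. g (x + e) = g x + w e"
proof -
  have "\<exists>w\<in>W_sph R. \<forall>x e. g (x + e) = g x + w e"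
    using assms unfolding W_aff_def
  proof induction
    case one
    show ?case using W_sph_id by (intro bexI[of _ id]) auto
  next
    case (step s g)
    then obtain w where w: "w \<in> W_sph R" "\<And>x e. g (x + e) = g x + w e" by blast
    obtain \<alpha> k where s: "\<alpha> \<in> R" "s = reflection \<alpha> (of_int k)"
      using step(1) by (auto simp: wall_reflection_eq)
    have "s (x + e) = s x + \<tau> \<alpha> e" for x e
      by (simp add: s(2) reflection_def \<tau>_def root_linear algebra_simps)
    then show ?case using w s(1) by (intro bexI[of _ "\<tau> \<alpha> \<circ> w"] W_sph_comp W_sph_\<tau>) auto
  qed
  then show ?thesis using that by blast
qed

text \<open>
  Elements of \<open>W_aff\<close> change the level of a hyperplane only by an integer, since coroots have integral
  values.  Hence the orbit of any level hyperplane of a root is locally finite.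
\<close>

lemma W_aff_hyperplane:
  assumes "g \<in> W_aff R" "\<beta> \<in> R"
  obtains \<delta> and n :: int where "\<delta> \<in> R" "\<And>c. g ` hyperplane \<beta> c = hyperplane \<delta> (c + n)"
proof -
  have "\<exists>\<delta>\<in>R. \<exists>n::int. \<forall>c. g ` hyperplane \<beta> c = hyperplane \<delta> (c + n)"
    using assms(1) unfolding W_aff_def
  proof induction
    case one
    show ?case using assms(2) by (intro bexI[of _ \<beta>] exI[of _ 0]) auto
  next
    case (step s w)
    then obtain \<gamma> and j :: int where b: "\<gamma> \<in> R" "\<And>c. w ` hyperplane \<beta> c = hyperplane \<gamma> (c + j)" by blast
    obtain \<alpha> k where s: "\<alpha> \<in> R" "s = reflection \<alpha> (of_int k)"
      using step(1) by (auto simp: wall_reflection_eq)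
    obtain \<delta> where d: "\<delta> \<in> R" "\<And>v. \<delta> v = \<gamma> (\<tau> \<alpha> v)" using root_\<tau>[OF s(1) b(1)] by blast
    obtain n where n: "\<gamma> (coroot \<alpha>) = of_int n"
      using root_coroot_Ints[OF s(1) b(1)] by (auto elim: Ints_cases)
    have eq: "\<gamma> (s v) = c + of_int j \<longleftrightarrow> \<delta> v = c + of_int (j - k * n)" for v c
      by (simp add: d s \<tau>_def reflection_def root_linear n algebra_simps)
    have ss: "s (s v) = v" for v using s root_nonzero by simp
    have "(s \<circ> w) ` hyperplane \<beta> c = hyperplane \<delta> (c + of_int (j - k * n))" for c
    proof -
      have "(s \<circ> w) ` hyperplane \<beta> c = s ` hyperplane \<gamma> (c + of_int j)"
        by (simp only: image_comp[symmetric] b)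
      also have "\<dots> = {v. \<gamma> (s v) = c + of_int j}"
        using ss by (force simp: hyperplane_def image_iff)
      also have "\<dots> = hyperplane \<delta> (c + of_int (j - k * n))"
        unfolding eq hyperplane_def ..
      finally show ?thesis .
    qed
    then show ?case using d(1) by blast
  qed
  then show ?thesis using that by blast
qed

text \<open>
  If the mirror of the reflection were not a wall, then its orbit \<open>\<O>\<close> would contain no wall.  Each
  generator would move the point \<open>q\<close> across an even number of members of \<open>\<O>\<close> by \<open>reflection_parity\<close>, and
  so would each element of the group, since these numbers are additive modulo 2.  But the given
  reflection moves \<open>q\<close> across an odd number of them, its own mirror included.
\<close>

lemma W_aff_reflection_is_wall_reflection:
  assumes \<gamma>: "\<gamma> \<in> R" and refl: "reflection \<gamma> t \<in> W_aff R"
  obtains \<beta> and k :: int where "\<beta> \<in> R" "hyperplane \<gamma> t = hyperplane \<beta> k"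
proof (rule ccontr)
  assume "\<not> thesis"
  then have no: "\<And>\<beta> k. \<beta> \<in> R \<Longrightarrow> hyperplane \<gamma> t \<noteq> hyperplane \<beta> (of_int k)" using that by blast
  define \<O> where "\<O> = (\<lambda>g. g ` hyperplane \<gamma> t) ` W_aff R"
  have level: "\<exists>\<beta>\<in>R. \<exists>j::int. K = hyperplane \<beta> (t + j)" if K: "K \<in> \<O>" for K
  proof -
    obtain g where "g \<in> W_aff R" "K = g ` hyperplane \<gamma> t" using K by (auto simp: \<O>_def)
    then show ?thesis using W_aff_hyperplane[OF _ \<gamma>] by metis
  qed
  have fin: "finite {K\<in>\<O>. separates K m n}" for m n
  proof (rule finite_subset)
    let ?B = "\<lambda>\<beta>. \<bar>blinfun_apply \<beta> m\<bar> + \<bar>blinfun_apply \<beta> n\<bar>"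
    let ?J = "\<lambda>\<beta>. {\<lfloor>- ?B \<beta> - t\<rfloor>..\<lceil>?B \<beta> - t\<rceil>}"
    show "finite (\<Union>\<beta>\<in>R. (\<lambda>j::int. hyperplane \<beta> (t + j)) ` ?J \<beta>)"
      using finite_roots by auto
    show "{K\<in>\<O>. separates K m n} \<subseteq> (\<Union>\<beta>\<in>R. (\<lambda>j::int. hyperplane \<beta> (t + j)) ` ?J \<beta>)"
    proof
      fix K assume "K \<in> {K\<in>\<O>. separates K m n}"
      then obtain \<beta> j where b: "\<beta> \<in> R" "K = hyperplane \<beta> (t + of_int j)" "separates K m n"
        using level by blast
      then obtain u where u: "0 \<le> u" "u \<le> 1" "\<beta> ((1 - u) *\<^sub>R m + u *\<^sub>R n) = t + of_int j"
        by (auto simp: separates_def hyperplane_def closed_segment_def)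
      have "\<bar>t + of_int j\<bar> \<le> \<bar>(1 - u) * \<beta> m\<bar> + \<bar>u * \<beta> n\<bar>"
        unfolding u(3)[symmetric] root_linear real_scaleR_def by (rule abs_triangle_ineq)
      also have "\<dots> \<le> ?B \<beta>"
        using u(1,2) by (intro add_mono) (auto simp: abs_mult intro!: mult_left_le_one_le)
      finally have "j \<in> ?J \<beta>" by (auto simp: floor_le_iff le_ceiling_iff) 
      then show "K \<in> (\<Union>\<beta>\<in>R. (\<lambda>j::int. hyperplane \<beta> (t + j)) ` ?J \<beta>)" using b(1,2) by blast
    qed
  qed
  have stable: "g ` K \<in> \<O>" if g: "g \<in> W_aff R" and K: "K \<in> \<O>" for g K
  proof -
    obtain g' where "g' \<in> W_aff R" "K = g' ` hyperplane \<gamma> t" using K by (auto simp: \<O>_def)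
    then have "g ` K = (g \<circ> g') ` hyperplane \<gamma> t" "g \<circ> g' \<in> W_aff R"
      using W_aff_comp[OF g] by (auto simp only: image_comp)
    then show ?thesis unfolding \<O>_def by (rule image_eqI)
  qed
  obtain q where q: "\<And>K. K \<in> \<O> \<Longrightarrow> q \<notin> K"
  proof -
    have "negligible (\<Union>((\<lambda>(\<beta>, j::int). hyperplane \<beta> (t + j)) ` (R \<times> UNIV)))"
      using finite_roots root_nonzero
      by (intro negligible_countable_Union countable_image countable_SIGMA countableI_type countable_finite[of R])
        (auto intro: negligible_affine_hyperplane)
    then have "\<Union>((\<lambda>(\<beta>, j::int). hyperplane \<beta> (t + j)) ` (R \<times> UNIV)) \<noteq> UNIV" by auto
    then obtain q where "q \<notin> \<Union>((\<lambda>(\<beta>, j::int). hyperplane \<beta> (t + j)) ` (R \<times> UNIV))" by blast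
    then show ?thesis using level that by force
  qed
  have off: "g q \<notin> K" if g: "g \<in> W_aff R" and K: "K \<in> \<O>" for g K
  proof
    assume "g q \<in> K"
    then have "q \<in> inv g ` K" using W_aff_inv_apply(1)[OF g] by (metis imageI)
    then show False using q stable W_aff_inv g K by blast
  qed
  have hyp: "\<exists>\<beta> j. K = hyperplane \<beta> j" if "K \<in> \<O>" for K using level that by blast
  let ?N = "\<lambda>m n. {K\<in>\<O>. separates K m n}"
  have no_wall: "hyperplane \<alpha> (of_int k) \<notin> \<O>" if a: "\<alpha> \<in> R" for \<alpha> and k :: int
  proof
    assume "hyperplane \<alpha> (of_int k) \<in> \<O>"
    then obtain g where g: "g \<in> W_aff R" "hyperplane \<alpha> (of_int k) = g ` hyperplane \<gamma> t" by (auto simp: \<O>_def)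
    obtain \<delta> and n :: int where d: "\<delta> \<in> R" "\<And>c. inv g ` hyperplane \<alpha> c = hyperplane \<delta> (c + n)"
      using W_aff_hyperplane[OF W_aff_inv[OF g(1)] a] by blast
    from d(2)[of "of_int k"]
    have "inv g ` hyperplane \<alpha> (of_int k) = hyperplane \<delta> (of_int (k + n))" by simp
    moreover have "inv g ` g ` hyperplane \<gamma> t = hyperplane \<gamma> t"
      using g(1) by (simp add: image_image)
    ultimately show False using no[OF d(1), of "k + n"] g(2) by simp
  qed
  have "even (card (?N q (g q)))" if "g \<in> W_aff R" for g
    using that unfolding W_aff_def
  proof induction
    case one
    have "?N q (id q) = {}" using q by (auto simp: separates_def)
    then show ?case by (simp only: card.empty even_zero)
  next
    case (step s g)
    then have g: "g \<in> W_aff R" by (simp add: W_aff_def)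
    obtain \<alpha> k where s: "\<alpha> \<in> R" "s = reflection \<alpha> (of_int k)"
      using step(1) by (auto simp: wall_reflection_eq)
    have sW: "s \<in> W_aff R" using s W_aff_reflection by simp
    have inj: "inj s" using sW W_aff_bij bij_is_inj by blast
    have e1: "even (card (?N q (s q)))"
      using reflection_parity[of \<alpha> \<O> "of_int k" q] s no_wall[OF s(1)] root_nonzero hyp stable[OF sW] fin q by simp
    have "?N (s q) (s (g q)) = image s ` ?N q (g q)"
    proof -
      have sep: "separates (s ` K) (s q) (s (g q)) \<longleftrightarrow> separates K q (g q)" for K
        unfolding s(2) by (rule separates_image[OF linear_\<tau> reflection_affine inj_reflection[OF root_nonzero[OF s(1)]]])
      have ss: "s ` s ` K = K" for K using s root_nonzero by (simp add: image_image)
      show ?thesis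
      proof (intro equalityI subsetI)
        fix K assume "K \<in> ?N (s q) (s (g q))"
        then show "K \<in> image s ` ?N q (g q)"
          using sep[of "s ` K"] ss stable[OF sW] by (intro image_eqI[of _ _ "s ` K"]) auto
      qed (use sep stable[OF sW] in auto)
    qed
    then have e2: "card (?N (s q) (s (g q))) = card (?N q (g q))"
      using inj by (simp add: card_image inj_on_def inj_image_eq_iff)
    have e3: "?N q ((s \<circ> g) q) = {K. K \<in> ?N q (s q) \<longleftrightarrow> K \<notin> ?N (s q) (s (g q))}"
    proof -
      have "separates K q (s (g q)) \<longleftrightarrow> (separates K q (s q) \<longleftrightarrow> \<not> separates K (s q) (s (g q)))"
        if K: "K \<in> \<O>" for K
      proof -
        obtain \<beta> j where b: "K = hyperplane \<beta> j" using hyp K by blast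
        have "\<beta> q \<noteq> j" "\<beta> (s q) \<noteq> j" "\<beta> (s (g q)) \<noteq> j"
          using q[OF K] off[OF sW K] off[OF W_aff_comp[OF sW g] K] by (auto simp: b hyperplane_def)
        then show ?thesis by (auto simp: b separates_hyperplane)
      qed
      then show ?thesis by auto
    qed
    show ?case
      unfolding e3 even_card_symmetric_difference[OF fin fin] e2 using e1 step.IH by blast
  qed
  then have "even (card (?N q (reflection \<gamma> t q)))" using refl by blast
  moreover have "hyperplane \<gamma> t \<in> \<O>" 
    unfolding \<O>_def by (rule image_eqI[OF _ W_aff_id]) simp
  ultimately show False
    using reflection_parity[of \<gamma> \<O> t q] root_nonzero[OF \<gamma>] hyp stable[OF refl] fin q by simp
qed

end

section \<open>Retractions and geodesics in a Euclidean building\<close>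

lemma linear_eq_of_small:
  fixes f g :: "'v::euclidean_space \<Rightarrow> 'v"
  assumes "linear f" "linear g" "\<forall>\<^sub>F s in at_right 0. f (s *\<^sub>R v) = g (s *\<^sub>R v)"
  shows "f v = g v"
proof -
  obtain s :: real where "s > 0" "f (s *\<^sub>R v) = g (s *\<^sub>R v)"
    using eventually_happens[OF eventually_conj[OF assms(3) eventually_at_right_less[of "0::real"]]]
    by auto
  then show ?thesis using assms(1,2) by (simp add: linear_cmul)
qed

lemma linear_eq_on_chamber:
  fixes f g :: "'v::euclidean_space \<Rightarrow> 'v"
  assumes "linear f" "linear g" "\<forall>\<^sub>F e in nhds 0. e \<in> chamber_of R \<sigma> \<longrightarrow> f e = g e"
    and "v \<in> chamber_of R \<sigma>"
  shows "f v = g v"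
proof (rule linear_eq_of_small[OF assms(1,2)])
  show "\<forall>\<^sub>F s in at_right 0. f (s *\<^sub>R v) = g (s *\<^sub>R v)"
    using eventually_small_multiple[OF assms(3), of v] eventually_at_right_less[of "0::real"]
    by eventually_elim (use chamber_of_scaleR[OF assms(4)] in auto)
qed

text \<open>
  For \<open>a = y - c\<close> and \<open>b = d - c\<close>, Stewart's theorem reads
  \<open>\<bar>a - s b\<bar>\<^sup>2 = (1 - s) \<bar>a\<bar>\<^sup>2 + s \<bar>a - b\<bar>\<^sup>2 - s (1 - s) \<bar>b\<bar>\<^sup>2\<close>; the bounds on the distances make the right-hand
  side nonpositive.
\<close>

lemma segment_point_unique:
  fixes c d y :: "'v::euclidean_space"
  assumes "0 \<le> s" "s \<le> 1"
    and "dist y c \<le> dist (c + s *\<^sub>R (d - c)) c" "dist y d \<le> dist (c + s *\<^sub>R (d - c)) d"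
  shows "y = c + s *\<^sub>R (d - c)"
proof -
  define a b where "a = y - c" and "b = d - c"
  have "norm a \<le> s * norm b" using assms(1,3) by (simp add: dist_norm a_def b_def)
  then have 1: "(norm a)\<^sup>2 \<le> (s * norm b)\<^sup>2" by (intro power_mono) auto
  have "c + s *\<^sub>R (d - c) - d = (s - 1) *\<^sub>R b" by (simp add: b_def algebra_simps)
  then have "norm (a - b) \<le> (1 - s) * norm b"
    using assms(2,4) by (simp add: dist_norm a_def b_def)
  then have 2: "(norm (a - b))\<^sup>2 \<le> ((1 - s) * norm b)\<^sup>2" by (intro power_mono) auto
  have "(norm (a - s *\<^sub>R b))\<^sup>2 = (1 - s) * (norm a)\<^sup>2 + s * (norm (a - b))\<^sup>2 - s * (1 - s) * (norm b)\<^sup>2"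
    by (simp add: power2_norm_eq_inner inner_diff_left inner_diff_right inner_commute[of b a] algebra_simps)
  also have "\<dots> \<le> (1 - s) * (s * norm b)\<^sup>2 + s * ((1 - s) * norm b)\<^sup>2 - s * (1 - s) * (norm b)\<^sup>2"
    using 1 2 assms(1,2) by (intro diff_right_mono add_mono mult_left_mono) auto
  also have "\<dots> = 0" by (simp add: power2_eq_square algebra_simps)
  finally have "a - s *\<^sub>R b = 0" by simp
  then show ?thesis by (simp add: a_def b_def algebra_simps)
qed

context roots
begin

lemma vector_in_chamber:
  assumes "regular_vector R \<rho>"
  obtains \<sigma> where "regular_vector R \<sigma>" "v \<in> chamber_of R \<sigma>"
proof -
  obtain g where g: "g \<in> W_sph R" "g v \<in> chamber_of R \<rho>" using ex_W_sph_to_chamber[OF assms] .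
  have "v \<in> chamber_of R (inv g \<rho>)"
    using W_sph_chamber_of_iff[OF W_sph_inv[OF g(1)], of "g v" \<rho>] g by simp
  then show ?thesis using that W_sph_regular[OF W_sph_inv[OF g(1)] assms] by blast
qed

lemma zero_in_chamber_of: "0 \<in> chamber_of R \<sigma>"
  by (simp add: chamber_of_def root_linear)

text \<open>
  An alcove has interior points, so an affine map that fixes it pointwise is the identity.
\<close>

lemma W_aff_fixing_alcove:
  assumes "g \<in> W_aff R" "a \<in> alcoves R" "\<And>c. c \<in> a \<Longrightarrow> g c = c"
  shows "g v = v"
proof -
  obtain q d where q: "0 < d" "ball q d \<subseteq> a" using alcove_interior[OF assms(2)] .
  obtain w where w: "w \<in> W_sph R" "\<And>x e. g (x + e) = g x + w e" using W_aff_linear_part[OF assms(1)] by blast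
  have fixq: "g q = q" by (rule assms(3)) (use q in auto)
  have "w e = e" for e
  proof (rule linear_eq_of_small[OF W_sph_linear[OF w(1)] linear_id[unfolded id_def]])
    have "\<forall>\<^sub>F e in nhds 0. w e = e"
      unfolding eventually_nhds_metric
    proof (intro exI[of _ d] conjI allI impI q(1))
      fix e :: 'v assume "dist e 0 < d"
      then have "q + e \<in> a" using q(2) by (auto simp: dist_norm)
      then have "g (q + e) = q + e" by (rule assms(3))
      then show "w e = e" using w(2)[of q e] fixq by simp
    qed
    then show "\<forall>\<^sub>F s in at_right 0. w (s *\<^sub>R e) = s *\<^sub>R e" by (rule eventually_small_multiple)
  qed
  then show ?thesis using w(2)[of q "v - q"] fixq by simp
qed

end

text \<open>
  The vector \<open>\<rho>\<close> marks the Weyl chamber to which the building will be folded.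
\<close>

locale building = roots R for R :: "('v::euclidean_space \<Rightarrow>\<^sub>L real) set" +
  fixes charts :: "('v \<Rightarrow> 'x::metric_space) set" and \<rho> :: 'v
  assumes building: "euclidean_building R charts" and regular: "regular_vector R \<rho>"
begin

lemma chart_dist: "\<forall>f\<in>charts. \<forall>u v. dist (f u) (f v) = dist u v"
  using building unfolding euclidean_building_def by (elim conjE)

lemma chart_comp: "\<forall>f\<in>charts. \<forall>g\<in>W_aff R. f \<circ> g \<in> charts"
  using building unfolding euclidean_building_def by (elim conjE)

lemma chart_transition:
  "\<forall>f\<in>charts. \<forall>f'\<in>charts. \<exists>g\<in>W_aff R. \<forall>u v. f u = f' v \<longrightarrow> v = g u"
  using building unfolding euclidean_building_def by (elim conjE)

lemma common_chart:
  "\<forall>f\<in>charts. \<forall>f'\<in>charts. \<forall>a\<in>alcoves R. \<forall>a'\<in>alcoves R. \<exists>k\<in>charts. f ` a \<union> f' ` a' \<subseteq> range k"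
  using building unfolding euclidean_building_def by (elim conjE)

lemma inj_chart:
  assumes "f \<in> charts"
  shows "f u = f v \<longleftrightarrow> u = v"
  using chart_dist[rule_format, OF assms, of u v] by (metis dist_eq_0_iff)

text \<open>
  The transition from such a chart to \<open>\<iota>\<close> fixes the alcove and is therefore the identity; so
  \<open>\<iota> \<circ> inv k\<close> is an admissible isomorphism in the definition of the folding.  Any other admissible
  apartment and isomorphism gives the same value, because the composed transition again fixes the
  alcove.
\<close>

lemma Fold_alcove_eq:
  assumes \<iota>: "\<iota> \<in> charts" and a: "a \<in> alcoves R" and k: "k \<in> charts" "\<And>c. c \<in> a \<Longrightarrow> k c = \<iota> c"
  shows "Fold_alcove charts \<iota> a (k y) = y"
  unfolding Fold_alcove_def
proof (rule the_equality)
  obtain g where g: "g \<in> W_aff R" "\<forall>u v. k u = \<iota> v \<longrightarrow> v = g u"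
    using chart_transition[THEN bspec, THEN bspec, OF k(1) \<iota>] by blast
  note g = g(1) g(2)[rule_format]
  have "g c = c" if "c \<in> a" for c using g(2)[OF k(2)[OF that]] by simp
  then have "g c = c" for c by (rule W_aff_fixing_alcove[OF g(1) a])
  then have ki: "u = v" if "k u = \<iota> v" for u v using g(2)[OF that] by simp
  have ik: "inv k (k u) = u" for u by (intro inv_f_f injI) (simp add: inj_chart[OF k(1)])
  show "\<exists>B\<in>apartments charts. \<exists>\<phi>. k y \<in> B \<and> \<iota> ` a \<subseteq> B \<and> apartment_iso charts B (range \<iota>) \<phi> \<and>
          (\<forall>b \<in> range \<iota> \<inter> B. \<phi> b = b) \<and> \<iota> y = \<phi> (k y)"
  proof (intro bexI[of _ "range k"] exI[of _ "\<iota> \<circ> inv k"] conjI)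
    show "\<iota> ` a \<subseteq> range k" using k(2) by (metis image_subsetI rangeI)
    show "apartment_iso charts (range k) (range \<iota>) (\<iota> \<circ> inv k)"
      unfolding apartment_iso_def
    proof (intro bexI[of _ k] conjI)
      have "\<iota> \<circ> inv k \<circ> k = \<iota>" using ik by (simp add: fun_eq_iff)
      then show "\<iota> \<circ> inv k \<circ> k \<in> charts" "range (\<iota> \<circ> inv k \<circ> k) = range \<iota>" using \<iota> by simp_all
    qed (use k in auto)
    show "\<forall>b\<in>range \<iota> \<inter> range k. (\<iota> \<circ> inv k) b = b"
    proof
      fix b assume "b \<in> range \<iota> \<inter> range k"
      then obtain u v where uv: "b = k u" "b = \<iota> v" by blast
      then have "u = v" using ki by simp
      moreover have "(\<iota> \<circ> inv k) b = \<iota> u" by (simp add: uv(1) ik)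
      ultimately show "(\<iota> \<circ> inv k) b = b" using uv(2) by simp
    qed
  qed (use k ik in \<open>auto simp: apartments_def\<close>)
next
  fix y' assume "\<exists>B\<in>apartments charts. \<exists>\<phi>. k y \<in> B \<and> \<iota> ` a \<subseteq> B \<and> apartment_iso charts B (range \<iota>) \<phi> \<and>
          (\<forall>b \<in> range \<iota> \<inter> B. \<phi> b = b) \<and> \<iota> y' = \<phi> (k y)"
  then obtain B \<phi> where B: "k y \<in> B" "\<iota> ` a \<subseteq> B" "apartment_iso charts B (range \<iota>) \<phi>"
    "\<forall>b\<in>range \<iota> \<inter> B. \<phi> b = b" "\<iota> y' = \<phi> (k y)" by (elim bexE exE conjE)
  obtain f where f: "f \<in> charts" "range f = B" "\<phi> \<circ> f \<in> charts" using B(3) by (auto simp: apartment_iso_def)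
  obtain g where g: "g \<in> W_aff R" "\<forall>u v. k u = f v \<longrightarrow> v = g u"
    using chart_transition[THEN bspec, THEN bspec, OF k(1) f(1)] by blast
  note g = g(1) g(2)[rule_format]
  obtain g' where g': "g' \<in> W_aff R" "\<forall>u v. (\<phi> \<circ> f) u = \<iota> v \<longrightarrow> v = g' u"
    using chart_transition[THEN bspec, THEN bspec, OF f(3) \<iota>] by blast
  note g' = g'(1) g'(2)[rule_format]
  have fixes_a: "(g' \<circ> g) c = c" if c: "c \<in> a" for c
  proof -
    obtain v where v: "\<iota> c = f v" using B(2) f(2) c by blast
    then have "v = g c" using g(2) k(2)[OF c] by simp
    moreover have "\<iota> c \<in> range \<iota> \<inter> B" using B(2) c by blast
    then have "\<phi> (\<iota> c) = \<iota> c" by (rule B(4)[rule_format])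
    then have "\<phi> (f v) = \<iota> c" by (simp only: v)
    ultimately show ?thesis using g'(2)[of v c] by simp
  qed
  have "(g' \<circ> g) y = y" by (rule W_aff_fixing_alcove[OF W_aff_comp[OF g'(1) g(1)] a fixes_a])
  obtain v where "k y = f v" using B(1) f(2) by blast
  then have "v = g y" "\<phi> (f v) = \<iota> y'" using g(2) B(5) by simp_all
  then show "y' = y" using g'(2)[of v y'] \<open>(g' \<circ> g) y = y\<close> by simp
qed

lemma chart_through_alcoves:
  assumes \<iota>: "\<iota> \<in> charts" and a: "a \<in> alcoves R" and f: "f \<in> charts" and b: "b \<in> alcoves R"
  obtains k g where "k \<in> charts" "\<forall>c\<in>a. k c = \<iota> c" "g \<in> W_aff R" "\<forall>u\<in>b. f u = k (g u)"
proof -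
  obtain j where j: "j \<in> charts" "f ` b \<union> \<iota> ` a \<subseteq> range j"
    using common_chart[THEN bspec, THEN bspec, THEN bspec, THEN bspec, OF f \<iota> b a] by blast
  obtain g where g: "g \<in> W_aff R" "\<forall>u v. \<iota> u = j v \<longrightarrow> v = g u"
    using chart_transition[THEN bspec, THEN bspec, OF \<iota> j(1)] by blast
  obtain h where h: "h \<in> W_aff R" "\<forall>u v. f u = j v \<longrightarrow> v = h u"
    using chart_transition[THEN bspec, THEN bspec, OF f j(1)] by blast
  have "j \<circ> g \<in> charts" using chart_comp[rule_format] j(1) g(1) .
  moreover have "\<forall>c\<in>a. (j \<circ> g) c = \<iota> c"
  proof
    fix c assume "c \<in> a"
    then have "\<iota> c \<in> range j" using j(2) by auto
    then obtain v where v: "\<iota> c = j v" by (rule rangeE)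
    then have "v = g c" by (rule g(2)[rule_format])
    then show "(j \<circ> g) c = \<iota> c" by (simp add: v)
  qed
  moreover have "inv g \<circ> h \<in> W_aff R" using W_aff_comp W_aff_inv g(1) h(1) by blast
  moreover have "\<forall>u\<in>b. f u = (j \<circ> g) ((inv g \<circ> h) u)"
  proof
    fix u assume "u \<in> b"
    then have "f u \<in> range j" using j(2) by auto
    then obtain v where v: "f u = j v" by (rule rangeE)
    then have "v = h u" by (rule h(2)[rule_format])
    then show "f u = (j \<circ> g) ((inv g \<circ> h) u)" using g(1) by (simp add: v)
  qed
  ultimately show ?thesis by (rule that)
qed

text \<open>
  The alcove at \<open>x\<close> that contains the germ of the chamber lies with \<open>a\<close> in a common apartment, whose chart
  \<open>k\<close> describes the folding there.
\<close>

lemma Fold_germ: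
  assumes \<iota>: "\<iota> \<in> charts" and a: "a \<in> alcoves R" and f: "f \<in> charts" and \<sigma>: "regular_vector R \<sigma>"
  obtains k g w where "k \<in> charts" "\<forall>c\<in>a. k c = \<iota> c" "g \<in> W_aff R" "w \<in> W_sph R"
    "\<And>y e. g (y + e) = g y + w e" "g x = Fold_alcove charts \<iota> a (f x)"
    "\<forall>\<^sub>F e in nhds 0. e \<in> chamber_of R \<sigma> \<longrightarrow>
       f (x + e) = k (g x + w e) \<and> Fold_alcove charts \<iota> a (f (x + e)) = g x + w e"
proof -
  obtain b where b: "b \<in> alcoves R" "\<forall>\<^sub>F e in nhds 0. e \<in> chamber_of R \<sigma> \<longrightarrow> x + e \<in> b"
    using alcove_at[OF \<sigma>] .
  obtain k g where k: "k \<in> charts" "\<forall>c\<in>a. k c = \<iota> c" "g \<in> W_aff R" "\<forall>u\<in>b. f u = k (g u)"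
    using chart_through_alcoves[OF \<iota> a f b(1)] .
  obtain w where w: "w \<in> W_sph R" "\<And>x e. g (x + e) = g x + w e"
    using W_aff_linear_part[OF k(3)] by blast
  have fold: "Fold_alcove charts \<iota> a (f u) = g u" if "u \<in> b" for u
    using Fold_alcove_eq[OF \<iota> a k(1) k(2)[rule_format], of "g u"] k(4)[rule_format, OF that] by simp
  have "\<forall>\<^sub>F e in nhds 0. e \<in> chamber_of R \<sigma> \<longrightarrow>
       f (x + e) = k (g x + w e) \<and> Fold_alcove charts \<iota> a (f (x + e)) = g x + w e"
    using b(2)
  proof eventually_elim
    case (elim e)
    then show ?case using fold[of "x + e"] k(4)[rule_format, of "x + e"] w(2)[of x e] by simp
  qed
  moreover have "x \<in> b" using eventually_nhds_x_imp_x[OF b(2)] zero_in_chamber_of by simp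
  then have "g x = Fold_alcove charts \<iota> a (f x)" using fold by simp
  ultimately show ?thesis using that[OF k(1,2,3) w] by blast
qed

lemma Fold_ray:
  assumes \<iota>: "\<iota> \<in> charts" and a: "a \<in> alcoves R" and f: "f \<in> charts"
  obtains w \<delta> where "w \<in> W_sph R" "0 < \<delta>"
    "\<And>s. 0 \<le> s \<Longrightarrow> s < \<delta> \<Longrightarrow>
       Fold_alcove charts \<iota> a (f (x + s *\<^sub>R d)) = Fold_alcove charts \<iota> a (f x) + s *\<^sub>R w d"
proof -
  obtain \<sigma> where s: "regular_vector R \<sigma>" "d \<in> chamber_of R \<sigma>" using vector_in_chamber[OF regular] .
  obtain w where g: "w \<in> W_sph R" "\<forall>\<^sub>F e in nhds 0. e \<in> chamber_of R \<sigma> \<longrightarrow>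
       Fold_alcove charts \<iota> a (f (x + e)) = Fold_alcove charts \<iota> a (f x) + w e"
  proof (rule Fold_germ[OF \<iota> a f s(1), of x])
    fix k g w
    assume *: "w \<in> W_sph R" "g x = Fold_alcove charts \<iota> a (f x)"
      "\<forall>\<^sub>F e in nhds 0. e \<in> chamber_of R \<sigma> \<longrightarrow>
       f (x + e) = k (g x + w e) \<and> Fold_alcove charts \<iota> a (f (x + e)) = g x + w e"
    show thesis
    proof (rule that[OF *(1)])
      show "\<forall>\<^sub>F e in nhds 0. e \<in> chamber_of R \<sigma> \<longrightarrow>
         Fold_alcove charts \<iota> a (f (x + e)) = Fold_alcove charts \<iota> a (f x) + w e"
        using *(3)[unfolded *(2)] by eventually_elim blast
    qed
  qed
  have "\<forall>\<^sub>F s in at_right 0. s *\<^sub>R d \<in> chamber_of R \<sigma> \<longrightarrow>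
       Fold_alcove charts \<iota> a (f (x + s *\<^sub>R d)) = Fold_alcove charts \<iota> a (f x) + w (s *\<^sub>R d)"
    by (rule eventually_small_multiple[OF g(2)])
  then obtain \<delta> where d: "0 < \<delta>" "\<And>s. 0 < s \<Longrightarrow> s < \<delta> \<Longrightarrow> s *\<^sub>R d \<in> chamber_of R \<sigma> \<longrightarrow>
       Fold_alcove charts \<iota> a (f (x + s *\<^sub>R d)) = Fold_alcove charts \<iota> a (f x) + w (s *\<^sub>R d)"
    unfolding eventually_at_right_field by blast
  show ?thesis
  proof (rule that[OF g(1) d(1)])
    fix s :: real assume "0 \<le> s" "s < \<delta>"
    then show "Fold_alcove charts \<iota> a (f (x + s *\<^sub>R d)) = Fold_alcove charts \<iota> a (f x) + s *\<^sub>R w d"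
      using d(2)[of s] chamber_of_scaleR[OF s(2)] linear_cmul[OF W_sph_linear[OF g(1)]]
      by (cases "s = 0") auto
  qed
qed

text \<open>
  The folding maps the segment from \<open>u\<close> to \<open>v\<close> to a path of the same speed, by \<open>Fold_ray\<close> applied in both
  directions at each of its points.
\<close>

lemma Fold_dist_le:
  assumes \<iota>: "\<iota> \<in> charts" and a: "a \<in> alcoves R" and f: "f \<in> charts"
  shows "dist (Fold_alcove charts \<iota> a (f u)) (Fold_alcove charts \<iota> a (f v)) \<le> dist u v"
proof -
  define d where "d = v - u"
  define \<phi> where "\<phi> s = Fold_alcove charts \<iota> a (f (u + s *\<^sub>R d))" for s
  have ray: "\<exists>\<delta>>0. \<forall>s. 0 \<le> s \<and> s < \<delta> \<longrightarrow> dist (\<phi> x) (\<phi> (x + c * s)) = s * norm d"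
    if "\<bar>c\<bar> = 1" for x c
  proof -
    obtain w \<delta> where w: "w \<in> W_sph R" "0 < \<delta>"
      "\<And>s. 0 \<le> s \<Longrightarrow> s < \<delta> \<Longrightarrow>
       Fold_alcove charts \<iota> a (f ((u + x *\<^sub>R d) + s *\<^sub>R (c *\<^sub>R d))) = \<phi> x + s *\<^sub>R w (c *\<^sub>R d)"
      using Fold_ray[OF \<iota> a f, of "u + x *\<^sub>R d" "c *\<^sub>R d"] unfolding \<phi>_def by blast
    have "dist (\<phi> x) (\<phi> (x + c * s)) = s * norm d" if "0 \<le> s" "s < \<delta>" for s
    proof -
      have "\<phi> (x + c * s) = \<phi> x + s *\<^sub>R w (c *\<^sub>R d)"
        using w(3)[OF that] by (simp add: \<phi>_def algebra_simps)
      then show ?thesis using that(1) \<open>\<bar>c\<bar> = 1\<close> by (simp add: dist_norm W_sph_norm[OF w(1)])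
    qed
    then show ?thesis using w(2) by blast
  qed
  have "dist (\<phi> 0) (\<phi> 1) \<le> (1 - 0) * norm d"
  proof (rule Bolzano[where a = "0::real" and b = 1])
    show "dist (\<phi> r) (\<phi> t) \<le> (t - r) * norm d"
      if "dist (\<phi> r) (\<phi> s) \<le> (s - r) * norm d" "dist (\<phi> s) (\<phi> t) \<le> (t - s) * norm d" for r s t
      using that dist_triangle[of "\<phi> r" "\<phi> t" "\<phi> s"] by (simp add: algebra_simps)
    fix x :: real
    obtain \<delta> where \<delta>: "0 < \<delta>" "\<And>s. 0 \<le> s \<Longrightarrow> s < \<delta> \<Longrightarrow> dist (\<phi> x) (\<phi> (x + s)) = s * norm d"
      using ray[of 1 x] by auto
    obtain \<epsilon> where \<epsilon>: "0 < \<epsilon>" "\<And>s. 0 \<le> s \<Longrightarrow> s < \<epsilon> \<Longrightarrow> dist (\<phi> x) (\<phi> (x - s)) = s * norm d"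
      using ray[of "-1" x] by auto
    have "dist (\<phi> r) (\<phi> t) \<le> (t - r) * norm d" if "r \<le> x" "x \<le> t" "t - r < min \<delta> \<epsilon>" for r t
    proof -
      have "dist (\<phi> r) (\<phi> x) = (x - r) * norm d" "dist (\<phi> x) (\<phi> t) = (t - x) * norm d"
        using \<epsilon>(2)[of "x - r"] \<delta>(2)[of "t - x"] that by (auto simp: dist_commute)
      then show ?thesis using dist_triangle[of "\<phi> r" "\<phi> t" "\<phi> x"] by (simp add: algebra_simps)
    qed
    then show "\<exists>d'>0. \<forall>r t. r \<le> x \<and> x \<le> t \<and> t - r < d' \<longrightarrow> dist (\<phi> r) (\<phi> t) \<le> (t - r) * norm d"
      using \<delta>(1) \<epsilon>(1) by (intro exI[of _ "min \<delta> \<epsilon>"]) auto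
  qed simp
  then show ?thesis by (simp add: \<phi>_def d_def dist_norm norm_minus_commute)
qed

text \<open>
  This is the uniqueness of geodesics in \<open>X\<close>.  Let \<open>b\<close> be an alcove that contains the point \<open>m\<close> of the
  segment.  The retraction to the apartment of \<open>k\<close> with centre \<open>k ` b\<close> does not increase distances and
  fixes the end points, hence takes \<open>k' m\<close> to \<open>m\<close>.  But \<open>k' m\<close> and \<open>k ` b\<close> lie in a common apartment, on
  which the retraction is injective, so that \<open>k' m = k m\<close>.
\<close>

lemma charts_agree_on_segment:
  assumes k: "k \<in> charts" "k' \<in> charts" and c: "k c = k' c" and d: "k d = k' d" and s: "0 \<le> s" "s \<le> 1"
  shows "k (c + s *\<^sub>R (d - c)) = k' (c + s *\<^sub>R (d - c))"
proof -
  define m where "m = c + s *\<^sub>R (d - c)"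
  obtain b where b: "b \<in> alcoves R" "\<forall>\<^sub>F e in nhds 0. e \<in> chamber_of R \<rho> \<longrightarrow> m + e \<in> b"
    using alcove_at[OF regular] .
  have mb: "m \<in> b" using eventually_nhds_x_imp_x[OF b(2)] zero_in_chamber_of by simp
  let ?F = "Fold_alcove charts k b"
  have F: "?F (k u) = u" for u using Fold_alcove_eq[OF k(1) b(1) k(1)] by blast
  have "?F (k' m) = m"
    unfolding m_def
  proof (rule segment_point_unique[OF s])
    show "dist (?F (k' (c + s *\<^sub>R (d - c)))) c \<le> dist (c + s *\<^sub>R (d - c)) c"
      using Fold_dist_le[OF k(1) b(1) k(2), of _ c] F[of c] c by simp
    show "dist (?F (k' (c + s *\<^sub>R (d - c)))) d \<le> dist (c + s *\<^sub>R (d - c)) d"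
      using Fold_dist_le[OF k(1) b(1) k(2), of _ d] F[of d] d by simp
  qed
  moreover obtain j g where j: "j \<in> charts" "\<forall>c\<in>b. j c = k c" "g \<in> W_aff R" "\<forall>u\<in>b. k' u = j (g u)"
    using chart_through_alcoves[OF k(1) b(1) k(2) b(1)] .
  moreover have "k' m = j (g m)" using j(4) mb by blast
  ultimately have "g m = m"
    using Fold_alcove_eq[OF k(1) b(1) j(1) j(2)[rule_format], of "g m"] by simp
  then have "k' m = k m" using j(2) mb \<open>k' m = j (g m)\<close> by simp
  then show ?thesis by (simp add: m_def)
qed

end

section \<open>The germ of the folding\<close>

context roots
begin

text \<open>
  The roots that vanish at \<open>m\<close> are multiples of \<open>\<alpha>\<close>, and the others keep their signs near \<open>m\<close>.
\<close>

lemma panel_halfspace: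
  assumes "m \<in> chamber_of R \<sigma>" "panel_point R \<alpha> m" "0 < \<alpha> \<sigma>"
  shows "\<forall>\<^sub>F e in nhds 0. 0 \<le> \<alpha> e \<longrightarrow> m + e \<in> chamber_of R \<sigma>"
proof -
  have "\<forall>\<^sub>F e in nhds 0. \<forall>\<delta>\<in>R. 0 < \<delta> \<sigma> \<longrightarrow> 0 \<le> \<alpha> e \<longrightarrow> 0 \<le> \<delta> (m + e)"
  proof (rule eventually_ball_finite[OF finite_roots], rule ballI)
    fix \<delta> assume d: "\<delta> \<in> R"
    show "\<forall>\<^sub>F e in nhds 0. 0 < \<delta> \<sigma> \<longrightarrow> 0 \<le> \<alpha> e \<longrightarrow> 0 \<le> \<delta> (m + e)"
    proof (cases "\<delta> m = 0")
      case True
      then obtain c where c: "\<And>v. \<delta> v = c * \<alpha> v"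
        using assms(2) d unfolding panel_point_def proportional_def by blast
      have "0 \<le> \<delta> (m + e)" if "0 < \<delta> \<sigma>" "0 \<le> \<alpha> e" for e
        using that assms(3) True by (simp add: root_linear c zero_less_mult_iff)
      then show ?thesis by simp
    next
      case False
      show ?thesis
      proof (cases "0 < \<delta> \<sigma>")
        case True
        then have "0 < \<delta> m" using assms(1) d False by (auto simp: chamber_of_def order_less_le)
        moreover have "((\<lambda>e. \<delta> (m + e)) \<longlongrightarrow> \<delta> (m + 0)) (nhds 0)"
          by (intro tendsto_intros filterlim_ident)
        ultimately have "\<forall>\<^sub>F e in nhds 0. 0 < \<delta> (m + e)"
          by (intro order_tendstoD(1)) auto
        then show ?thesis by eventually_elim auto
      qed simp
    qed
  qed
  then show ?thesis by eventually_elim (auto simp: chamber_of_def)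
qed

lemma panel_point_fixed: "panel_point R \<alpha> m \<Longrightarrow> \<tau> \<alpha> m = m"
  by (simp add: panel_point_def \<tau>_def)

text \<open>
  The two chambers on either side of the panel share a neighbourhood of \<open>m\<close> in the hyperplane of \<open>\<alpha>\<close>.
\<close>

lemma linear_eq_panel:
  fixes w w' :: "'v \<Rightarrow> 'v"
  assumes \<alpha>: "\<alpha> \<in> R" "m \<in> chamber_of R \<sigma>" "panel_point R \<alpha> m" "0 < \<alpha> \<sigma>"
    and lin: "linear w" "linear w'"
    and agree: "\<forall>\<^sub>F e in nhds 0. e \<in> chamber_of R \<sigma> \<and> e \<in> chamber_of R (\<tau> \<alpha> \<sigma>) \<longrightarrow> w e = w' e"
    and e: "\<alpha> e = 0"
  shows "w e = w' e"
proof -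
  have both: "w v = w' v" if v: "v \<in> chamber_of R \<sigma>" "\<alpha> v = 0" for v
  proof (rule linear_eq_of_small[OF lin])
    have "\<tau> \<alpha> v = v" using v(2) by (simp add: \<tau>_def)
    then have v': "v \<in> chamber_of R (\<tau> \<alpha> \<sigma>)"
      using W_sph_chamber_of_iff[OF W_sph_\<tau>[OF \<alpha>(1)], of v \<sigma>] v(1) by simp
    show "\<forall>\<^sub>F s in at_right 0. w (s *\<^sub>R v) = w' (s *\<^sub>R v)"
      using eventually_small_multiple[OF agree, of v] eventually_at_right_less[of "0::real"]
      by eventually_elim (use chamber_of_scaleR[OF v(1)] chamber_of_scaleR[OF v'] in auto)
  qed
  have am: "\<alpha> m = 0" using \<alpha>(3) by (simp add: panel_point_def)
  show ?thesis
  proof (rule linear_eq_of_small[OF lin])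
    show "\<forall>\<^sub>F s in at_right 0. w (s *\<^sub>R e) = w' (s *\<^sub>R e)"
      using eventually_small_multiple[OF panel_halfspace[OF \<alpha>(2-4)], of e]
    proof eventually_elim
      case (elim s)
      have "\<alpha> (s *\<^sub>R e) = 0" by (simp add: root_linear e)
      then have "w (m + s *\<^sub>R e) = w' (m + s *\<^sub>R e)"
        using elim am by (intro both) (simp_all add: root_linear e)
      then show ?case using both[OF \<alpha>(2) am] by (simp add: linear_add[OF lin(1)] linear_add[OF lin(2)])
    qed
  qed
qed

lemma linear_eq_chamber:
  fixes w w' :: "'v \<Rightarrow> 'v"
  assumes "linear w" "linear w'"
    and agree: "\<forall>\<^sub>F e in nhds 0. e \<in> chamber_of R \<sigma> \<longrightarrow> w e = w' e"
  shows "w v = w' v"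
proof (rule linear_eq_of_small[OF assms(1,2)])
  have on: "w u = w' u" if "u \<in> chamber_of R \<sigma>" for u
    by (rule linear_eq_on_chamber[OF assms(1,2) agree that])
  have "\<forall>\<^sub>F s in at_right 0. \<forall>\<alpha>\<in>R. 0 < \<alpha> \<sigma> \<longrightarrow> 0 < \<alpha> (\<sigma> + s *\<^sub>R v)"
  proof (rule eventually_ball_finite[OF finite_roots], rule ballI)
    fix \<alpha> assume "\<alpha> \<in> R"
    have "((\<lambda>s. \<alpha> (\<sigma> + s *\<^sub>R v)) \<longlongrightarrow> \<alpha> (\<sigma> + 0 *\<^sub>R v)) (at_right 0)"
      by (intro tendsto_intros)
    then have "\<forall>\<^sub>F s in at_right 0. 0 < \<alpha> (\<sigma> + s *\<^sub>R v)" if "0 < \<alpha> \<sigma>"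
      using that by (intro order_tendstoD(1)) auto
    then show "\<forall>\<^sub>F s in at_right 0. 0 < \<alpha> \<sigma> \<longrightarrow> 0 < \<alpha> (\<sigma> + s *\<^sub>R v)" by (cases "0 < \<alpha> \<sigma>") auto
  qed
  then show "\<forall>\<^sub>F s in at_right 0. w (s *\<^sub>R v) = w' (s *\<^sub>R v)"
  proof eventually_elim
    case (elim s)
    then have "\<sigma> + s *\<^sub>R v \<in> chamber_of R \<sigma>" by (auto simp: chamber_of_def intro: less_imp_le)
    from on[OF this] on[OF self_in_chamber_of] show ?case
      by (simp add: linear_add[OF assms(1)] linear_add[OF assms(2)])
  qed
qed

text \<open>
  The quotient of the two isometries fixes the hyperplane pointwise, so that it maps the normal vector to
  a multiple of itself, with factor \<open>1\<close> or \<open>- 1\<close>.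
\<close>

lemma isometries_agreeing_on_hyperplane:
  assumes \<alpha>: "\<alpha> \<in> R" and w: "w \<in> W_sph R" "w' \<in> W_sph R"
    and agree: "\<And>e. \<alpha> e = 0 \<Longrightarrow> w e = w' e"
  shows "(\<forall>v. w' v = w v) \<or> (\<forall>v. w' v = w (\<tau> \<alpha> v))"
proof -
  define q where "q = inv w \<circ> w'"
  have q: "q \<in> W_sph R" unfolding q_def using w W_sph_comp W_sph_inv by blast
  have wq: "w (q v) = w' v" for v using w(1) by (simp add: q_def)
  have fixed: "q e = e" if "\<alpha> e = 0" for e using agree[OF that] w(1) by (simp add: q_def flip: agree[OF that])
  let ?c = "coroot \<alpha>"
  obtain k where k: "k > 0" "\<And>v. ?c \<bullet> v = k * \<alpha> v" "?c \<bullet> ?c = 2 * k" "\<alpha> ?c = 2"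
    using coroot_inner[OF root_nonzero[OF \<alpha>]] by metis
  define \<mu> where "\<mu> = \<alpha> (q ?c) / 2"
  define d where "d = q ?c - \<mu> *\<^sub>R ?c"
  have ad: "\<alpha> d = 0" by (simp add: d_def \<mu>_def root_linear k(4))
  have "q ?c \<bullet> q d = ?c \<bullet> d"
    using W_sph_linear_norm[OF q] orthogonal_transformation orthogonal_transformation_def by metis
  then have "q ?c \<bullet> d = 0" using fixed[OF ad] k(2) ad by simp
  moreover have "d \<bullet> d = q ?c \<bullet> d - \<mu> * (?c \<bullet> d)"
    by (subst (1) d_def) (simp add: inner_diff_left)
  ultimately have "d = 0" using k(2)[of d] ad by simp
  then have qc: "q ?c = \<mu> *\<^sub>R ?c" by (simp add: d_def)
  have "norm (q ?c) = norm ?c" by (rule W_sph_norm[OF q])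
  moreover have "?c \<noteq> 0" using k(1,3) by auto
  ultimately have "\<bar>\<mu>\<bar> = 1" by (simp add: qc)
  have split: "q v = v - (\<alpha> v / 2) *\<^sub>R ?c + (\<alpha> v / 2 * \<mu>) *\<^sub>R ?c" for v
  proof -
    have "\<alpha> (v - (\<alpha> v / 2) *\<^sub>R ?c) = 0" by (simp add: root_linear k(4))
    then have "q (v - (\<alpha> v / 2) *\<^sub>R ?c) = v - (\<alpha> v / 2) *\<^sub>R ?c" by (rule fixed)
    moreover have "q ((\<alpha> v / 2) *\<^sub>R ?c) = (\<alpha> v / 2 * \<mu>) *\<^sub>R ?c"
      by (simp add: linear_cmul[OF W_sph_linear[OF q]] qc)
    moreover have "q v = q (v - (\<alpha> v / 2) *\<^sub>R ?c) + q ((\<alpha> v / 2) *\<^sub>R ?c)"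
      by (simp flip: linear_add[OF W_sph_linear[OF q]])
    ultimately show ?thesis by simp
  qed
  consider "\<mu> = 1" | "\<mu> = - 1" using \<open>\<bar>\<mu>\<bar> = 1\<close> by linarith
  then show ?thesis
  proof cases
    case 1
    then have "q v = v" for v using split[of v] by simp
    then show ?thesis using wq by simp
  next
    case 2
    have "q v = \<tau> \<alpha> v" for v
    proof -
      have "(\<alpha> v / 2) *\<^sub>R ?c + (\<alpha> v / 2) *\<^sub>R ?c = \<alpha> v *\<^sub>R ?c"
        by (simp flip: scaleR_left_distrib)
      then show ?thesis using split[of v] 2 by (simp add: \<tau>_def diff_diff_eq)
    qed
    then show ?thesis using wq by simp
  qed
qed

lemma root_positive_on_chamber:
  assumes "regular_vector R \<rho>" "\<beta> \<in> R" "v \<in> chamber_of R \<rho>" "0 < \<beta> v"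
  shows "\<beta> \<in> positive_roots R (chamber_of R \<rho>)"
proof -
  have "0 < \<beta> \<rho>"
    using regular_cases[OF assms(1,2)] chamber_of_neg[OF assms(3,2)] assms(4) by auto
  then show ?thesis using assms(2) by (auto simp: positive_roots_def chamber_of_def)
qed

lemma hyperplane_eq_proportional:
  assumes "\<alpha> \<in> R" "hyperplane \<alpha> (\<alpha> y) = hyperplane \<beta> c"
  shows "\<beta> y = c" "proportional \<alpha> \<beta>"
proof -
  have "y \<in> hyperplane \<beta> c" using assms(2) by (auto simp: hyperplane_def)
  then show y: "\<beta> y = c" by (simp add: hyperplane_def)
  have "\<beta> e = 0" if "\<alpha> e = 0" for e
  proof -
    have "y + e \<in> hyperplane \<alpha> (\<alpha> y)" using that by (simp add: hyperplane_def root_linear)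
    then have "\<beta> (y + e) = c" unfolding assms(2) by (simp add: hyperplane_def)
    then show ?thesis using y by (simp add: root_linear)
  qed
  then show "proportional \<alpha> \<beta>" using proportional_iff_kernel[OF root_nonzero[OF assms(1)]] by blast
qed

end

text \<open>
  The map \<open>F\<close> below is the retraction and \<open>G\<close> the whole folding, both in the coordinates that \<open>f\<close> gives to
  the apartment of the path.
\<close>

locale folding = building R charts \<rho>
  for R :: "('v::euclidean_space \<Rightarrow>\<^sub>L real) set" and charts :: "('v \<Rightarrow> 'x::metric_space) set" and \<rho> +
  fixes \<iota> f :: "'v \<Rightarrow> 'x" and a :: "'v set" and z b :: 'v and l :: real and h :: "'v \<Rightarrow> 'v"
  assumes \<iota>: "\<iota> \<in> charts" and f: "f \<in> charts" and a: "a \<in> alcoves R" "z \<in> a"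
    and l: "0 < l" and h: "h = (\<lambda>x. l *\<^sub>R x + b)" "h z = 0"
    and h_W: "\<And>w. w \<in> W_aff R \<Longrightarrow> h \<circ> w \<circ> inv h \<in> W_aff R"
begin

definition F :: "'v \<Rightarrow> 'v" where "F x = Fold_alcove charts \<iota> a (f x)"

definition G :: "'v \<Rightarrow> 'v" where "G x = Fold_chamber R (chamber_of R \<rho>) charts \<iota> h a (f x)"

lemma G_eq: "G x = proj_chamber R (chamber_of R \<rho>) (h (F x))"
  by (simp add: G_def F_def Fold_chamber_def)

lemma h_add: "h (x + e) = h x + l *\<^sub>R e"
  by (simp add: h(1) algebra_simps)

lemma h_eq: "h x = l *\<^sub>R (x - z)"
  using h_add[of z "x - z"] h(2) by simp

lemma bij_h: "bij h"
proof (rule o_bij)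
  show "(\<lambda>y. (1 / l) *\<^sub>R (y - b)) \<circ> h = id" "h \<circ> (\<lambda>y. (1 / l) *\<^sub>R (y - b)) = id"
    using l by (auto simp: h(1) fun_eq_iff)
qed

text \<open>
  The germ of the folded map \<open>G\<close> at \<open>x\<close> in the directions of the chamber of \<open>\<sigma>\<close>: near \<open>x\<close> the
  retraction is given by \<open>g\<close>, with linear part \<open>w\<close>, and the projection to the chamber
  by \<open>p\<close>.
\<close>

definition germ :: "'v \<Rightarrow> 'v \<Rightarrow> ('v \<Rightarrow> 'x) \<Rightarrow> ('v \<Rightarrow> 'v) \<Rightarrow> ('v \<Rightarrow> 'v) \<Rightarrow> ('v \<Rightarrow> 'v) \<Rightarrow> bool" where
  "germ x \<sigma> k g w p \<longleftrightarrow>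
     k \<in> charts \<and> (\<forall>c\<in>a. k c = \<iota> c) \<and> g \<in> W_aff R \<and> w \<in> W_sph R \<and> (\<forall>y e. g (y + e) = g y + w e) \<and>
     g x = F x \<and> p \<in> W_sph R \<and>
     (\<forall>\<^sub>F e in nhds 0. e \<in> chamber_of R \<sigma> \<longrightarrow> f (x + e) = k (F x + w e) \<and> F (x + e) = F x + w e) \<and>
     (\<forall>\<^sub>F e in nhds 0. e \<in> chamber_of R (w \<sigma>) \<longrightarrow>
        p (h (F x) + e) \<in> chamber_of R \<rho> \<and> proj_chamber R (chamber_of R \<rho>) (h (F x) + e) = p (h (F x) + e))"

lemma ex_germ:
  assumes "regular_vector R \<sigma>"
  obtains k g w p where "germ x \<sigma> k g w p"
proof -
  obtain k g w where *: "k \<in> charts" "\<forall>c\<in>a. k c = \<iota> c" "g \<in> W_aff R" "w \<in> W_sph R"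
    "\<And>y e. g (y + e) = g y + w e" "g x = Fold_alcove charts \<iota> a (f x)"
    "\<forall>\<^sub>F e in nhds 0. e \<in> chamber_of R \<sigma> \<longrightarrow>
       f (x + e) = k (g x + w e) \<and> Fold_alcove charts \<iota> a (f (x + e)) = g x + w e"
    using Fold_germ[OF \<iota> a(1) f assms, of x] by blast
  obtain p where p: "p \<in> W_sph R"
    "\<forall>\<^sub>F e in nhds 0. e \<in> chamber_of R (w \<sigma>) \<longrightarrow>
        p (h (F x) + e) \<in> chamber_of R \<rho> \<and> proj_chamber R (chamber_of R \<rho>) (h (F x) + e) = p (h (F x) + e)"
    using proj_chamber_germ[OF regular W_sph_regular[OF *(4) assms], of "h (F x)"] .
  have "germ x \<sigma> k g w p"
    unfolding germ_def using * p by (simp add: F_def)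
  then show ?thesis by (rule that)
qed

lemma germ_apex:
  assumes "germ x \<sigma> k g w p"
  shows "p (h (F x)) = G x" "G x \<in> chamber_of R \<rho>"
proof -
  have "\<forall>\<^sub>F e in nhds 0. e \<in> chamber_of R (w \<sigma>) \<longrightarrow>
        p (h (F x) + e) \<in> chamber_of R \<rho> \<and> proj_chamber R (chamber_of R \<rho>) (h (F x) + e) = p (h (F x) + e)"
    using assms by (simp add: germ_def)
  from eventually_nhds_x_imp_x[OF this] show "p (h (F x)) = G x" "G x \<in> chamber_of R \<rho>"
    by (simp_all add: zero_in_chamber_of G_eq)
qed

lemma germ_G:
  assumes "germ x \<sigma> k g w p"
  shows "\<forall>\<^sub>F e in nhds 0. e \<in> chamber_of R \<sigma> \<longrightarrow> G (x + e) = G x + l *\<^sub>R p (w e) \<and> G (x + e) \<in> chamber_of R \<rho>"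
proof -
  have w: "w \<in> W_sph R" and p: "p \<in> W_sph R"
    and ev1: "\<forall>\<^sub>F e in nhds 0. e \<in> chamber_of R \<sigma> \<longrightarrow> f (x + e) = k (F x + w e) \<and> F (x + e) = F x + w e"
    and ev2: "\<forall>\<^sub>F e in nhds 0. e \<in> chamber_of R (w \<sigma>) \<longrightarrow>
        p (h (F x) + e) \<in> chamber_of R \<rho> \<and> proj_chamber R (chamber_of R \<rho>) (h (F x) + e) = p (h (F x) + e)"
    using assms by (simp_all add: germ_def)
  have "((\<lambda>e. l *\<^sub>R w e) \<longlongrightarrow> l *\<^sub>R w 0) (nhds 0)"
  proof (intro tendsto_intros)
    show "(w \<longlongrightarrow> w 0) (nhds 0)"
      using linear_continuous_at[OF linear_conv_bounded_linear[THEN iffD1, OF W_sph_linear[OF w]], of 0]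
      unfolding isCont_def tendsto_at_iff_tendsto_nhds .
  qed
  then have "filterlim (\<lambda>e. l *\<^sub>R w e) (nhds 0) (nhds 0)"
    by (simp add: linear_0[OF W_sph_linear[OF w]])
  then have "\<forall>\<^sub>F e in nhds 0. l *\<^sub>R w e \<in> chamber_of R (w \<sigma>) \<longrightarrow>
        p (h (F x) + l *\<^sub>R w e) \<in> chamber_of R \<rho> \<and>
        proj_chamber R (chamber_of R \<rho>) (h (F x) + l *\<^sub>R w e) = p (h (F x) + l *\<^sub>R w e)"
    using ev2 unfolding filterlim_iff by blast
  with ev1 show ?thesis
  proof eventually_elim
    case (elim e)
    show ?case
    proof
      assume e: "e \<in> chamber_of R \<sigma>"
      then have "w e \<in> chamber_of R (w \<sigma>)" using W_sph_chamber_of_iff[OF w] by blast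
      then have "l *\<^sub>R w e \<in> chamber_of R (w \<sigma>)" using l by (intro chamber_of_scaleR) simp_all
      then have *: "p (h (F x) + l *\<^sub>R w e) \<in> chamber_of R \<rho>"
        "proj_chamber R (chamber_of R \<rho>) (h (F x) + l *\<^sub>R w e) = p (h (F x) + l *\<^sub>R w e)"
        using elim by blast+
      have "p (h (F x) + l *\<^sub>R w e) = G x + l *\<^sub>R p (w e)"
        using germ_apex(1)[OF assms]
        by (simp add: linear_add[OF W_sph_linear[OF p]] linear_cmul[OF W_sph_linear[OF p]])
      moreover have "G (x + e) = proj_chamber R (chamber_of R \<rho>) (h (F x) + l *\<^sub>R w e)"
        using elim e by (simp add: G_eq h_add)
      ultimately show "G (x + e) = G x + l *\<^sub>R p (w e) \<and> G (x + e) \<in> chamber_of R \<rho>"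
        using * by simp
    qed
  qed
qed

end

section \<open>Crossing panels\<close>

context folding
begin

text \<open>
  Folds open away from the centre.  Otherwise the segment from a point of the folded panel to \<open>z\<close> would
  start inside the folded germ.  The two charts that describe the retraction on either side of the panel
  agree at both ends of this segment, hence on all of it.  There they would identify a point
  \<open>x + e\<close> with its mirror image in the panel, although \<open>f\<close> is injective.
\<close>

lemma fold_away_from_centre:
  assumes g: "germ x \<sigma> k g w p" "germ x (\<tau> \<alpha> \<sigma>) k' g' w' p'"
    and \<sigma>: "\<alpha> \<in> R" "0 < \<alpha> \<sigma>" "m \<in> chamber_of R \<sigma>" "panel_point R \<alpha> m"
    and fold: "\<And>v. w' v = w (\<tau> \<alpha> v)"
  shows "\<alpha> (inv w (z - F x)) \<le> 0"
proof (rule ccontr)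
  assume "\<not> ?thesis"
  define \<zeta> where "\<zeta> = inv w (z - F x)"
  have pos: "0 < \<alpha> \<zeta>" using \<open>\<not> _\<close> by (simp add: \<zeta>_def)
  have k: "k \<in> charts" "k' \<in> charts" "k z = k' z" and w: "w \<in> W_sph R"
    and ev: "\<forall>\<^sub>F e in nhds 0. e \<in> chamber_of R \<sigma> \<longrightarrow> f (x + e) = k (F x + w e)"
    and ev': "\<forall>\<^sub>F e in nhds 0. e \<in> chamber_of R (\<tau> \<alpha> \<sigma>) \<longrightarrow> f (x + e) = k' (F x + w' e)"
    using g a(2) by (auto simp: germ_def elim: eventually_mono)
  have \<alpha>: "\<alpha> \<noteq> 0" using \<sigma>(1) root_nonzero by blast
  obtain r where r: "0 < r"
    "\<And>e. norm e < r \<Longrightarrow> e \<in> chamber_of R \<sigma> \<Longrightarrow> f (x + e) = k (F x + w e)"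
    "\<And>e. norm e < r \<Longrightarrow> e \<in> chamber_of R (\<tau> \<alpha> \<sigma>) \<Longrightarrow> f (x + e) = k' (F x + w' e)"
    using eventually_conj[OF ev ev'] unfolding eventually_nhds_metric by (auto simp: dist_norm)
  have refl: "\<tau> \<alpha> e \<in> chamber_of R (\<tau> \<alpha> \<sigma>)" if "e \<in> chamber_of R \<sigma>" for e
    using W_sph_chamber_of_iff[OF W_sph_\<tau>[OF \<sigma>(1)]] that by blast
  \<comment> \<open>Both charts describe \<open>f\<close> at \<open>x + e\<close> and at its mirror image, and these have the same image.\<close>
  have img: "k (F x + w e) = f (x + e)" "k' (F x + w e) = f (x + \<tau> \<alpha> e)"
    if "norm e < r" "e \<in> chamber_of R \<sigma>" for e
    using r(2)[OF that] r(3)[of "\<tau> \<alpha> e"] refl[OF that(2)] that(1) \<alpha> by (simp_all add: fold)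
  have "\<forall>\<^sub>F e in nhds (0::'v). norm e < r"
    using r(1) unfolding eventually_nhds_metric by (auto simp: dist_norm)
  then obtain s where s: "0 < s" "norm (s *\<^sub>R m) < r" using small_multiple by metis
  define n where "n = s *\<^sub>R m"
  have n: "norm n < r" "n \<in> chamber_of R \<sigma>" "panel_point R \<alpha> n"
    using s \<sigma>(4) chamber_of_scaleR[OF \<sigma>(3) less_imp_le[OF s(1)]]
    by (auto simp: n_def panel_point_def root_linear)
  have agree: "k (F x + w n) = k' (F x + w n)"
    using img[OF n(1,2)] panel_point_fixed[OF n(3)] by simp
  define e where "e t = n + t *\<^sub>R (\<zeta> - n)" for t
  have an: "\<alpha> n = 0" using n(3) by (simp add: panel_point_def)
  have "\<forall>\<^sub>F t in at_right 0. 0 \<le> \<alpha> (t *\<^sub>R (\<zeta> - n)) \<longrightarrow> e t \<in> chamber_of R \<sigma>"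
    unfolding e_def by (rule eventually_small_multiple[OF panel_halfspace[OF n(2,3) \<sigma>(2)]])
  moreover have "\<forall>\<^sub>F t in at_right 0. norm (e t) < r"
  proof (rule order_tendstoD(2))
    show "((\<lambda>t. norm (e t)) \<longlongrightarrow> norm (n + 0 *\<^sub>R (\<zeta> - n))) (at_right 0)"
      unfolding e_def by (intro tendsto_intros)
  qed (use n in simp)
  moreover have "\<forall>\<^sub>F t in at_right (0::real). t \<in> {0<..<1}" by (rule eventually_at_right_real) simp
  ultimately have "\<forall>\<^sub>F t in at_right 0. 0 < t \<and> t < 1 \<and> norm (e t) < r \<and> e t \<in> chamber_of R \<sigma>"
    by eventually_elim (use pos an in \<open>auto simp: root_linear\<close>)
  then obtain t where t: "0 < t" "t < 1" "norm (e t) < r" "e t \<in> chamber_of R \<sigma>"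
    by (auto dest: eventually_happens)
  have z_eq: "z = F x + w \<zeta>" using w by (simp add: \<zeta>_def)
  have on_segment: "F x + w (e t) = (F x + w n) + t *\<^sub>R (z - (F x + w n))"
    by (subst z_eq) (simp add: e_def linear_add[OF W_sph_linear[OF w]] linear_cmul[OF W_sph_linear[OF w]]
        linear_diff[OF W_sph_linear[OF w]] algebra_simps)
  have "k (F x + w (e t)) = k' (F x + w (e t))"
    unfolding on_segment 
    by (rule charts_agree_on_segment[OF k(1,2) agree k(3)]) (use t(1,2) in simp_all)
  then have "f (x + e t) = f (x + \<tau> \<alpha> (e t))" using img[OF t(3,4)] by simp
  then have "\<tau> \<alpha> (e t) = e t" using inj_chart[OF f] by simp
  then have "\<alpha> (e t) = 0" using reflection_fixes_iff[OF \<alpha>] by (simp add: \<tau>_eq)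
  then show False using t(1) pos an by (simp add: e_def root_linear)
qed

text \<open>
  The elements \<open>g\<close> and \<open>g'\<close> of \<open>W_aff\<close> that describe the retraction on either side of the panel differ by
  the reflection in the folded panel; the dilation and the projection conjugate it into the reflection
  in question.
\<close>

lemma fold_reflection_W_aff:
  assumes g: "germ x \<sigma> k g w p" "germ x (\<tau> \<alpha> \<sigma>) k' g' w' p'"
    and \<alpha>: "\<alpha> \<in> R" and \<beta>: "\<beta> \<in> R" "\<And>v. \<beta> (p (w v)) = \<alpha> v"
    and fold: "\<And>v. w' v = w (\<tau> \<alpha> v)"
  shows "reflection \<beta> (\<beta> (G x)) \<in> W_aff R"
proof -
  have gW: "g \<in> W_aff R" "g' \<in> W_aff R" and w: "w \<in> W_sph R" and p: "p \<in> W_sph R"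
    and ga: "\<And>y e. g (y + e) = g y + w e" "\<And>y e. g' (y + e) = g' y + w' e"
    and gx: "g x = F x" "g' x = F x"
    using g by (auto simp: germ_def)
  define T where "T = p \<circ> (h \<circ> (g' \<circ> inv g) \<circ> inv h) \<circ> inv p"
  have T: "T \<in> W_aff R"
  proof -
    have 1: "h \<circ> (g' \<circ> inv g) \<circ> inv h \<in> W_aff R" using h_W W_aff_comp W_aff_inv gW by blast
    have 2: "p \<in> W_aff R" "inv p \<in> W_aff R" using p W_sph_subset_W_aff W_sph_inv by blast+
    show ?thesis unfolding T_def by (rule W_aff_comp[OF W_aff_comp[OF 2(1) 1] 2(2)])
  qed
  have pw: "p \<circ> w \<in> W_sph R" using p w W_sph_comp by blast
  have Gx: "p (h (F x)) = G x" by (rule germ_apex(1)[OF g(1)])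
  note lin = linear_add[OF W_sph_linear[OF p]] linear_cmul[OF W_sph_linear[OF p]]
  have Tv: "T (G x + l *\<^sub>R p (w e)) = G x + l *\<^sub>R p (w (\<tau> \<alpha> e))" for e
  proof -
    have 1: "G x + l *\<^sub>R p (w e) = p (h (g (x + e)))"
      by (simp add: ga gx h_add lin Gx)
    have "T (p (h (g (x + e)))) = p (h (g' (x + e)))"
      using p gW(1) bij_h by (simp add: T_def bij_is_inj)
    also have "\<dots> = G x + l *\<^sub>R p (w (\<tau> \<alpha> e))"
      by (simp add: ga gx h_add lin Gx fold)
    finally show ?thesis unfolding 1 .
  qed
  have "T v = reflection \<beta> (\<beta> (G x)) v" for v
  proof -
    define e where "e = inv (p \<circ> w) ((1 / l) *\<^sub>R (v - G x))"
    have "p (w e) = (1 / l) *\<^sub>R (v - G x)"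
      using W_sph_inv_apply(2)[OF pw, of "(1 / l) *\<^sub>R (v - G x)"] by (simp add: e_def)
    then have v: "v = G x + l *\<^sub>R p (w e)" using l by simp
    have "\<tau> \<beta> (p (w e)) = p (w (\<tau> \<alpha> e))"
      using \<tau>_conjugate(2)[of \<alpha> \<beta> "p \<circ> w" e] root_nonzero \<alpha> \<beta> W_sph_linear[OF pw] W_sph_norm[OF pw]
      by simp
    then have "T v = G x + \<tau> \<beta> (l *\<^sub>R p (w e))"
      by (subst v, subst Tv) (simp add: linear_cmul[OF linear_\<tau>])
    also have "\<dots> = reflection \<beta> (\<beta> (G x)) v"
      by (subst v) (simp add: reflection_def \<tau>_def root_linear)
    finally show ?thesis .
  qed
  then have "T = reflection \<beta> (\<beta> (G x))" by blast
  with T show ?thesis by simp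
qed

text \<open>
  The linear parts of the retraction on the two sides of the panel agree on the panel, so they are equal
  or differ by \<open>\<tau> \<alpha>\<close>.  If they differ, the two germs are folded to the same place and the projection
  cannot fold as well.  If they are equal, the same dichotomy applies to the projection.  Whenever one of
  them folds, \<open>\<beta>\<close>, the image of \<open>\<alpha>\<close> under the linear part, is nonnegative at \<open>G x\<close> and positive at points of
  the folded germ, which lies in the chamber of \<open>\<rho>\<close>; hence it is a positive root.
\<close>

lemma panel_crossing:
  assumes g: "germ x \<sigma> k g w p" "germ x (\<tau> \<alpha> \<sigma>) k' g' w' p'"
    and \<sigma>: "\<alpha> \<in> R" "0 < \<alpha> \<sigma>" "m \<in> chamber_of R \<sigma>" "panel_point R \<alpha> m"
  shows "(\<forall>v. p' (w' v) = p (w v)) \<or>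
    (\<exists>\<beta>\<in>positive_roots R (chamber_of R \<rho>). blinfun_apply \<beta> (G x) \<in> \<int> \<and> (\<forall>v. p' (w' v) = \<tau> \<beta> (p (w v))) \<and>
       (\<forall>v. \<alpha> v \<le> 0 \<longrightarrow> blinfun_apply \<beta> (p (w v)) \<le> 0))"
proof -
  have w: "w \<in> W_sph R" "w' \<in> W_sph R" and p: "p \<in> W_sph R" "p' \<in> W_sph R"
    and ev: "\<forall>\<^sub>F e in nhds 0. e \<in> chamber_of R \<sigma> \<longrightarrow> F (x + e) = F x + w e"
    and ev': "\<forall>\<^sub>F e in nhds 0. e \<in> chamber_of R (\<tau> \<alpha> \<sigma>) \<longrightarrow> F (x + e) = F x + w' e"
    and pev: "\<forall>\<^sub>F e in nhds 0. e \<in> chamber_of R (w \<sigma>) \<longrightarrow>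
        proj_chamber R (chamber_of R \<rho>) (h (F x) + e) = p (h (F x) + e)"
    and pev': "\<forall>\<^sub>F e in nhds 0. e \<in> chamber_of R (w' (\<tau> \<alpha> \<sigma>)) \<longrightarrow>
        proj_chamber R (chamber_of R \<rho>) (h (F x) + e) = p' (h (F x) + e)"
    using g by (auto simp: germ_def elim: eventually_mono)
  note linw = W_sph_linear[OF w(1)] W_sph_linear[OF w(2)]
  note linp = W_sph_linear[OF p(1)] W_sph_linear[OF p(2)]
  have \<alpha>: "\<alpha> \<noteq> 0" using \<sigma>(1) root_nonzero by blast
  have py: "p (h (F x)) = G x" "p' (h (F x)) = G x" using germ_apex(1) g by blast+
  have pw: "p \<circ> w \<in> W_sph R" using p w W_sph_comp by blast
  obtain \<beta> where b: "\<beta> \<in> R" "\<And>v. \<beta> ((p \<circ> w) v) = \<alpha> v" using W_sph_root_inv[OF pw \<sigma>(1)] by blast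
  then have b2: "\<beta> (p (w v)) = \<alpha> v" for v by simp
  have conj: "\<tau> \<beta> (p (w v)) = p (w (\<tau> \<alpha> v))" for v
    using \<tau>_conjugate(2)[of \<alpha> \<beta> "p \<circ> w" v] \<alpha> root_nonzero[OF b(1)] b(2) W_sph_linear[OF pw] W_sph_norm[OF pw]
    by simp
  have bG: "\<beta> (G x) = \<alpha> (inv w (h (F x)))"
  proof -
    have "G x = p (w (inv w (h (F x))))" using w(1) py(1) by simp
    then show ?thesis using b2 by metis
  qed
  \<comment> \<open>The folded germ lies in the chamber, on the positive side of \<open>\<beta>\<close>.\<close>
  have \<beta>_positive: "\<beta> \<in> positive_roots R (chamber_of R \<rho>)" if "0 \<le> \<beta> (G x)"
  proof -
    obtain s where s: "0 < s" "s *\<^sub>R \<sigma> \<in> chamber_of R \<sigma> \<longrightarrow>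
        G (x + s *\<^sub>R \<sigma>) = G x + l *\<^sub>R p (w (s *\<^sub>R \<sigma>)) \<and> G (x + s *\<^sub>R \<sigma>) \<in> chamber_of R \<rho>"
      using small_multiple[OF germ_G[OF g(1)], of \<sigma>] by blast
    then have s': "G x + l *\<^sub>R p (w (s *\<^sub>R \<sigma>)) \<in> chamber_of R \<rho>"
      using chamber_of_scaleR[OF self_in_chamber_of] by (metis less_imp_le)
    have "\<beta> (G x + l *\<^sub>R p (w (s *\<^sub>R \<sigma>))) = \<beta> (G x) + l * (s * \<alpha> \<sigma>)"
      by (simp add: root_linear b2)
    moreover have "0 < l * (s * \<alpha> \<sigma>)" using l s(1) \<sigma>(2) by simp
    ultimately have "0 < \<beta> (G x + l *\<^sub>R p (w (s *\<^sub>R \<sigma>)))" using that by linarith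
    then show ?thesis using root_positive_on_chamber[OF regular b(1) s'] by blast
  qed
  have agree_w: "w e = w' e" if "\<alpha> e = 0" for e
  proof (rule linear_eq_panel[OF \<sigma>(1,3,4,2) linw _ that])
    show "\<forall>\<^sub>F e in nhds 0. e \<in> chamber_of R \<sigma> \<and> e \<in> chamber_of R (\<tau> \<alpha> \<sigma>) \<longrightarrow> w e = w' e"
      using ev ev' by eventually_elim auto
  qed
  consider "\<forall>v. w' v = w (\<tau> \<alpha> v)" | "\<forall>v. w' v = w v"
    using isometries_agreeing_on_hyperplane[OF \<sigma>(1) w agree_w] by blast
  then show ?thesis
  proof cases
    case 1
    \<comment> \<open>The retraction folds.  Both germs have the same image, so the projection acts alike.\<close>
    have p_eq: "p v = p' v" for v
    proof (rule linear_eq_chamber[OF linp])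
      show "\<forall>\<^sub>F e in nhds 0. e \<in> chamber_of R (w \<sigma>) \<longrightarrow> p e = p' e"
        using pev pev'
      proof eventually_elim
        case (elim e)
        then show ?case using 1 \<alpha> py by (simp add: linear_add[OF linp(1)] linear_add[OF linp(2)])
      qed
    qed
    have lin_inv: "linear (inv w)" by (rule W_sph_linear[OF W_sph_inv[OF w(1)]])
    have "\<alpha> (inv w (z - F x)) \<le> 0"
      using fold_away_from_centre[OF g \<sigma>] 1 by blast
    moreover have "h (F x) = - l *\<^sub>R (z - F x)" by (simp add: h_eq algebra_simps)
    then have "\<beta> (G x) = - l * \<alpha> (inv w (z - F x))"
      by (simp add: bG linear_cmul[OF lin_inv] linear_neg[OF lin_inv] root_linear)
    ultimately have nonneg: "0 \<le> \<beta> (G x)" using l by (simp add: mult_nonneg_nonpos)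
    have "reflection \<beta> (\<beta> (G x)) \<in> W_aff R"
      using fold_reflection_W_aff[OF g \<sigma>(1) b(1) b2] 1 by blast
    then obtain \<delta> and j :: int where d: "\<delta> \<in> R" "hyperplane \<beta> (\<beta> (G x)) = hyperplane \<delta> (of_int j)"
      using W_aff_reflection_is_wall_reflection[OF b(1)] by blast
    obtain c where c: "\<And>v. \<delta> v = c * \<beta> v"
      using hyperplane_eq_proportional(2)[OF b(1) d(2)] unfolding proportional_def by blast
    have dG: "\<delta> (G x) \<in> \<int>" using hyperplane_eq_proportional(1)[OF b(1) d(2)] by simp
    have "c \<noteq> 0"
    proof
      assume "c = 0"
      then have "\<delta> = 0" by (intro blinfun_eqI) (simp add: c)
      then show False using root_nonzero[OF d(1)] by simp
    qed
    \<comment> \<open>The wall is a level set of some root proportional to \<open>\<beta>\<close>; choose the positive one.\<close>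
    obtain \<gamma> c' where \<gamma>: "\<gamma> \<in> R" "0 < c'" "\<And>v. \<gamma> v = c' * \<beta> v" "\<gamma> (G x) \<in> \<int>"
    proof (cases "0 < c")
      case True
      then show ?thesis using that[of \<delta> c] d(1) c dG by blast
    next
      case False
      then show ?thesis
        using that[of "- \<delta>" "- c"] \<open>c \<noteq> 0\<close> root_uminus[OF d(1)] c dG by (simp add: blinfun.minus_left)
    qed
    have "\<tau> \<gamma> = \<tau> \<beta>" using \<tau>_proportional root_nonzero \<gamma>(1,3) b(1) by metis
    then have "p' (w' v) = \<tau> \<gamma> (p (w v))" for v using 1 p_eq conj by simp
    moreover have "\<gamma> \<in> positive_roots R (chamber_of R \<rho>)"
      using \<beta>_positive[OF nonneg] \<gamma>(1-3) by (auto simp: positive_roots_def)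
    moreover have "\<gamma> (p (w v)) \<le> 0" if "\<alpha> v \<le> 0" for v
      using that \<gamma>(2) by (simp add: \<gamma>(3) b2 mult_nonneg_nonpos)
    ultimately show ?thesis using \<gamma>(4) by blast
  next
    case 2
    \<comment> \<open>The retraction does not fold; the images of the two germs are adjacent.\<close>
    obtain \<gamma> where c: "\<gamma> \<in> R" "\<And>v. \<gamma> (w v) = \<alpha> v" using W_sph_root_inv[OF w(1) \<sigma>(1)] by blast
    have tw: "\<tau> \<gamma> (w v) = w (\<tau> \<alpha> v)" for v
      using \<tau>_conjugate(2)[of \<alpha> \<gamma> w v] \<alpha> root_nonzero[OF c(1)] c(2) linw(1) W_sph_norm[OF w(1)] by blast
    have panel: "panel_point R \<gamma> (w m)"
      unfolding panel_point_def
    proof (intro conjI ballI impI)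
      show "\<gamma> (w m) = 0" using \<sigma>(4) by (simp add: c panel_point_def)
      fix \<delta> assume d: "\<delta> \<in> R" "\<delta> (w m) = 0"
      obtain \<epsilon> where e: "\<epsilon> \<in> R" "\<And>v. \<epsilon> v = \<delta> (w v)" using W_sph_root[OF w(1) d(1)] by blast
      have "\<epsilon> m = 0" using e(2) d(2) by simp
      then have "proportional \<alpha> \<epsilon>" using \<sigma>(4) e(1) unfolding panel_point_def by blast
      then obtain c' where "\<And>v. \<epsilon> v = c' * \<alpha> v" unfolding proportional_def by blast
      then have "\<delta> (w v) = c' * \<gamma> (w v)" for v using e(2) c(2) by metis
      then have "\<delta> v = c' * \<gamma> v" for v using W_sph_inv_apply(2)[OF w(1)] by metis
      then show "proportional \<gamma> \<delta>" unfolding proportional_def by blast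
    qed
    have agree_p: "p e = p' e" if "\<gamma> e = 0" for e
    proof (rule linear_eq_panel[OF c(1) _ panel _ linp _ that])
      show "w m \<in> chamber_of R (w \<sigma>)" using W_sph_chamber_of_iff[OF w(1)] \<sigma>(3) by blast
      show "0 < \<gamma> (w \<sigma>)" using c(2) \<sigma>(2) by simp
      show "\<forall>\<^sub>F e in nhds 0. e \<in> chamber_of R (w \<sigma>) \<and> e \<in> chamber_of R (\<tau> \<gamma> (w \<sigma>)) \<longrightarrow> p e = p' e"
        using pev pev'
      proof eventually_elim
        case (elim e)
        then show ?case using 2 py by (auto simp: tw linear_add[OF linp(1)] linear_add[OF linp(2)])
      qed
    qed
    consider "\<forall>v. p' v = p v" | "\<forall>v. p' v = p (\<tau> \<gamma> v)"
      using isometries_agreeing_on_hyperplane[OF c(1) p agree_p] by blast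
    then show ?thesis
    proof cases
      case 1
      then show ?thesis using 2 by simp
    next
      case refl: 2
      have "p (\<tau> \<gamma> (h (F x))) = p (h (F x))" using refl py by metis
      then have "\<tau> \<gamma> (h (F x)) = h (F x)" using W_sph_inv_apply(1)[OF p(1)] by metis
      then have "\<gamma> (h (F x)) = 0"
        using reflection_fixes_iff[OF root_nonzero[OF c(1)]] by (simp add: \<tau>_eq)
      moreover have "h (F x) = w (inv w (h (F x)))" using w(1) by simp
      ultimately have zero: "\<beta> (G x) = 0" using bG c(2) by metis
      have "p' (w' v) = \<tau> \<beta> (p (w v))" for v using 2 refl conj tw by simp
      moreover have "\<beta> (p (w v)) \<le> 0" if "\<alpha> v \<le> 0" for v using that b2 by simp
      ultimately show ?thesis using \<beta>_positive zero by (metis Ints_0 order_refl)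
    qed
  qed
qed

text \<open>
  If \<open>\<omega>\<close> is not in the chamber of \<open>\<sigma>\<close>, then some wall of this chamber separates the two.  Reflection in it
  leads to an adjacent chamber and decreases the number of separating roots, since it changes the sign of
  no root other than the multiples of the normal \<open>\<alpha>\<close>.  As \<open>\<alpha>\<close> is negative at \<open>\<omega>\<close>, it is nonpositive at
  \<open>v\<close>, so that \<open>panel_crossing\<close> provides a step of the chain, or no change of the vector if \<open>\<beta>\<close> vanishes
  at it.
\<close>

lemma gallery_chain:
  assumes "germ x \<sigma> k g w p" "germ x \<omega> k' g' w' p'" "regular_vector R \<sigma>" "regular_vector R \<omega>"
    and v: "v \<in> chamber_of R \<omega>"
  shows "(chain_step R (chamber_of R \<rho>) (G x))\<^sup>*\<^sup>* (p (w v)) (p' (w' v))"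
  using assms(1,3)
proof (induction "card {\<delta>\<in>R. 0 < blinfun_apply \<delta> \<sigma> \<and> blinfun_apply \<delta> \<omega> < 0}" arbitrary: \<sigma> k g w p rule: less_induct)
  case (less \<sigma>)
  note germ = less.prems(1)
  show ?case
  proof (cases "\<omega> \<in> chamber_of R \<sigma>")
    case True
    then have eq: "chamber_of R \<omega> = chamber_of R \<sigma>"
      by (intro open_chamber_of_regular(2)[OF less.prems(2)] regular_in_chamber_of assms(4) True)
    have W: "w \<in> W_sph R" "p \<in> W_sph R" "w' \<in> W_sph R" "p' \<in> W_sph R"
      using germ assms(2) by (auto simp: germ_def)
    have "(p \<circ> w) v = (p' \<circ> w') v"
    proof (rule linear_eq_on_chamber[OF _ _ _ v])
      show "linear (p \<circ> w)" "linear (p' \<circ> w')" using W W_sph_linear W_sph_comp by blast+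
      show "\<forall>\<^sub>F e in nhds 0. e \<in> chamber_of R \<omega> \<longrightarrow> (p \<circ> w) e = (p' \<circ> w') e"
        using germ_G[OF germ] germ_G[OF assms(2)]
      proof eventually_elim
        case (elim e)
        then show ?case using l by (auto simp: eq)
      qed
    qed
    then show ?thesis by simp
  next
    case False
    obtain S where S: "simple_roots R \<sigma> S" using ex_simple_roots[OF less.prems(2)] .
    then obtain \<alpha> where "\<alpha> \<in> S" "\<alpha> \<omega> < 0" using False by (auto simp: simple_roots_def not_le)
    then have \<alpha>: "\<alpha> \<in> R" "0 < \<alpha> \<sigma>" "\<alpha> \<omega> < 0" and "\<exists>m\<in>chamber_of R \<sigma>. panel_point R \<alpha> m"
      using S by (auto simp: simple_roots_def)
    then obtain m where m: "m \<in> chamber_of R \<sigma>" "panel_point R \<alpha> m" by blast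
    have r: "regular_vector R (\<tau> \<alpha> \<sigma>)" using W_sph_regular[OF W_sph_\<tau>[OF \<alpha>(1)] less.prems(2)] .
    obtain k1 g1 w1 p1 where g1: "germ x (\<tau> \<alpha> \<sigma>) k1 g1 w1 p1" using ex_germ[OF r] .
    let ?N = "\<lambda>\<sigma>. {\<delta>\<in>R. 0 < blinfun_apply \<delta> \<sigma> \<and> blinfun_apply \<delta> \<omega> < 0}"
    have neg: "\<alpha> (\<tau> \<alpha> \<sigma>) < 0"
      using root_reflection[OF root_nonzero[OF \<alpha>(1)], of 0 \<sigma>] \<alpha>(2) by (simp add: \<tau>_eq)
    have "?N (\<tau> \<alpha> \<sigma>) \<subseteq> ?N \<sigma>"
    proof clarify
      fix \<delta> assume d: "\<delta> \<in> R" "0 < \<delta> (\<tau> \<alpha> \<sigma>)" "\<delta> \<omega> < 0"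
      show "0 < \<delta> \<sigma>"
      proof (cases "proportional \<alpha> \<delta>")
        case True
        then obtain c where c: "\<And>v. \<delta> v = c * \<alpha> v" unfolding proportional_def by blast
        have "c < 0" using d(2) neg by (simp add: c zero_less_mult_iff)
        moreover have "0 < c" using d(3) \<alpha>(3) by (simp add: c mult_less_0_iff)
        ultimately show ?thesis by simp
      next
        case False
        then show ?thesis using panel_sign[OF m \<alpha>(1) d(1) False less.prems(2)] d(2) by simp
      qed
    qed
    moreover have "\<alpha> \<in> ?N \<sigma>" "\<alpha> \<notin> ?N (\<tau> \<alpha> \<sigma>)" using \<alpha> neg by auto
    ultimately have "?N (\<tau> \<alpha> \<sigma>) \<subset> ?N \<sigma>" by blast
    then have "card (?N (\<tau> \<alpha> \<sigma>)) < card (?N \<sigma>)"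
      using finite_roots by (intro psubset_card_mono) auto
    then have IH: "(chain_step R (chamber_of R \<rho>) (G x))\<^sup>*\<^sup>* (p1 (w1 v)) (p' (w' v))"
      using less.hyps g1 r by blast
    have av: "\<alpha> v \<le> 0" using chamber_of_neg[OF v \<alpha>(1,3)] .
    show ?thesis
      using panel_crossing[OF germ g1 \<alpha>(1,2) m]
    proof (elim disjE bexE conjE)
      assume "\<forall>v. p1 (w1 v) = p (w v)"
      then show ?thesis using IH by simp
    next
      fix \<beta> assume b: "\<beta> \<in> positive_roots R (chamber_of R \<rho>)" "blinfun_apply \<beta> (G x) \<in> \<int>"
        "\<forall>v. p1 (w1 v) = \<tau> \<beta> (p (w v))" "\<forall>v. \<alpha> v \<le> 0 \<longrightarrow> blinfun_apply \<beta> (p (w v)) \<le> 0"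
      show ?thesis
      proof (cases "\<beta> (p (w v)) = 0")
        case True
        then have "p1 (w1 v) = p (w v)" using b(3) by (simp add: \<tau>_def)
        then show ?thesis using IH by simp
      next
        case False
        then have "\<beta> (p (w v)) < 0" using b(4) av by (simp add: order_less_le)
        then have "chain_step R (chamber_of R \<rho>) (G x) (p (w v)) (p1 (w1 v))"
          unfolding chain_step_def using b(1-3) by blast
        then show ?thesis using IH by (rule converse_rtranclp_into_rtranclp)
      qed
    qed
  qed
qed

end

section \<open>Folded paths\<close>

lemma piecewise_linear_right:
  assumes "piecewise_linear c q" "0 \<le> t" "t < c"
  obtains v \<delta> where "0 < \<delta>" "t + \<delta> \<le> c" "\<And>s. 0 \<le> s \<Longrightarrow> s \<le> \<delta> \<Longrightarrow> q (t + s) = q t + s *\<^sub>R v"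
proof -
  obtain S where S: "finite S" "\<And>a b. 0 \<le> a \<and> a \<le> b \<and> b \<le> c \<and> {a<..<b} \<inter> S = {} \<Longrightarrow>
      \<exists>u v. \<forall>t\<in>{a..b}. q t = u + t *\<^sub>R v"
    using assms(1) unfolding piecewise_linear_def by blast
  define b where "b = Min (insert c {s\<in>S. t < s})"
  have fin: "finite (insert c {s\<in>S. t < s})" using S(1) by simp
  then have b: "t < b" "b \<le> c" "\<And>s. s \<in> S \<Longrightarrow> t < s \<Longrightarrow> b \<le> s"
    using assms(3) by (auto simp: b_def)
  then have "0 \<le> t \<and> t \<le> b \<and> b \<le> c \<and> {t<..<b} \<inter> S = {}" using assms(2) by force
  then obtain u v where uv: "\<forall>r\<in>{t..b}. q r = u + r *\<^sub>R v" using S(2) by blast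
  show ?thesis
  proof (rule that[of "b - t"])
    fix s assume "0 \<le> s" "s \<le> b - t"
    then have "q (t + s) = u + (t + s) *\<^sub>R v" "q t = u + t *\<^sub>R v" using uv b by simp_all
    then show "q (t + s) = q t + s *\<^sub>R v" by (simp add: algebra_simps)
  qed (use b in auto)
qed

lemma piecewise_linear_left:
  assumes "piecewise_linear c q" "0 < t" "t \<le> c"
  obtains v \<delta> where "0 < \<delta>" "\<delta> \<le> t" "\<And>s. 0 \<le> s \<Longrightarrow> s \<le> \<delta> \<Longrightarrow> q (t - s) = q t - s *\<^sub>R v"
proof -
  obtain S where S: "finite S" "\<And>a b. 0 \<le> a \<and> a \<le> b \<and> b \<le> c \<and> {a<..<b} \<inter> S = {} \<Longrightarrow>
      \<exists>u v. \<forall>t\<in>{a..b}. q t = u + t *\<^sub>R v"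
    using assms(1) unfolding piecewise_linear_def by blast
  define b where "b = Max (insert 0 {s\<in>S. s < t})"
  have fin: "finite (insert 0 {s\<in>S. s < t})" using S(1) by simp
  then have b: "b < t" "0 \<le> b" "\<And>s. s \<in> S \<Longrightarrow> s < t \<Longrightarrow> s \<le> b"
    using assms(2) by (auto simp: b_def)
  then have "0 \<le> b \<and> b \<le> t \<and> t \<le> c \<and> {b<..<t} \<inter> S = {}" using assms(3) by force
  then obtain u v where uv: "\<forall>r\<in>{b..t}. q r = u + r *\<^sub>R v" using S(2) by blast
  show ?thesis
  proof (rule that[of "t - b"])
    fix s assume "0 \<le> s" "s \<le> t - b"
    then have "q (t - s) = u + (t - s) *\<^sub>R v" "q t = u + t *\<^sub>R v" using uv b by simp_all
    then show "q (t - s) = q t - s *\<^sub>R v" by (simp add: algebra_simps)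
  qed (use b in auto)
qed

text \<open>
  By compactness: bisection reduces the claim to a neighbourhood of one parameter, which is the only break
  point there.
\<close>

lemma piecewise_linear_if_locally_linear:
  fixes q :: "real \<Rightarrow> 'v::real_normed_vector"
  assumes right: "\<And>t. 0 \<le> t \<Longrightarrow> t < c \<Longrightarrow>
      \<exists>v. \<exists>\<delta>>0. \<forall>s. 0 \<le> s \<and> s < \<delta> \<and> t + s \<le> c \<longrightarrow> q (t + s) = q t + s *\<^sub>R v"
    and left: "\<And>t. 0 < t \<Longrightarrow> t \<le> c \<Longrightarrow>
      \<exists>v. \<exists>\<delta>>0. \<forall>s. 0 \<le> s \<and> s < \<delta> \<and> 0 \<le> t - s \<longrightarrow> q (t - s) = q t - s *\<^sub>R v"
    and c: "0 \<le> c"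
  shows "piecewise_linear c q"
proof -
  let ?lin = "\<lambda>a b. \<exists>u v. \<forall>t\<in>{a..b}. q t = u + t *\<^sub>R v"
  define Q where "Q r t \<longleftrightarrow> (\<exists>S. finite S \<and>
      (\<forall>a b. 0 \<le> a \<and> a \<le> b \<and> b \<le> c \<and> r \<le> a \<and> b \<le> t \<and> {a<..<b} \<inter> S = {} \<longrightarrow> ?lin a b))" for r t
  have "Q 0 c"
  proof (rule Bolzano[OF c])
    fix r s t assume "Q r s" "Q s t"
    then obtain S T where S: "finite S"
        "\<forall>a b. 0 \<le> a \<and> a \<le> b \<and> b \<le> c \<and> r \<le> a \<and> b \<le> s \<and> {a<..<b} \<inter> S = {} \<longrightarrow> ?lin a b"
      and T: "finite T"
        "\<forall>a b. 0 \<le> a \<and> a \<le> b \<and> b \<le> c \<and> s \<le> a \<and> b \<le> t \<and> {a<..<b} \<inter> T = {} \<longrightarrow> ?lin a b"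
      unfolding Q_def by blast
    show "Q r t"
      unfolding Q_def
    proof (intro exI[of _ "insert s (S \<union> T)"] conjI allI impI)
      fix a b assume *: "0 \<le> a \<and> a \<le> b \<and> b \<le> c \<and> r \<le> a \<and> b \<le> t \<and> {a<..<b} \<inter> insert s (S \<union> T) = {}"
      then have "s \<notin> {a<..<b}" by blast
      then consider "b \<le> s" | "s \<le> a" by force
      then show "?lin a b"
      proof cases
        case 1
        moreover have "{a<..<b} \<inter> S = {}" using * by blast
        ultimately show ?thesis using S(2) * by blast
      next
        case 2
        moreover have "{a<..<b} \<inter> T = {}" using * by blast
        ultimately show ?thesis using T(2) * by blast
      qed
    qed (use S T in simp)
  next
    fix x assume x: "0 \<le> x" "x \<le> c"
    obtain v d where v: "0 < d" "\<And>s. 0 \<le> s \<Longrightarrow> s < d \<Longrightarrow> x + s \<le> c \<Longrightarrow> q (x + s) = q x + s *\<^sub>R v"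
    proof (cases "x < c")
      case True
      then show ?thesis using right[OF x(1)] that by blast
    next
      case False
      then show ?thesis using x(2) by (intro that[of 1 0]) auto
    qed
    obtain v' d' where v': "0 < d'" "\<And>s. 0 \<le> s \<Longrightarrow> s < d' \<Longrightarrow> 0 \<le> x - s \<Longrightarrow> q (x - s) = q x - s *\<^sub>R v'"
    proof (cases "0 < x")
      case True
      then show ?thesis using left[OF _ x(2)] that by blast
    next
      case False
      then show ?thesis using x(1) by (intro that[of 1 0]) auto
    qed
    have "Q r t" if rt: "r \<le> x" "x \<le> t" "t - r < min d d'" for r t
      unfolding Q_def
    proof (intro exI[of _ "{x}"] conjI allI impI)
      fix a b assume *: "0 \<le> a \<and> a \<le> b \<and> b \<le> c \<and> r \<le> a \<and> b \<le> t \<and> {a<..<b} \<inter> {x} = {}"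
      then have "x \<notin> {a<..<b}" by blast
      then consider "b \<le> x" | "x \<le> a" by force
      then show "?lin a b"
      proof cases
        case 1
        have "q s = (q x - x *\<^sub>R v') + s *\<^sub>R v'" if "s \<in> {a..b}" for s
          using v'(2)[of "x - s"] that * 1 rt by (simp add: algebra_simps)
        then show ?thesis by blast
      next
        case 2
        have "q s = (q x - x *\<^sub>R v) + s *\<^sub>R v" if "s \<in> {a..b}" for s
          using v(2)[of "s - x"] that * 2 rt by (simp add: algebra_simps)
        then show ?thesis by blast
      qed
    qed simp
    then show "\<exists>d>0. \<forall>r t. r \<le> x \<and> x \<le> t \<and> t - r < d \<longrightarrow> Q r t"
      using v(1) v'(1) by (intro exI[of _ "min d d'"]) auto
  qed
  then show ?thesis unfolding Q_def piecewise_linear_def by (meson order_trans)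
qed

lemma deriv_right_linear:
  assumes "0 < \<delta>" "\<And>s. 0 \<le> s \<Longrightarrow> s < \<delta> \<Longrightarrow> q (t + s) = q t + s *\<^sub>R v"
  shows "deriv_right q t = v"
proof -
  have lin: "((\<lambda>r. q t + (r - t) *\<^sub>R v) has_vector_derivative v) (at_right t)"
    by (auto intro!: derivative_eq_intros)
  have "(q has_vector_derivative v) (at_right t)"
  proof (rule has_vector_derivative_cong_ev[THEN iffD1, OF _ _ lin])
    show "\<forall>\<^sub>F r in nhds t. r \<in> {t<..} \<longrightarrow> q t + (r - t) *\<^sub>R v = q r"
      unfolding eventually_nhds_metric
    proof (intro exI[of _ \<delta>] conjI allI impI assms(1))
      fix r assume "dist r t < \<delta>" "r \<in> {t<..}"
      then show "q t + (r - t) *\<^sub>R v = q r" using assms(2)[of "r - t"] by (simp add: dist_real_def)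
    qed
  qed simp
  then show ?thesis unfolding deriv_right_def by (intro vector_derivative_within) auto
qed

lemma deriv_left_linear:
  assumes "0 < \<delta>" "\<And>s. 0 \<le> s \<Longrightarrow> s < \<delta> \<Longrightarrow> q (t - s) = q t - s *\<^sub>R v"
  shows "deriv_left q t = v"
proof -
  have lin: "((\<lambda>r. q t + (r - t) *\<^sub>R v) has_vector_derivative v) (at_left t)"
    by (auto intro!: derivative_eq_intros)
  have "(q has_vector_derivative v) (at_left t)"
  proof (rule has_vector_derivative_cong_ev[THEN iffD1, OF _ _ lin])
    show "\<forall>\<^sub>F r in nhds t. r \<in> {..<t} \<longrightarrow> q t + (r - t) *\<^sub>R v = q r"
      unfolding eventually_nhds_metric
    proof (intro exI[of _ \<delta>] conjI allI impI assms(1))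
      fix r assume "dist r t < \<delta>" "r \<in> {..<t}"
      then show "q t + (r - t) *\<^sub>R v = q r"
        using assms(2)[of "t - r"] by (simp add: dist_real_def algebra_simps)
    qed
  qed simp
  then show ?thesis unfolding deriv_left_def by (intro vector_derivative_within) auto
qed

context roots
begin

lemma regular_uminus: "regular_vector R \<omega> \<Longrightarrow> regular_vector R (- \<omega>)"
  by (simp add: regular_vector_def root_linear)

lemma chamber_of_uminus: "v \<in> chamber_of R \<omega> \<Longrightarrow> - v \<in> chamber_of R (- \<omega>)"
  using chamber_of_neg by (auto simp: chamber_of_def root_linear)

end

context folding
begin

lemma G_ray:
  assumes g: "germ x \<sigma> k g w p" and v: "v \<in> chamber_of R \<sigma>"
  obtains \<delta> where "0 < \<delta>" "\<And>s. 0 \<le> s \<Longrightarrow> s < \<delta> \<Longrightarrow> G (x + s *\<^sub>R v) = G x + s *\<^sub>R (l *\<^sub>R p (w v))"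
proof -
  have wp: "w \<in> W_sph R" "p \<in> W_sph R" using g by (simp_all add: germ_def)
  have "\<forall>\<^sub>F s in at_right 0. s *\<^sub>R v \<in> chamber_of R \<sigma> \<longrightarrow>
      G (x + s *\<^sub>R v) = G x + l *\<^sub>R p (w (s *\<^sub>R v)) \<and> G (x + s *\<^sub>R v) \<in> chamber_of R \<rho>"
    by (rule eventually_small_multiple[OF germ_G[OF g]])
  then obtain \<delta> where d: "0 < \<delta>" "\<And>s. 0 < s \<Longrightarrow> s < \<delta> \<Longrightarrow> s *\<^sub>R v \<in> chamber_of R \<sigma> \<longrightarrow>
      G (x + s *\<^sub>R v) = G x + l *\<^sub>R p (w (s *\<^sub>R v)) \<and> G (x + s *\<^sub>R v) \<in> chamber_of R \<rho>"
    unfolding eventually_at_right_field by blast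
  show ?thesis
  proof (rule that[OF d(1)])
    fix s :: real assume s: "0 \<le> s" "s < \<delta>"
    show "G (x + s *\<^sub>R v) = G x + s *\<^sub>R (l *\<^sub>R p (w v))"
    proof (cases "s = 0")
      case False
      then have "G (x + s *\<^sub>R v) = G x + l *\<^sub>R p (w (s *\<^sub>R v))"
        using d(2)[of s] s chamber_of_scaleR[OF v, of s] by simp
      then show ?thesis
        by (simp add: linear_cmul[OF W_sph_linear[OF wp(1)]] linear_cmul[OF W_sph_linear[OF wp(2)]])
    qed simp
  qed
qed

lemma folded_path_piecewise_linear:
  assumes q: "piecewise_linear c q" and c: "0 \<le> c"
    and r: "\<And>t. 0 \<le> t \<Longrightarrow> t \<le> c \<Longrightarrow> r t = G (q t)"
  shows "piecewise_linear c r"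
proof (rule piecewise_linear_if_locally_linear[OF _ _ c])
  have ray: "\<exists>d. \<exists>\<delta>>0. \<forall>s. 0 \<le> s \<and> s < \<delta> \<longrightarrow> G (x + s *\<^sub>R v) = G x + s *\<^sub>R d" for x v
  proof -
    obtain \<sigma> where s: "regular_vector R \<sigma>" "v \<in> chamber_of R \<sigma>" using vector_in_chamber[OF regular] .
    obtain k g w p where "germ x \<sigma> k g w p" using ex_germ[OF s(1)] .
    from G_ray[OF this s(2)] show ?thesis by metis
  qed
  fix t
  show "\<exists>v. \<exists>\<delta>>0. \<forall>s. 0 \<le> s \<and> s < \<delta> \<and> t + s \<le> c \<longrightarrow> r (t + s) = r t + s *\<^sub>R v" if t: "0 \<le> t" "t < c"
  proof -
    obtain v \<delta> where v: "0 < \<delta>" "\<And>s. 0 \<le> s \<Longrightarrow> s \<le> \<delta> \<Longrightarrow> q (t + s) = q t + s *\<^sub>R v"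
      using piecewise_linear_right[OF q t] by blast
    obtain d \<epsilon> where d: "0 < \<epsilon>" "\<And>s. 0 \<le> s \<Longrightarrow> s < \<epsilon> \<Longrightarrow> G (q t + s *\<^sub>R v) = G (q t) + s *\<^sub>R d"
      using ray[of "q t" v] by blast
    have "r (t + s) = r t + s *\<^sub>R d" if "0 \<le> s" "s < min \<delta> \<epsilon>" "t + s \<le> c" for s
      using that t v(2)[of s] d(2)[of s] by (simp add: r)
    then show ?thesis using v(1) d(1) by (intro exI[of _ d] exI[of _ "min \<delta> \<epsilon>"]) auto
  qed
  show "\<exists>v. \<exists>\<delta>>0. \<forall>s. 0 \<le> s \<and> s < \<delta> \<and> 0 \<le> t - s \<longrightarrow> r (t - s) = r t - s *\<^sub>R v" if t: "0 < t" "t \<le> c"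
  proof -
    obtain v \<delta> where v: "0 < \<delta>" "\<And>s. 0 \<le> s \<Longrightarrow> s \<le> \<delta> \<Longrightarrow> q (t - s) = q t - s *\<^sub>R v"
      using piecewise_linear_left[OF q t] by blast
    obtain d \<epsilon> where d: "0 < \<epsilon>" "\<And>s. 0 \<le> s \<Longrightarrow> s < \<epsilon> \<Longrightarrow> G (q t + s *\<^sub>R (- v)) = G (q t) + s *\<^sub>R d"
      using ray[of "q t" "- v"] by blast
    have "r (t - s) = r t - s *\<^sub>R (- d)" if "0 \<le> s" "s < min \<delta> \<epsilon>" "0 \<le> t - s" for s
      using that t v(2)[of s] d(2)[of s] by (simp add: r)
    then show ?thesis using v(1) d(1) by (intro exI[of _ "- d"] exI[of _ "min \<delta> \<epsilon>"]) auto
  qed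
qed

lemma folded_path_chain_condition:
  assumes q: "piecewise_linear c q" "unit_speed c q" and c: "0 \<le> c"
    and same: "\<forall>t\<in>{0<..<c}. same_chamber R (deriv_left q t) (deriv_right q t)"
    and r: "\<And>t. 0 \<le> t \<Longrightarrow> t \<le> c \<Longrightarrow> r t = G (q t)"
  shows "chain_condition R (chamber_of R \<rho>) c r"
  unfolding chain_condition_def
proof (intro conjI ballI folded_path_piecewise_linear[OF q(1) c r])
  fix t assume t: "t \<in> {0<..<c}"
  then have t': "0 < t" "t < c" by auto
  obtain v \<delta> where v: "0 < \<delta>" "\<delta> \<le> t" "\<And>s. 0 \<le> s \<Longrightarrow> s \<le> \<delta> \<Longrightarrow> q (t - s) = q t - s *\<^sub>R v"
    using piecewise_linear_left[OF q(1) t'(1) less_imp_le[OF t'(2)]] by blast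
  obtain v' \<delta>' where v': "0 < \<delta>'" "t + \<delta>' \<le> c" "\<And>s. 0 \<le> s \<Longrightarrow> s \<le> \<delta>' \<Longrightarrow> q (t + s) = q t + s *\<^sub>R v'"
    using piecewise_linear_right[OF q(1) less_imp_le[OF t'(1)] t'(2)] by blast
  have dl: "deriv_left q t = v" using v by (intro deriv_left_linear[of \<delta>]) auto
  have dr: "deriv_right q t = v'" using v' by (intro deriv_right_linear[of \<delta>']) auto
  have nv: "norm v = 1" "norm v' = 1" using q(2) t dl dr by (auto simp: unit_speed_def)
  obtain C where C: "C \<in> weyl_chambers R" "v \<in> C" "v' \<in> C"
    using same[rule_format, OF t] unfolding dl dr same_chamber_def by blast
  obtain \<omega> where w: "regular_vector R \<omega>" "C = chamber_of R \<omega>" using C(1) weyl_chamber_iff by blast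
  obtain k g w p where g: "germ (q t) (- \<omega>) k g w p" using ex_germ[OF regular_uminus[OF w(1)]] .
  obtain k' g' w' p' where g': "germ (q t) \<omega> k' g' w' p'" using ex_germ[OF w(1)] .
  have W: "w \<in> W_sph R" "p \<in> W_sph R" "w' \<in> W_sph R" "p' \<in> W_sph R"
    using g g' by (auto simp: germ_def)
  have norms: "norm (p (w e)) = norm e" "norm (p' (w' e)) = norm e" for e
    using W by (simp_all add: W_sph_norm)
  have rt: "r t = G (q t)" using r t by simp
  have left: "deriv_left r t = l *\<^sub>R p (w v)"
  proof -
    obtain \<epsilon> where e: "0 < \<epsilon>"
      "\<And>s. 0 \<le> s \<Longrightarrow> s < \<epsilon> \<Longrightarrow> G (q t + s *\<^sub>R (- v)) = G (q t) + s *\<^sub>R (l *\<^sub>R p (w (- v)))"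
      using G_ray[OF g chamber_of_uminus] C(2) w(2) by blast
    have neg: "p (w (- v)) = - p (w v)"
      using linear_neg[OF W_sph_linear] W(1,2) by simp
    have "r (t - s) = r t - s *\<^sub>R (l *\<^sub>R p (w v))" if "0 \<le> s" "s < min \<delta> \<epsilon>" for s
      using that t v(2) v(3)[of s] e(2)[of s] by (simp add: r neg)
    then show ?thesis using v(1) e(1) by (intro deriv_left_linear[of "min \<delta> \<epsilon>"]) auto
  qed
  have right: "deriv_right r t = l *\<^sub>R p' (w' v')"
  proof -
    obtain \<epsilon> where e: "0 < \<epsilon>"
      "\<And>s. 0 \<le> s \<Longrightarrow> s < \<epsilon> \<Longrightarrow> G (q t + s *\<^sub>R v') = G (q t) + s *\<^sub>R (l *\<^sub>R p' (w' v'))"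
      using G_ray[OF g'] C(3) w(2) by blast
    have "r (t + s) = r t + s *\<^sub>R (l *\<^sub>R p' (w' v'))" if "0 \<le> s" "s < min \<delta>' \<epsilon>" for s
      using that t v'(2) v'(3)[of s] e(2)[of s] by (simp add: r)
    then show ?thesis using v'(1) e(1) by (intro deriv_right_linear[of "min \<delta>' \<epsilon>"]) auto
  qed
  have sgn: "sgn (deriv_left r t) = p (w v)" "sgn (deriv_right r t) = p' (w' v')"
    using l nv by (simp_all add: left right sgn_div_norm norms)
  have "chain_ge R (chamber_of R \<rho>) (r t) (p (w v)) (p' (w' v))"
    unfolding chain_ge_def rt
    using gallery_chain[OF g g' regular_uminus[OF w(1)] w(1)] C(2) w(2) norms[of v] nv(1) by auto
  moreover have "same_chamber R (p' (w' v)) (p' (w' v'))"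
  proof -
    have PW: "p' \<circ> w' \<in> W_sph R" using W W_sph_comp by blast
    have "chamber_of R ((p' \<circ> w') \<omega>) \<in> weyl_chambers R"
      using weyl_chamber_iff W_sph_regular[OF PW w(1)] by blast
    moreover have "(p' \<circ> w') v \<in> chamber_of R ((p' \<circ> w') \<omega>)" "(p' \<circ> w') v' \<in> chamber_of R ((p' \<circ> w') \<omega>)"
      using W_sph_chamber_of_iff[OF PW] C(2,3) w(2) by blast+
    ultimately show ?thesis
      using norms[of v] norms[of v'] nv unfolding same_chamber_def by fastforce
  qed
  ultimately show "\<exists>\<mu>. norm \<mu> = 1 \<and> chain_ge R (chamber_of R \<rho>) (r t) (sgn (deriv_left r t)) \<mu> \<and>
        same_chamber R \<mu> (sgn (deriv_right r t))"
    using norms(2)[of v] nv(1) sgn by metis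
qed

end

theorem theorem4p16:
  fixes R :: "('v::euclidean_space \<Rightarrow>\<^sub>L real) set"
    and \<Delta> a :: "'v set"
    and charts :: "('v \<Rightarrow> 'x::metric_space) set"
    and \<iota> f :: "'v \<Rightarrow> 'x"
    and z :: 'v
    and h :: "'v \<Rightarrow> 'v"
    and A' :: "'x set"
    and p' :: "real \<Rightarrow> 'x"
    and c :: real
  assumes "root_system R"
    and "\<Delta> \<in> weyl_chambers R"
    and "euclidean_building R charts"
    and "\<iota> \<in> charts"
    and "is_vertex R z"
    and "h \<in> Dil R"
    and "h z = 0"
    and "a \<in> alcoves R"
    and "z \<in> a"
    and "A' \<in> apartments charts"
    and "0 \<le> c"
    and "p' ` {0..c} \<subseteq> A'"
    and "f \<in> charts"
    and "range f = A'"
    and "piecewise_linear c (inv f \<circ> p')"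
    and "unit_speed c (inv f \<circ> p')"
    and "\<forall>t\<in>{0<..<c}. same_chamber R (deriv_left (inv f \<circ> p') t) (deriv_right (inv f \<circ> p') t)"
  shows "chain_condition R \<Delta> c (Fold_chamber R \<Delta> charts \<iota> h a \<circ> p')"
proof -
  interpret roots R by unfold_locales (rule assms(1))
  obtain \<rho> where \<rho>: "regular_vector R \<rho>" "\<Delta> = chamber_of R \<rho>" using assms(2) weyl_chamber_iff by blast
  obtain l b where lb: "0 < l" "h = (\<lambda>x. l *\<^sub>R x + b)" "\<forall>w\<in>W_aff R. h \<circ> w \<circ> inv h \<in> W_aff R"
    using assms(6) unfolding Dil_def by blast
  interpret folding R charts \<rho> \<iota> f a z b l h
    by unfold_locales (use assms \<rho> lb in blast)+
  show ?thesis
    unfolding \<rho>(2)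
  proof (rule folded_path_chain_condition[OF assms(15,16,11,17)])
    fix t assume "0 \<le> t" "t \<le> c"
    then have "p' t \<in> range f" using assms(12,14) by auto
    then have "f (inv f (p' t)) = p' t" by (rule f_inv_into_f)
    then show "(Fold_chamber R (chamber_of R \<rho>) charts \<iota> h a \<circ> p') t = G ((inv f \<circ> p') t)"
      by (simp add: G_def)
  qed
qed

end
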